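(* Let $T\in\mathcal B(\mathcal H_n)$ be normal, fix $\mathfrak I\in\mathbb S$, put $\Omega_{\mathfrak I}^+=\sigma_S(T)\cap\mathbb C_{\mathfrak I}^+$, let $J$ be an imaginary operator with $T=A+JB$, where $A=(T+T^* )/2$, $B=|T-T^*|/2$ and $A,J,B$ mutually commute, and let $E$ be the spectral measure of $T$ (a spectral measure on $\mathscr B(\Omega_{\mathfrak I}^+)$ with which $J$ is associated, satisfying $T=\int\mathrm{Re}(\lambda)\,dE(\lambda)+\int\mathrm{Im}(\lambda)\,dE(\lambda)\,J$). For any bounded Borel measurable $f,g:\Omega_{\mathfrak I}^+\to\mathbb C_{\mathfrak I}$, the spectral integrals $\mathbb I(f),\mathbb I(g)\in\mathcal B(\mathcal H_n)$ are normal operators with the following properties: (i) $\mathbb I(\bar f)=\mathbb I(f)^*$. (ii) $\mathbb I(fg)=\mathbb I(f)\mathbb I(g)$. (iii) $\mathbb I(\mathfrak I)=J$ and $\mathbb I(cf+g)=(\mathrm{Re}(c)I+\mathrm{Im}(c)J)\,\mathbb I(f)+\mathbb I(g)$ for all $c\in\mathbb C_{\mathfrak I}$. (iv) $\langle\mathbb I(f)x,y\rangle=\int_{\Omega_{\mathfrak I}^+}\mathrm{Re}(f(\lambda))\,d\langle E(\lambda)x,y\rangle+\int_{\Omega_{\mathfrak I}^+}\mathrm{Im}(f(\lambda))\,d\langle JE(\lambda)x,y\rangle$ for all $x,y\in\mathcal H_n$. (v) $\|\mathbb I(f)x\|^2=\int_{\Omega_{\mathfrak I}^+}|f(\lambda)|^2\,d(\mathrm{Re}\langle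 E(\lambda)x,x\rangle)$ for all $x\in\mathcal H_n$. (vi) $\|\mathbb I(f)\|\le\|f\|_\infty$ (supremum norm). Moreover, $\|\mathbb I(f)\|=\|f\|_{\infty}$ ($L_\infty$-norm with respect to $E$) if and only if $f\in L_\infty(\Omega_{\mathfrak I}^+,\mathscr B(\Omega_{\mathfrak I}^+),\mathbb C_{\mathfrak I},E)$. (vii) If bounded Borel functions $f_j:\Omega_{\mathfrak I}^+\to\mathbb C_{\mathfrak I}$, $j=1,2,\dots$, converge pointwise $E$-a.e. to $f$ and there is $\kappa>0$ with $|f_j(\lambda)|\le\kappa$ for all $\lambda$ and $j$, then $\mathbb I(f_j)\to\mathbb I(f)$ in the strong operator topology. (viii) If $\Pi_\pm(J,\mathfrak I)$ denotes the projection onto the right complex subspace $\mathcal H_\pm(J,\mathfrak I)$, respectively, then $$\langle\mathbb I(f)x,y\rangle=\int_{\Omega_{\mathfrak I}^+}d\langle E(\lambda)\Pi_+(J,\mathfrak I)x,y\rangle\,f(\lambda)+\int_{\Omega_{\mathfrak I}^+}d\langle E(\lambda)\Pi_-(J,\mathfrak I)x,y\rangle\,\overline{f(\lambda)}\qquad\text{for }x,y\in\mathcal H_n.$$ (ix) If $f$ is nonnegative $E$-a.e., then $\mathbb I(f)$ is positive. (x) $\mathbb I(f)^{-1}\in\mathcal B(\mathcal H_n)$ if and only if $f(\lambda)\ne0$ $E$-a.e. and $f^{-1}\in L_\infty(\Omega_{\mathfrak I}^+,\mathscr B(\Omega_{\mathfrak I}^+),\mathbb C_{\mathfrak I},E)$.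 In this case, $\mathbb I(f)^{-1}=\mathbb I(1/f)$. (xi) The spectral measure $E_{\mathbb I(f)}$ of $\mathbb I(f)$ satisfies $E_{\mathbb I(f)}(M)=E(f^{-1}(M\cap f(\Omega_{\mathfrak I}^+)))$ for Borel $M$.
   Context: Let $n\ge1$. $\mathbb R_n$ is the real Clifford algebra (of real dimension $2^n$) generated by $e_1,\dots,e_n$ with $e_i^2=-1$ and $e_ie_j=-e_je_i$ for $i\ne j$; it has basis $e_\alpha=e_{i_1}\cdots e_{i_r}$ for $\alpha=\{i_1<\cdots<i_r\}\subseteq\{1,\dots,n\}$, $e_\emptyset=1$. For $a=\sum_\alpha a_\alpha e_\alpha$ ($a_\alpha\in\mathbb R$): $\mathrm{Re}(a)=a_\emptyset$, $|a|=(\sum_\alpha a_\alpha^2)^{1/2}$, and $a\mapsto\bar a$ is the real-linear map with $\overline{ab}=\bar b\,\bar a$, $\bar 1=1$, $\bar e_j=-e_j$. $a\succeq 0$ means $a=b\bar b$ for some $b\in\mathbb R_n$. $\mathcal H$ is a real Hilbert space and $\mathcal H_n=\mathcal H\otimes\mathbb R_n$ is the two-sided Clifford module of elements $x=\sum_\alpha x_\alpha e_\alpha$ ($x_\alpha\in\mathcal H$), with $\langle x,y\rangle=\sum_{\alpha,\beta}\bar e_\beta e_\alpha\langle x_\alpha,y_\beta\rangle_{\mathcal H}\in\mathbb R_n$ (so $\langle xa,y\rangle=\langle x,y\rangle a$) and norm $\|x\|=(\sum_\alpha\|x_\alpha\|^2)^{1/2}=(\mathrm{Re}\langle x,x\rangle)^{1/2}$.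 $\mathcal B(\mathcal H_n)$ is the set of everywhere defined bounded right $\mathbb R_n$-linear operators on $\mathcal H_n$; $T^*$ is the adjoint. $T$ is normal if $TT^*=T^*T$, self-adjoint if $T=T^*$, positive if $\langle Tx,x\rangle\succeq0$ for all $x$. A bounded positive operator has a unique bounded positive square root, and $|T|=(T^*T)^{1/2}$. An imaginary operator is a unitary $J\in\mathcal B(\mathcal H_n)$ with $J^*=-J$. An orthogonal projection is a self-adjoint $P\in\mathcal B(\mathcal H_n)$ with $P^2=P$. $\mathbb R^{n+1}$ is identified with the paravectors $s=s_0+\sum_{j=1}^n s_je_j$. $\mathbb S=\{\sum_{j=1}^n\mathfrak I_je_j:\sum\mathfrak I_j^2=1\}$ (so $\mathfrak I^2=-1$). For $\mathfrak I\in\mathbb S$, $\mathbb C_{\mathfrak I}=\{\lambda_0+\lambda_1\mathfrak I:\lambda_0,\lambda_1\in\mathbb R\}$, $\mathbb C_{\mathfrak I}^+=\{\lambda_0+\lambda_1\mathfrak I:\lambda_1\ge0\}$, $\mathrm{Re}(\lambda)=\lambda_0$, $\mathrm{Im}(\lambda)=\lambda_1\in\mathbb R$. With $\mathcal Q_s(T)=T^2-2\mathrm{Re}(s)T+|s|^2I$, the $S$-resolvent set $\rho_S(T)$ is the set of $s\in\mathbb R^{n+1}$ such that $\mathcal Q_s(T)$ has trivial kernel, dense range, and bounded inverse on its range; $\sigma_S(T)=\mathbb R^{n+1}\setminus\rho_S(T)$. A spectral measure on a $\sigma$-algebra $\mathscr A$ of subsets of $\Omega$ is a map $E$ from $\mathscr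 A$ to orthogonal projections on $\mathcal H_n$ that is countably additive (in the strong operator topology) with $E(\Omega)=I$. An imaginary operator $J$ is associated with $E$ if $JE(M)=E(M)J$ for all $M\in\mathscr A$. For a simple function $f=\sum_jc_j\chi_{M_j}$ (disjoint $M_j\in\mathscr A$, $c_j\in\mathbb C_{\mathfrak I}$), $\mathbb I(f)=\sum_j\{\mathrm{Re}(c_j)E(M_j)+\mathrm{Im}(c_j)E(M_j)J\}$; for bounded measurable $f:\Omega\to\mathbb C_{\mathfrak I}$, $\mathbb I(f)$ is the operator norm limit of $\mathbb I(f_j)$ for simple $f_j\to f$ uniformly; one also writes $\mathbb I(f)=\int\mathrm{Re}(f)\,dE+\int\mathrm{Im}(f)\,dE\,J$. The spectral measure of a bounded normal operator $N$ is the spectral measure on $\mathscr B(\sigma_S(N)\cap\mathbb C_{\mathfrak I}^+)$ (extended to $\mathscr B(\mathbb C_{\mathfrak I}^+)$ by $M\mapsto M\cap\sigma_S(N)$) representing $N$ as $\int\mathrm{Re}(\lambda)dE(\lambda)+\int\mathrm{Im}(\lambda)dE(\lambda)J$. $L_\infty(\Omega,\mathscr A,\mathbb C_{\mathfrak I},E)$ is the space of measurable functions bounded off an $E$-null set, normed by $\inf_{E(M)=0}\sup_{\lambda\in\Omega\setminus M}|f(\lambda)|$. For an $\mathbb R_n$-valued measure $\mu$ and real $h$, $\int h\,d\mu$ is defined componentwise in the basis $e_\alpha$; for $f$ with values in $\mathbb C_{\mathfrak I}$, $\int d\mu\,f=\int\mathrm{Re}(f)\,d\mu+(\int\mathrm{Im}(f)\,d\mu)\,\mathfrak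 I$. Also $\mathcal H_\pm(J,\mathfrak I)=\{x\in\mathcal H_n:Jx=x(\pm\mathfrak I)\}$, $\mathcal H_n=\mathcal H_+(J,\mathfrak I)\oplus\mathcal H_-(J,\mathfrak I)$, and $\Pi_\pm(J,\mathfrak I)$ are the projections of this decomposition, $\Pi_\pm x=\tfrac12(x\mp Jx\,\mathfrak I)$.
   Formalization: In (xi), false e.g. for constant f = −𝕀 since E_{𝕀(f)} lives on the upper half plane, f is assumed to take values in C_𝕀^+ E-a.e. (which is necessary); for all f the formula is also proved for the spectral measure of 𝕀(f) on the whole plane C_𝕀 relative to J. *)

theory Defs
  imports "HOL-Analysis.Analysis"
begin

section \<open>The Clifford algebra and Clifford modules\<close>

text \<open>
  The generators are indexed by a finite linearly ordered type \<open>'n\<close>, so the Clifford algebra is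
  the one on \<open>CARD('n)\<close> generators (at least one), with basis indexed by \<open>'n set\<close>.  Likewise
  an element of the module over a Hilbert space \<open>'h\<close> is the vector of its coefficients.
  The Euclidean norm of these vector types is the norm of the algebra and of the module.
  Beware that \<open>*\<close> and \<open>1\<close> on vector types are the componentwise ones;
  they are never used here.
\<close>

type_synonym 'n clifford = "real ^ ('n set)"
type_synonym ('h, 'n) cmodule = "'h ^ ('n set)"
type_synonym ('h, 'n) cop = "('h ^ ('n set)) \<Rightarrow>\<^sub>L ('h ^ ('n set))"

text \<open>
  Reordering \<open>e\<^sub>\<alpha> e\<^sub>\<beta>\<close> costs one sign for each pair \<open>j < i\<close> (a transposition) and one for each
  pair \<open>j = i\<close> (as \<open>e\<^sub>i e\<^sub>i = -1\<close>), where \<open>i \<in> \<alpha>\<close>, \<open>j \<in> \<beta>\<close>; what remains is the basis element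
  of the symmetric difference.
\<close>

definition cl_sign :: "('n::{finite,linorder}) set \<Rightarrow> 'n set \<Rightarrow> real" where
  "cl_sign \<alpha> \<beta> = (\<Prod>i\<in>\<alpha>. \<Prod>j\<in>\<beta>. if j \<le> i then -1 else 1)"

text \<open>
  Right multiplication \<open>x a\<close> on the module.  For \<open>'h = real\<close> it is the product of the algebra.
\<close>

definition cl_mult ::
  "('h::real_vector, 'n::{finite,linorder}) cmodule \<Rightarrow> 'n clifford \<Rightarrow> ('h, 'n) cmodule"
  (infixl "\<odot>" 70) where
  "x \<odot> a = (\<Sum>\<alpha>\<in>UNIV. \<Sum>\<beta>\<in>UNIV.
              axis (sym_diff \<alpha> \<beta>) ((cl_sign \<alpha> \<beta> * a $ \<beta>) *\<^sub>R (x $ \<alpha>)))"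

definition cl_basis :: "('n::{finite,linorder}) set \<Rightarrow> 'n clifford" where
  "cl_basis \<alpha> = axis \<alpha> 1"

definition cl_one :: "('n::{finite,linorder}) clifford" where
  "cl_one = cl_basis {}"

definition cl_gen :: "'n::{finite,linorder} \<Rightarrow> 'n clifford" where
  "cl_gen j = cl_basis {j}"

text \<open>
  The conjugate of \<open>e\<^sub>\<alpha>\<close> is its inverse, which is \<open>e\<^sub>\<alpha>\<close> up to the sign of \<open>e\<^sub>\<alpha> e\<^sub>\<alpha>\<close>.
\<close>

definition cl_conj :: "('n::{finite,linorder}) clifford \<Rightarrow> 'n clifford" where
  "cl_conj a = (\<chi> \<alpha>. cl_sign \<alpha> \<alpha> * a $ \<alpha>)"

definition cl_re :: "('n::{finite,linorder}) clifford \<Rightarrow> real" where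
  "cl_re a = a $ {}"

definition cl_nonneg :: "('n::{finite,linorder}) clifford \<Rightarrow> bool" where
  "cl_nonneg a \<longleftrightarrow> (\<exists>b. a = b \<odot> cl_conj b)"

definition cl_inner ::
  "('h::real_inner, 'n::{finite,linorder}) cmodule \<Rightarrow> ('h, 'n) cmodule \<Rightarrow> 'n clifford" where
  "cl_inner x y = (\<Sum>\<alpha>\<in>UNIV. \<Sum>\<beta>\<in>UNIV.
      (x $ \<alpha> \<bullet> y $ \<beta>) *\<^sub>R (cl_conj (cl_basis \<beta>) \<odot> cl_basis \<alpha>))"

definition paravectors :: "('n::{finite,linorder}) clifford set" where
  "paravectors = {s0 *\<^sub>R cl_one + (\<Sum>j\<in>UNIV. t j *\<^sub>R cl_gen j) | s0 t. True}"

definition cl_sphere :: "('n::{finite,linorder}) clifford set" where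
  "cl_sphere = {(\<Sum>j\<in>UNIV. t j *\<^sub>R cl_gen j) | t. (\<Sum>j\<in>UNIV. (t j)\<^sup>2) = 1}"

definition cplane :: "('n::{finite,linorder}) clifford \<Rightarrow> 'n clifford set" where
  "cplane \<II> = {a *\<^sub>R cl_one + b *\<^sub>R \<II> | a b. True}"

definition cplane_upper :: "('n::{finite,linorder}) clifford \<Rightarrow> 'n clifford set" where
  "cplane_upper \<II> = {a *\<^sub>R cl_one + b *\<^sub>R \<II> | a b. b \<ge> 0}"

definition cl_im :: "('n::{finite,linorder}) clifford \<Rightarrow> 'n clifford \<Rightarrow> real" where
  "cl_im \<II> c = c \<bullet> \<II>"

text \<open>The multiplicative inverse on paravectors (with value 0 at 0).\<close>

definition cl_inverse :: "('n::{finite,linorder}) clifford \<Rightarrow> 'n clifford" where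
  "cl_inverse a = (1 / (norm a)\<^sup>2) *\<^sub>R cl_conj a"


subsection \<open>Basic laws\<close>

lemma prod_sym_diff_sign:
  fixes f :: "'a::finite \<Rightarrow> real"
  assumes "\<And>i. f i * f i = 1"
  shows "prod f (sym_diff A B) = prod f A * prod f B"
proof -
  have sq: "prod f C * prod f C = 1" for C
    by (simp add: assms flip: prod.distrib)
  have "prod f A = prod f (A - B) * prod f (A \<inter> B)"
    by (subst prod.union_disjoint[symmetric]) (auto intro!: prod.cong)
  moreover have "prod f B = prod f (B - A) * prod f (A \<inter> B)"
    by (subst prod.union_disjoint[symmetric]) (auto intro!: prod.cong)
  moreover have "prod f (sym_diff A B) = prod f (A - B) * prod f (B - A)"
    by (subst prod.union_disjoint[symmetric]) (auto intro!: prod.cong)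
  ultimately show ?thesis
    using sq[of "A \<inter> B"] by (simp add: algebra_simps)
qed

lemma cl_sign_square: "cl_sign \<alpha> \<beta> * cl_sign \<alpha> \<beta> = 1"
  by (auto simp: cl_sign_def simp flip: prod.distrib intro!: prod.neutral)

lemma cl_sign_sym_diff_left: "cl_sign (sym_diff \<alpha> \<beta>) \<gamma> = cl_sign \<alpha> \<gamma> * cl_sign \<beta> \<gamma>"
  unfolding cl_sign_def
  by (rule prod_sym_diff_sign) (auto simp flip: prod.distrib intro!: prod.neutral)

lemma cl_sign_sym_diff_right: "cl_sign \<alpha> (sym_diff \<beta> \<gamma>) = cl_sign \<alpha> \<beta> * cl_sign \<alpha> \<gamma>"
  unfolding cl_sign_def
  by (subst prod_sym_diff_sign) (auto simp: prod.distrib)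

lemma cl_sign_empty [simp]: "cl_sign {} \<beta> = 1" "cl_sign \<alpha> {} = 1"
  by (auto simp: cl_sign_def)

lemma cl_mult_nth:
  "(x \<odot> a) $ \<gamma> = (\<Sum>\<beta>\<in>UNIV. (cl_sign (sym_diff \<gamma> \<beta>) \<beta> * a $ \<beta>) *\<^sub>R (x $ sym_diff \<gamma> \<beta>))"
proof -
  have eq: "\<gamma> = sym_diff \<alpha> \<beta> \<longleftrightarrow> \<alpha> = sym_diff \<gamma> \<beta>" for \<alpha> \<beta> :: "'b set"
    by blast
  have "(x \<odot> a) $ \<gamma> = (\<Sum>\<beta>\<in>UNIV. \<Sum>\<alpha>\<in>UNIV. if \<alpha> = sym_diff \<gamma> \<beta>
      then (cl_sign \<alpha> \<beta> * a $ \<beta>) *\<^sub>R (x $ \<alpha>) else 0)"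
    unfolding cl_mult_def by (subst sum.swap) (simp add: axis_def eq)
  then show ?thesis
    by simp
qed

lemma cl_mult_assoc: "(x \<odot> a) \<odot> b = x \<odot> (a \<odot> b)"
proof (rule vec_eq_iff[THEN iffD2], rule allI)
  fix \<gamma>
  have arr: "p * u * (q * v) = r * (s * u * v)" if "p * q = r * s" for p q r s u v :: real
    using arg_cong[OF that, of "\<lambda>t. t * (u * v)"] by (simp add: mult.assoc mult.left_commute)
  have bij: "bij_betw (\<lambda>\<delta>. sym_diff \<delta> \<beta>) UNIV UNIV" for \<beta> :: "'b set"
    by (rule bij_betw_byWitness[where f' = "\<lambda>\<delta>. sym_diff \<delta> \<beta>"]) auto
  have sd: "sym_diff (sym_diff \<gamma> \<beta>) (sym_diff \<delta> \<beta>) = sym_diff \<gamma> \<delta>" for \<beta> \<delta> :: "'b set"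
    by blast
  have "((x \<odot> a) \<odot> b) $ \<gamma> = (\<Sum>\<beta>\<in>UNIV. \<Sum>\<delta>\<in>UNIV.
      (cl_sign (sym_diff \<gamma> \<beta>) \<beta> * b $ \<beta> *
       (cl_sign (sym_diff (sym_diff \<gamma> \<beta>) \<delta>) \<delta> * a $ \<delta>)) *\<^sub>R
      (x $ sym_diff (sym_diff \<gamma> \<beta>) \<delta>))"
    by (simp add: cl_mult_nth scaleR_sum_right)
  also have "\<dots> = (\<Sum>\<beta>\<in>UNIV. \<Sum>\<delta>\<in>UNIV.
      (cl_sign (sym_diff \<gamma> \<beta>) \<beta> * b $ \<beta> *
       (cl_sign (sym_diff \<gamma> \<delta>) (sym_diff \<delta> \<beta>) * a $ (sym_diff \<delta> \<beta>))) *\<^sub>R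
      (x $ sym_diff \<gamma> \<delta>))"
  proof (rule sum.cong[OF refl])
    fix \<beta> :: "'b set"
    show "(\<Sum>\<delta>\<in>UNIV.
      (cl_sign (sym_diff \<gamma> \<beta>) \<beta> * b $ \<beta> *
       (cl_sign (sym_diff (sym_diff \<gamma> \<beta>) \<delta>) \<delta> * a $ \<delta>)) *\<^sub>R
      (x $ sym_diff (sym_diff \<gamma> \<beta>) \<delta>)) =
      (\<Sum>\<delta>\<in>UNIV.
      (cl_sign (sym_diff \<gamma> \<beta>) \<beta> * b $ \<beta> *
       (cl_sign (sym_diff \<gamma> \<delta>) (sym_diff \<delta> \<beta>) * a $ (sym_diff \<delta> \<beta>))) *\<^sub>R
      (x $ sym_diff \<gamma> \<delta>))"
      by (subst sum.reindex_bij_betw[OF bij[of \<beta>], symmetric]) (simp only: sd)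
  qed
  also have "\<dots> = (\<Sum>\<beta>\<in>UNIV. \<Sum>\<delta>\<in>UNIV.
      (cl_sign (sym_diff \<gamma> \<delta>) \<delta> * (cl_sign (sym_diff \<delta> \<beta>) \<beta> * b $ \<beta> * a $ (sym_diff \<delta> \<beta>))) *\<^sub>R
      (x $ sym_diff \<gamma> \<delta>))"
  proof (intro sum.cong refl arg_cong2[where f = scaleR])
    fix \<beta> \<delta> :: "'b set"
    have "cl_sign (sym_diff \<gamma> \<beta>) \<beta> * cl_sign (sym_diff \<gamma> \<delta>) (sym_diff \<delta> \<beta>) =
        cl_sign \<gamma> \<delta> * cl_sign \<delta> \<delta> * cl_sign \<delta> \<beta> * cl_sign \<beta> \<beta> * (cl_sign \<gamma> \<beta> * cl_sign \<gamma> \<beta>)"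
      unfolding cl_sign_sym_diff_left cl_sign_sym_diff_right by (simp only: mult.assoc mult.commute mult.left_commute)
    also have "\<dots> = cl_sign (sym_diff \<gamma> \<delta>) \<delta> * cl_sign (sym_diff \<delta> \<beta>) \<beta>"
      unfolding cl_sign_sym_diff_left cl_sign_square by (simp add: mult.assoc)
    finally show "cl_sign (sym_diff \<gamma> \<beta>) \<beta> * b $ \<beta> *
       (cl_sign (sym_diff \<gamma> \<delta>) (sym_diff \<delta> \<beta>) * a $ (sym_diff \<delta> \<beta>)) =
       cl_sign (sym_diff \<gamma> \<delta>) \<delta> * (cl_sign (sym_diff \<delta> \<beta>) \<beta> * b $ \<beta> * a $ (sym_diff \<delta> \<beta>))"
      by (rule arr)
  qed
  also have "\<dots> = (x \<odot> (a \<odot> b)) $ \<gamma>"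
    by (subst sum.swap)
       (simp add: cl_mult_nth scaleR_sum_left sum_distrib_left)
  finally show "((x \<odot> a) \<odot> b) $ \<gamma> = (x \<odot> (a \<odot> b)) $ \<gamma>" .
qed

lemma cl_mult_one_right [simp]: "x \<odot> cl_one = x"
  by (simp add: vec_eq_iff cl_mult_nth cl_one_def cl_basis_def axis_def
        if_distrib[of "\<lambda>t. (_ * t) *\<^sub>R _"] if_distrib[of "\<lambda>t. t *\<^sub>R _"] cong: if_cong)

lemma cl_mult_basis: "cl_basis \<alpha> \<odot> cl_basis \<beta> = cl_sign \<alpha> \<beta> *\<^sub>R cl_basis (sym_diff \<alpha> \<beta>)"
proof -
  have eq: "sym_diff \<gamma> \<beta> = \<alpha> \<longleftrightarrow> \<gamma> = sym_diff \<alpha> \<beta>" for \<gamma>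
    by blast
  have "(cl_basis \<alpha> \<odot> cl_basis \<beta>) $ \<gamma> =
      (\<Sum>\<beta>'\<in>UNIV. if \<beta>' = \<beta> then cl_sign (sym_diff \<gamma> \<beta>) \<beta> * (if sym_diff \<gamma> \<beta> = \<alpha> then 1 else 0) else 0)"
    for \<gamma>
    unfolding cl_mult_nth cl_basis_def by (intro sum.cong refl) (simp add: axis_def)
  then show ?thesis
    by (simp add: vec_eq_iff cl_basis_def axis_def eq)
       (metis eq)
qed

lemma cl_mult_add_left: "(x + y) \<odot> a = x \<odot> a + y \<odot> a"
  by (simp add: vec_eq_iff cl_mult_nth scaleR_add_right sum.distrib)

lemma cl_mult_add_right: "x \<odot> (a + b) = x \<odot> a + x \<odot> b"
  by (simp add: vec_eq_iff cl_mult_nth scaleR_add_left sum.distrib distrib_left)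

lemma cl_mult_scaleR_left: "(r *\<^sub>R x) \<odot> a = r *\<^sub>R (x \<odot> a)"
  by (simp add: vec_eq_iff cl_mult_nth scaleR_sum_right ac_simps)

lemma cl_mult_scaleR_right: "x \<odot> (r *\<^sub>R a) = r *\<^sub>R (x \<odot> a)"
  by (simp add: vec_eq_iff cl_mult_nth scaleR_sum_right ac_simps)

lemma cl_mult_minus_right: "x \<odot> (- a) = - (x \<odot> a)"
  using cl_mult_scaleR_right[of x "-1" a] by simp

lemma cl_mult_diff_right: "x \<odot> (a - b) = x \<odot> a - x \<odot> b"
  using cl_mult_add_right[of x a "- b"] by (simp add: cl_mult_minus_right)

lemma cl_mult_one_left [simp]: "cl_one \<odot> a = a"
proof -
  have eq: "sym_diff \<gamma> \<beta> = {} \<longleftrightarrow> \<beta> = \<gamma>" for \<gamma> \<beta> :: "'a set"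
    by blast
  have "(cl_one \<odot> a) $ \<gamma> = (\<Sum>\<beta>\<in>UNIV. if \<beta> = \<gamma> then a $ \<beta> else 0)" for \<gamma>
    unfolding cl_mult_nth cl_basis_def cl_one_def by (intro sum.cong refl) (auto simp: axis_def eq)
  then show ?thesis
    by (simp add: vec_eq_iff)
qed

lemma cl_gen_square: "cl_gen i \<odot> cl_gen i = - cl_one"
  by (simp add: cl_gen_def cl_mult_basis cl_one_def cl_sign_def)

lemma cl_gen_anticommute: "i \<noteq> j \<Longrightarrow> cl_gen i \<odot> cl_gen j = - (cl_gen j \<odot> cl_gen i)"
  by (auto simp: cl_gen_def cl_mult_basis cl_sign_def Un_commute)

lemma cl_basis_insert_greater:
  assumes "\<And>j. j \<in> \<alpha> \<Longrightarrow> j < i"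
  shows "cl_basis (insert i \<alpha>) = cl_basis \<alpha> \<odot> cl_gen i"
proof -
  have "cl_sign \<alpha> {i} = 1"
    using assms by (force simp: cl_sign_def intro!: prod.neutral)
  moreover have "sym_diff \<alpha> {i} = insert i \<alpha>"
    using assms by auto
  ultimately show ?thesis
    by (simp add: cl_gen_def cl_mult_basis del: Diff_insert0)
qed

lemma cl_conj_one [simp]: "cl_conj cl_one = cl_one"
  by (auto simp: cl_conj_def cl_one_def cl_basis_def axis_def vec_eq_iff)

lemma cl_conj_gen: "cl_conj (cl_gen j) = - cl_gen j"
  by (auto simp: cl_conj_def cl_gen_def cl_basis_def axis_def vec_eq_iff cl_sign_def)

lemma cl_conj_add: "cl_conj (a + b) = cl_conj a + cl_conj b"
  by (simp add: cl_conj_def vec_eq_iff distrib_left)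

lemma cl_conj_scaleR: "cl_conj (r *\<^sub>R a) = r *\<^sub>R cl_conj a"
  by (simp add: cl_conj_def vec_eq_iff)

lemma cl_conj_sum: "cl_conj (sum f A) = (\<Sum>i\<in>A. cl_conj (f i))"
  by (simp add: cl_conj_def vec_eq_iff sum_distrib_left)

lemma cl_conj_mult: "cl_conj (a \<odot> b) = cl_conj b \<odot> cl_conj a"
proof (rule vec_eq_iff[THEN iffD2], rule allI)
  fix \<gamma> :: "'a set"
  have bij: "bij_betw (\<lambda>\<delta>. sym_diff \<gamma> \<delta>) UNIV UNIV"
    by (rule bij_betw_byWitness[where f' = "\<lambda>\<delta>. sym_diff \<gamma> \<delta>"]) auto
  have sd: "sym_diff \<gamma> (sym_diff \<gamma> \<beta>) = \<beta>" for \<beta> :: "'a set"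
    by blast
  have sgn: "cl_sign \<gamma> \<gamma> * cl_sign (sym_diff \<gamma> \<beta>) \<beta> =
      cl_sign \<beta> (sym_diff \<gamma> \<beta>) * cl_sign \<beta> \<beta> * cl_sign (sym_diff \<gamma> \<beta>) (sym_diff \<gamma> \<beta>)" for \<beta>
    using cl_sign_square[of \<beta> \<gamma>] cl_sign_square[of \<beta> \<beta>]
    by (simp add: cl_sign_sym_diff_left cl_sign_sym_diff_right algebra_simps)
  have "cl_conj (a \<odot> b) $ \<gamma> =
      (\<Sum>\<beta>\<in>UNIV. (cl_sign \<gamma> \<gamma> * cl_sign (sym_diff \<gamma> \<beta>) \<beta>) * (b $ \<beta> * a $ sym_diff \<gamma> \<beta>))"
    by (simp add: cl_conj_def cl_mult_nth sum_distrib_left mult.assoc)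
  also have "\<dots> = (\<Sum>\<beta>\<in>UNIV. cl_sign \<beta> (sym_diff \<gamma> \<beta>) *
      cl_conj a $ sym_diff \<gamma> \<beta> * cl_conj b $ \<beta>)"
    unfolding sgn by (simp add: cl_conj_def ac_simps)
  also have "\<dots> = (\<Sum>\<beta>\<in>UNIV. cl_sign (sym_diff \<gamma> \<beta>) \<beta> *
      cl_conj a $ \<beta> * cl_conj b $ sym_diff \<gamma> \<beta>)"
    by (subst sum.reindex_bij_betw[OF bij, symmetric]) (simp only: sd)
  also have "\<dots> = (cl_conj b \<odot> cl_conj a) $ \<gamma>"
    by (simp add: cl_mult_nth)
  finally show "cl_conj (a \<odot> b) $ \<gamma> = (cl_conj b \<odot> cl_conj a) $ \<gamma>" .
qed

lemma cl_gen_nth: "cl_gen j $ \<alpha> = (if \<alpha> = {j} then 1 else 0)"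
  by (simp add: cl_gen_def cl_basis_def axis_def)

lemma cl_mult_sum_left: "(\<Sum>i\<in>A. f i) \<odot> a = (\<Sum>i\<in>A. f i \<odot> a)"
  by (induction A rule: infinite_finite_induct)
     (simp_all add: cl_mult_add_left, simp_all add: cl_mult_def vec_eq_iff axis_def)

lemma cl_mult_sum_right: "x \<odot> (\<Sum>i\<in>A. f i) = (\<Sum>i\<in>A. x \<odot> f i)"
  by (induction A rule: infinite_finite_induct)
     (simp_all add: cl_mult_add_right, simp_all add: cl_mult_def vec_eq_iff axis_def)

lemma cl_sphere_square:
  assumes "\<II> \<in> cl_sphere"
  shows "\<II> \<odot> \<II> = - cl_one"
proof -
  obtain t where t: "\<II> = (\<Sum>j\<in>UNIV. t j *\<^sub>R cl_gen j)" "(\<Sum>j\<in>UNIV. (t j)\<^sup>2) = 1"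
    using assms by (auto simp: cl_sphere_def)
  let ?g = "\<lambda>i j. (t i * t j) *\<^sub>R (cl_gen i \<odot> cl_gen j)"
  have S: "\<II> \<odot> \<II> = (\<Sum>i\<in>UNIV. \<Sum>j\<in>UNIV. ?g j i)"
    by (simp add: t cl_mult_sum_left cl_mult_sum_right cl_mult_scaleR_left cl_mult_scaleR_right
        scaleR_sum_right mult.commute)
  also have "\<dots> = (\<Sum>i\<in>UNIV. \<Sum>j\<in>UNIV. ?g i j)"
    by (rule sum.swap)
  finally have S': "\<II> \<odot> \<II> = (\<Sum>i\<in>UNIV. \<Sum>j\<in>UNIV. ?g i j)" .
  have g: "?g i j + ?g j i = (if i = j then (-2 * (t i)\<^sup>2) *\<^sub>R cl_one else 0)" for i j
  proof (cases "i = j")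
    case True
    then show ?thesis
      by (simp add: cl_gen_square power2_eq_square flip: scaleR_2 scaleR_minus_left)
  next
    case False
    then show ?thesis
      by (simp add: cl_gen_anticommute[of i j] mult.commute)
  qed
  have "2 *\<^sub>R (\<II> \<odot> \<II>) = (\<Sum>i\<in>UNIV. \<Sum>j\<in>UNIV. ?g i j + ?g j i)"
    using S S' by (simp add: sum.distrib scaleR_2)
  also have "\<dots> = (\<Sum>i\<in>UNIV. (-2 * (t i)\<^sup>2) *\<^sub>R cl_one)"
    unfolding g by simp
  also have "\<dots> = (-2 * (\<Sum>i\<in>UNIV. (t i)\<^sup>2)) *\<^sub>R cl_one"
    by (simp only: sum_distrib_left scaleR_sum_left)
  finally have "2 *\<^sub>R (\<II> \<odot> \<II>) = 2 *\<^sub>R (- cl_one)"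
    by (simp add: t)
  then show ?thesis
    by (simp only: scaleR_cancel_left) simp
qed

lemma cl_sphere_conj: "\<II> \<in> cl_sphere \<Longrightarrow> cl_conj \<II> = - \<II>"
  by (auto simp: cl_sphere_def cl_conj_sum cl_conj_scaleR cl_conj_gen sum_negf)

lemma cl_sphere_orth: "\<II> \<in> cl_sphere \<Longrightarrow> cl_one \<bullet> \<II> = 0"
  by (auto simp: cl_sphere_def inner_sum_right cl_one_def cl_basis_def inner_axis' cl_gen_nth)

lemma cl_re_conj_basis_mult:
  "cl_re (cl_conj (cl_basis \<beta>) \<odot> cl_basis \<alpha>) = (if \<alpha> = \<beta> then 1 else 0)"
proof -
  have "cl_conj (cl_basis \<beta>) = cl_sign \<beta> \<beta> *\<^sub>R cl_basis \<beta>"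
    by (auto simp: vec_eq_iff cl_conj_def cl_basis_def axis_def)
  moreover have "{} = sym_diff \<beta> \<alpha> \<longleftrightarrow> \<alpha> = \<beta>"
    by blast
  ultimately show ?thesis
    by (simp add: cl_mult_scaleR_left cl_mult_basis cl_re_def cl_sign_square)
       (auto simp: cl_basis_def axis_def cl_sign_square)
qed

lemma cl_re_inner_self: "cl_re (cl_inner x x) = (norm x)\<^sup>2"
proof -
  have "cl_re (cl_inner x x) =
      (\<Sum>\<alpha>\<in>UNIV. \<Sum>\<beta>\<in>UNIV. (x $ \<alpha> \<bullet> x $ \<beta>) * cl_re (cl_conj (cl_basis \<beta>) \<odot> cl_basis \<alpha>))"
    by (simp add: cl_inner_def cl_re_def)
  also have "\<dots> = (\<Sum>\<alpha>\<in>UNIV. x $ \<alpha> \<bullet> x $ \<alpha>)"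
    by (simp add: cl_re_conj_basis_mult if_distrib cong: if_cong)
  also have "\<dots> = x \<bullet> x"
    by (simp add: inner_vec_def)
  finally show ?thesis
    by (simp add: power2_norm_eq_inner)
qed

lemma cl_sphere_norm:
  assumes "\<II> \<in> cl_sphere"
  shows "norm \<II> = 1"
proof -
  obtain t where t: "\<II> = (\<Sum>j\<in>UNIV. t j *\<^sub>R cl_gen j)" "(\<Sum>j\<in>UNIV. (t j)\<^sup>2) = 1"
    using assms by (auto simp: cl_sphere_def)
  have "\<II> \<bullet> \<II> = (\<Sum>i\<in>UNIV. \<Sum>j\<in>UNIV. t i * t j * (cl_gen j \<bullet> cl_gen i))"
    by (simp add: t inner_sum_left inner_sum_right sum_distrib_left mult.assoc)
  also have "\<dots> = (\<Sum>i\<in>UNIV. \<Sum>j\<in>UNIV. if i = j then t i * t i else 0)"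
    by (intro sum.cong refl) (simp add: cl_gen_def cl_basis_def inner_axis_axis)
  finally have "\<II> \<bullet> \<II> = 1"
    using t(2) by (simp add: power2_eq_square)
  then show ?thesis
    by (simp add: norm_eq_1)
qed

lemma cplane_re_im:
  assumes "\<II> \<in> cl_sphere"
  shows "cl_re (a *\<^sub>R cl_one + b *\<^sub>R \<II>) = a" "cl_im \<II> (a *\<^sub>R cl_one + b *\<^sub>R \<II>) = b"
proof -
  have "\<II> $ {} = 0"
    using cl_sphere_orth[OF assms] by (simp add: cl_one_def cl_basis_def inner_axis')
  then show "cl_re (a *\<^sub>R cl_one + b *\<^sub>R \<II>) = a"
    by (simp add: cl_re_def cl_one_def cl_basis_def axis_def)
  show "cl_im \<II> (a *\<^sub>R cl_one + b *\<^sub>R \<II>) = b"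
    using cl_sphere_orth[OF assms] cl_sphere_norm[OF assms]
    by (simp add: cl_im_def inner_add_left norm_eq_1)
qed

lemma cplane_inverse:
  assumes "\<II> \<in> cl_sphere" "c \<in> cplane \<II>" "c \<noteq> 0"
  shows "c \<odot> cl_inverse c = cl_one"
proof -
  obtain a b where c: "c = a *\<^sub>R cl_one + b *\<^sub>R \<II>"
    using assms by (auto simp: cplane_def)
  have 1: "(cl_one :: 'a clifford) \<bullet> cl_one = 1"
    by (simp add: cl_one_def cl_basis_def inner_axis_axis)
  have 2: "\<II> \<bullet> \<II> = 1"
    using cl_sphere_norm[OF assms(1)] by (simp add: norm_eq_1)
  have "(norm c)\<^sup>2 = c \<bullet> c"
    by (rule power2_norm_eq_inner)
  also have "\<dots> = a * a + b * b"
    using cl_sphere_orth[OF assms(1)]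
    by (simp add: c inner_add_left inner_add_right 1 2 inner_commute[of \<II> cl_one])
  finally have n: "(norm c)\<^sup>2 = a * a + b * b" .
  have "c \<odot> cl_conj c = (a * a + b * b) *\<^sub>R cl_one"
    using cl_sphere_square[OF assms(1)]
    by (simp add: c cl_conj_add cl_conj_scaleR cl_sphere_conj[OF assms(1)] cl_mult_add_left
        cl_mult_add_right cl_mult_scaleR_left cl_mult_scaleR_right cl_mult_diff_right
        scaleR_add_left scaleR_add_right scaleR_diff_right mult.commute)
  then show ?thesis
    using assms(3) by (simp add: cl_inverse_def cl_mult_scaleR_right flip: n)
qed


section \<open>Operators\<close>

text \<open>
  \<open>\<Rightarrow>\<^sub>L\<close> is the Banach space of bounded real-linear maps with the operator norm; the
  operators considered are its right Clifford-linear elements.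
\<close>

definition cl_ops :: "('h::real_normed_vector, 'n::{finite,linorder}) cop set" where
  "cl_ops = {T :: ('h, 'n) cop. \<forall>x a. T (x \<odot> a) = T x \<odot> a}"

definition cl_adjoint ::
  "('h::real_inner, 'n::{finite,linorder}) cop \<Rightarrow> ('h, 'n) cop" where
  "cl_adjoint T = (THE S. S \<in> cl_ops \<and> (\<forall>x y. cl_inner (T x) y = cl_inner x (S y)))"

definition cl_normal :: "('h::real_inner, 'n::{finite,linorder}) cop \<Rightarrow> bool" where
  "cl_normal T \<longleftrightarrow> T o\<^sub>L cl_adjoint T = cl_adjoint T o\<^sub>L T"

definition cl_positive :: "('h::real_inner, 'n::{finite,linorder}) cop \<Rightarrow> bool" where
  "cl_positive T \<longleftrightarrow> (\<forall>x. cl_nonneg (cl_inner (T x) x))"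

definition cl_abs :: "('h::real_inner, 'n::{finite,linorder}) cop \<Rightarrow> ('h, 'n) cop" where
  "cl_abs T = (THE R. R \<in> cl_ops \<and> cl_positive R \<and> R o\<^sub>L R = cl_adjoint T o\<^sub>L T)"

definition cl_imaginary :: "('h::real_inner, 'n::{finite,linorder}) cop \<Rightarrow> bool" where
  "cl_imaginary J \<longleftrightarrow> J \<in> cl_ops \<and>
     J o\<^sub>L cl_adjoint J = id_blinfun \<and> cl_adjoint J o\<^sub>L J = id_blinfun \<and> cl_adjoint J = - J"

definition cl_projection :: "('h::real_inner, 'n::{finite,linorder}) cop \<Rightarrow> bool" where
  "cl_projection P \<longleftrightarrow> P \<in> cl_ops \<and> cl_adjoint P = P \<and> P o\<^sub>L P = P"

definition cl_inverse_op ::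
  "('h::real_inner, 'n::{finite,linorder}) cop \<Rightarrow> ('h, 'n) cop \<Rightarrow> bool" where
  "cl_inverse_op T R \<longleftrightarrow> R \<in> cl_ops \<and> T o\<^sub>L R = id_blinfun \<and> R o\<^sub>L T = id_blinfun"

definition S_quadratic ::
  "('h::real_inner, 'n::{finite,linorder}) cop \<Rightarrow> 'n clifford \<Rightarrow> ('h, 'n) cop" where
  "S_quadratic T s = (T o\<^sub>L T) - (2 * cl_re s) *\<^sub>R T + (norm s)\<^sup>2 *\<^sub>R id_blinfun"

definition S_resolvent_set ::
  "('h::real_inner, 'n::{finite,linorder}) cop \<Rightarrow> 'n clifford set" where
  "S_resolvent_set T = {s \<in> paravectors.
     (\<forall>x. S_quadratic T s x = 0 \<longrightarrow> x = 0) \<and>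
     closure (range (S_quadratic T s)) = UNIV \<and>
     (\<exists>K. \<forall>y \<in> range (S_quadratic T s). norm (inv (S_quadratic T s) y) \<le> K * norm y)}"

definition S_spectrum ::
  "('h::real_inner, 'n::{finite,linorder}) cop \<Rightarrow> 'n clifford set" where
  "S_spectrum T = paravectors - S_resolvent_set T"

definition Hplus ::
  "('h::real_inner, 'n::{finite,linorder}) cop \<Rightarrow> 'n clifford \<Rightarrow> ('h, 'n) cmodule set" where
  "Hplus J \<II> = {x. J x = x \<odot> \<II>}"

definition Hminus ::
  "('h::real_inner, 'n::{finite,linorder}) cop \<Rightarrow> 'n clifford \<Rightarrow> ('h, 'n) cmodule set" where
  "Hminus J \<II> = {x. J x = x \<odot> (- \<II>)}"

definition Pi_plus ::
  "('h::real_inner, 'n::{finite,linorder}) cop \<Rightarrow> 'n clifford \<Rightarrow> ('h, 'n) cmodule \<Rightarrow> ('h, 'n) cmodule"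
  where "Pi_plus J \<II> x = (1/2) *\<^sub>R (x - J x \<odot> \<II>)"

definition Pi_minus ::
  "('h::real_inner, 'n::{finite,linorder}) cop \<Rightarrow> 'n clifford \<Rightarrow> ('h, 'n) cmodule \<Rightarrow> ('h, 'n) cmodule"
  where "Pi_minus J \<II> x = (1/2) *\<^sub>R (x + J x \<odot> \<II>)"

lemma cl_imaginary_square:
  assumes "cl_imaginary J"
  shows "J (J x) = - x"
proof -
  have "J o\<^sub>L (- J) = id_blinfun"
    using assms unfolding cl_imaginary_def by metis
  then have "(J o\<^sub>L (- J)) x = x"
    by (simp del: blinfun_apply_blinfun_compose)
  then have "- J (J x) = x"
    by (simp add: uminus_blinfun.rep_eq blinfun.minus_right)
  then show ?thesis
    by (simp add: minus_equation_iff)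
qed

lemma Pi_decomposition:
  assumes J: "cl_imaginary J" and I: "\<II> \<in> cl_sphere"
  shows "Pi_plus J \<II> x \<in> Hplus J \<II>" "Pi_minus J \<II> x \<in> Hminus J \<II>"
    and "Pi_plus J \<II> x + Pi_minus J \<II> x = x"
    and "Hplus J \<II> \<inter> Hminus J \<II> = {0}"
proof -
  have lin: "J (y \<odot> a) = J y \<odot> a" for y a
    using J by (simp add: cl_imaginary_def cl_ops_def)
  have sq: "y \<odot> \<II> \<odot> \<II> = - y" for y :: "('a, 'b) cmodule"
    by (simp add: cl_mult_assoc cl_sphere_square[OF I] cl_mult_minus_right)
  have minus: "(- y) \<odot> \<II> = - (y \<odot> \<II>)" for y :: "('a, 'b) cmodule"
    using cl_mult_scaleR_left[of "-1" y \<II>] by simp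
  have diff: "(y - z) \<odot> \<II> = y \<odot> \<II> - z \<odot> \<II>" for y z :: "('a, 'b) cmodule"
    using cl_mult_add_left[of y "- z" \<II>] by (simp add: minus)
  show "Pi_plus J \<II> x \<in> Hplus J \<II>"
    by (simp add: Pi_plus_def Hplus_def blinfun.scaleR_right blinfun.diff_right lin
        cl_imaginary_square[OF J] cl_mult_scaleR_left diff sq minus add.commute)
  show "Pi_minus J \<II> x \<in> Hminus J \<II>"
    by (simp add: Pi_minus_def Hminus_def blinfun.scaleR_right blinfun.add_right lin
        cl_imaginary_square[OF J] cl_mult_scaleR_left cl_mult_add_left cl_mult_minus_right
        sq minus flip: scaleR_minus_right)
  show "Pi_plus J \<II> x + Pi_minus J \<II> x = x"
    by (simp add: Pi_plus_def Pi_minus_def flip: scaleR_add_right scaleR_2)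
  show "Hplus J \<II> \<inter> Hminus J \<II> = {0}"
  proof -
    have zero: "(0 :: ('a, 'b) cmodule) \<odot> a = 0" for a
      by (simp add: vec_eq_iff cl_mult_nth)
    have "y = 0" if "y \<odot> \<II> = y \<odot> (- \<II>)" for y :: "('a, 'b) cmodule"
    proof -
      have "y \<odot> \<II> = - (y \<odot> \<II>)"
        using that by (simp add: cl_mult_minus_right)
      then have "y \<odot> \<II> = 0"
        using scaleR_2[of "y \<odot> \<II>"] by (metis add.right_inverse scaleR_eq_0_iff zero_neq_numeral)
      then have "- y = 0 \<odot> \<II>"
        using sq[of y] by simp
      then show ?thesis
        by (simp add: zero)
    qed
    then show ?thesis
      by (auto simp: Hplus_def Hminus_def zero)
  qed
qed


section \<open>Integration against signed and Clifford-valued measures\<close>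

text \<open>
  Here and below a \<open>measure\<close> argument \<open>S\<close> serves only as a measurable space
  (\<open>space S\<close>, \<open>sets S\<close>).
\<close>

text \<open>
  The positive part of the Jordan decomposition of a finite signed measure \<open>\<mu>\<close>
  (negative values of \<open>\<mu> A\<close> are cut off by \<open>ennreal\<close>, and \<open>A = {}\<close> contributes 0).
\<close>

definition jordan_pos :: "'a measure \<Rightarrow> ('a set \<Rightarrow> real) \<Rightarrow> 'a measure" where
  "jordan_pos S \<mu> = measure_of (space S) (sets S)
     (\<lambda>M. SUP A\<in>{A \<in> sets S. A \<subseteq> M}. ennreal (\<mu> A))"

definition signed_integral :: "'a measure \<Rightarrow> ('a set \<Rightarrow> real) \<Rightarrow> ('a \<Rightarrow> real) \<Rightarrow> real" where
  "signed_integral S \<mu> h =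
     (\<integral>l. h l \<partial>jordan_pos S \<mu>) - (\<integral>l. h l \<partial>jordan_pos S (\<lambda>A. - \<mu> A))"

definition cl_integral ::
  "'a measure \<Rightarrow> ('a set \<Rightarrow> ('n::{finite,linorder}) clifford) \<Rightarrow> ('a \<Rightarrow> real) \<Rightarrow> 'n clifford" where
  "cl_integral S \<mu> h = (\<chi> \<alpha>. signed_integral S (\<lambda>M. \<mu> M $ \<alpha>) h)"

definition cl_integral_right ::
  "('n::{finite,linorder}) clifford \<Rightarrow> 'a measure \<Rightarrow> ('a set \<Rightarrow> 'n clifford) \<Rightarrow>
   ('a \<Rightarrow> 'n clifford) \<Rightarrow> 'n clifford" where
  "cl_integral_right \<II> S \<mu> f =
     cl_integral S \<mu> (\<lambda>l. cl_re (f l)) + cl_integral S \<mu> (\<lambda>l. cl_im \<II> (f l)) \<odot> \<II>"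


section \<open>Spectral measures and spectral integrals\<close>

definition spectral_measure ::
  "'a measure \<Rightarrow> ('a set \<Rightarrow> ('h::real_inner, 'n::{finite,linorder}) cop) \<Rightarrow> bool" where
  "spectral_measure S E \<longleftrightarrow>
     (\<forall>M\<in>sets S. cl_projection (E M)) \<and> E (space S) = id_blinfun \<and>
     (\<forall>A :: nat \<Rightarrow> 'a set. range A \<subseteq> sets S \<longrightarrow> disjoint_family A \<longrightarrow>
        (\<forall>x. (\<lambda>i. E (A i) x) sums E (\<Union>i. A i) x))"

definition associated ::
  "'a measure \<Rightarrow> ('a set \<Rightarrow> ('h::real_inner, 'n::{finite,linorder}) cop) \<Rightarrow> ('h, 'n) cop \<Rightarrow> bool" where
  "associated S E J \<longleftrightarrow> (\<forall>M\<in>sets S. J o\<^sub>L E M = E M o\<^sub>L J)"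

definition spectral_AE ::
  "'a measure \<Rightarrow> ('a set \<Rightarrow> ('h::real_inner, 'n::{finite,linorder}) cop) \<Rightarrow> ('a \<Rightarrow> bool) \<Rightarrow> bool" where
  "spectral_AE S E P \<longleftrightarrow> (\<exists>M\<in>sets S. E M = 0 \<and> (\<forall>l\<in>space S - M. P l))"

definition bounded_borel ::
  "('n::{finite,linorder}) clifford \<Rightarrow> 'a measure \<Rightarrow> ('a \<Rightarrow> 'n clifford) set" where
  "bounded_borel \<II> S =
     {f \<in> borel_measurable S. f ` space S \<subseteq> cplane \<II> \<and> bounded (f ` space S)}"

definition Linf ::
  "('n::{finite,linorder}) clifford \<Rightarrow> 'a measure \<Rightarrow> ('a set \<Rightarrow> ('h::real_inner, 'n) cop) \<Rightarrow>
   ('a \<Rightarrow> 'n clifford) set" where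
  "Linf \<II> S E = {f \<in> borel_measurable S. f ` space S \<subseteq> cplane \<II> \<and>
     (\<exists>M\<in>sets S. E M = 0 \<and> bounded (f ` (space S - M)))}"

definition Linf_norm ::
  "'a measure \<Rightarrow> ('a set \<Rightarrow> ('h::real_inner, 'n::{finite,linorder}) cop) \<Rightarrow>
   ('a \<Rightarrow> 'n clifford) \<Rightarrow> ennreal" where
  "Linf_norm S E f =
     (INF M\<in>{M \<in> sets S. E M = 0}. SUP l\<in>space S - M. ennreal (norm (f l)))"

definition simple_spectral_integral ::
  "('n::{finite,linorder}) clifford \<Rightarrow> 'a measure \<Rightarrow> ('a set \<Rightarrow> ('h::real_inner, 'n) cop) \<Rightarrow>
   ('h, 'n) cop \<Rightarrow> ('a \<Rightarrow> 'n clifford) \<Rightarrow> ('h, 'n) cop" where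
  "simple_spectral_integral \<II> S E J f = (\<Sum>c\<in>f ` space S.
     cl_re c *\<^sub>R E (f -` {c} \<inter> space S) + cl_im \<II> c *\<^sub>R (E (f -` {c} \<inter> space S) o\<^sub>L J))"

definition spectral_integral ::
  "('n::{finite,linorder}) clifford \<Rightarrow> 'a measure \<Rightarrow> ('a set \<Rightarrow> ('h::real_inner, 'n) cop) \<Rightarrow>
   ('h, 'n) cop \<Rightarrow> ('a \<Rightarrow> 'n clifford) \<Rightarrow> ('h, 'n) cop" where
  "spectral_integral \<II> S E J f = (THE A. \<exists>F :: nat \<Rightarrow> 'a \<Rightarrow> 'n clifford.
     (\<forall>j. simple_function S (F j) \<and> F j ` space S \<subseteq> cplane \<II>) \<and>
     uniform_limit (space S) F f sequentially \<and>
     (\<lambda>j. simple_spectral_integral \<II> S E J (F j)) \<longlonglongrightarrow> A)"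

text \<open>An essentially bounded function is integrated through any bounded representative.\<close>

definition spectral_integral_Linf ::
  "('n::{finite,linorder}) clifford \<Rightarrow> 'a measure \<Rightarrow> ('a set \<Rightarrow> ('h::real_inner, 'n) cop) \<Rightarrow>
   ('h, 'n) cop \<Rightarrow> ('a \<Rightarrow> 'n clifford) \<Rightarrow> ('h, 'n) cop" where
  "spectral_integral_Linf \<II> S E J f = (THE A. \<exists>g \<in> bounded_borel \<II> S.
     spectral_AE S E (\<lambda>l. g l = f l) \<and> A = spectral_integral \<II> S E J g)"

text \<open>\<open>J\<close> is an imaginary operator with \<open>T = A + J B\<close>, where \<open>A = (T + T*)/2\<close>,
  \<open>B = |T - T*|/2\<close> and \<open>A, J, B\<close> commute.\<close>

definition polar_imaginary ::
  "('h::real_inner, 'n::{finite,linorder}) cop \<Rightarrow> ('h, 'n) cop \<Rightarrow> bool" where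
  "polar_imaginary T J \<longleftrightarrow> cl_imaginary J \<and>
     (let A = (1/2) *\<^sub>R (T + cl_adjoint T); B = (1/2) *\<^sub>R cl_abs (T - cl_adjoint T)
      in T = A + (J o\<^sub>L B) \<and> A o\<^sub>L J = J o\<^sub>L A \<and> A o\<^sub>L B = B o\<^sub>L A \<and> J o\<^sub>L B = B o\<^sub>L J)"

definition spectral_space ::
  "('n::{finite,linorder}) clifford \<Rightarrow> ('h::real_inner, 'n) cop \<Rightarrow> 'n clifford measure" where
  "spectral_space \<II> T = restrict_space borel (S_spectrum T \<inter> cplane_upper \<II>)"

definition represents ::
  "('n::{finite,linorder}) clifford \<Rightarrow> ('h::real_inner, 'n) cop \<Rightarrow> ('h, 'n) cop \<Rightarrow>
   ('n clifford set \<Rightarrow> ('h, 'n) cop) \<Rightarrow> bool" where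
  "represents \<II> T J E \<longleftrightarrow>
     spectral_measure (spectral_space \<II> T) E \<and> associated (spectral_space \<II> T) E J \<and>
     T = spectral_integral \<II> (spectral_space \<II> T) E J (\<lambda>l. l)"

definition is_spectral_measure_of ::
  "('n::{finite,linorder}) clifford \<Rightarrow> ('h::real_inner, 'n) cop \<Rightarrow>
   ('n clifford set \<Rightarrow> ('h, 'n) cop) \<Rightarrow> bool" where
  "is_spectral_measure_of \<II> T E \<longleftrightarrow> (\<exists>J. polar_imaginary T J \<and> represents \<II> T J E)"

text \<open>The variant on the whole plane, relative to a prescribed \<open>J\<close>.\<close>

definition represents_on_plane ::
  "('n::{finite,linorder}) clifford \<Rightarrow> ('h::real_inner, 'n) cop \<Rightarrow> ('h, 'n) cop \<Rightarrow>
   ('n clifford set \<Rightarrow> ('h, 'n) cop) \<Rightarrow> bool" where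
  "represents_on_plane \<II> T J E \<longleftrightarrow>
     spectral_measure (restrict_space borel (cplane \<II>)) E \<and>
     associated (restrict_space borel (cplane \<II>)) E J \<and>
     (\<lambda>l. l) \<in> Linf \<II> (restrict_space borel (cplane \<II>)) E \<and>
     T = spectral_integral_Linf \<II> (restrict_space borel (cplane \<II>)) E J (\<lambda>l. l)"

end

theory Submission
  imports Defs
begin

text \<open>
  On the real Hilbert space underlying the module, a bounded real function \<open>h\<close> has the integral
  \<open>R h\<close>, the unique symmetric operator with \<open>R h x \<bullet> x = \<integral> h d(E x \<bullet> x)\<close>.  It is multiplicative,
  and the spectral integral is \<open>R (Re f) + R (Im f) J\<close>, so (i)--(x) come down to the
  multiplicativity of \<open>R\<close>, to \<open>J\<^sup>2 = -1\<close> and to \<open>norm (I f x)\<^sup>2 = \<integral> \<bar>f\<bar>\<^sup>2 d(E x \<bullet> x)\<close>.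

  For (xi), \<open>Q\<^sub>s(I f) = I((f - s)(f - s\<^sup>*))\<close> identifies the S-spectrum in the upper half plane with
  the essential range of \<open>f\<close>.  Two representations of \<open>I f\<close> have the same real part and, by uniqueness
  of positive square roots, the same positive imaginary part whatever their imaginary operators are;
  hence they integrate all polynomials alike, and by Stone--Weierstrass the measures agree.
\<close>

section \<open>Operators on real Hilbert spaces\<close>

text \<open>Adjoint, modulus and spectral integral are given by definite descriptions, so each must
  be shown to exist and to be unique. This is done for real inner products: a component of
  \<open>cl_inner\<close> is a real inner product after a right multiplication, so identities for
  right linear operators follow from real ones. The price is that a real quadratic form determines
  only a symmetric operator; symmetry is therefore carried along, and Clifford positivity is shown
  to entail it. The obstacle in (xi) is that an operator A + J B does not see J on the kernel of B.
  Two representations over the upper half plane can thus be compared only through their positive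
  imaginary parts. On the whole plane the imaginary part takes both signs and no positive root is at
  hand; there J is prescribed and gets cancelled. The upper half plane also matters for the
  spectrum: in it a point is at least as near to f as its conjugate, so a lower bound for one factor
  of f - s and f - conj s bounds their product.\<close>

definition symmetric_op :: "('a::real_inner \<Rightarrow>\<^sub>L 'a) \<Rightarrow> bool" where
  "symmetric_op A \<longleftrightarrow> (\<forall>x y. A x \<bullet> y = x \<bullet> A y)"

definition positive_op :: "('a::real_inner \<Rightarrow>\<^sub>L 'a) \<Rightarrow> bool" where
  "positive_op A \<longleftrightarrow> (\<forall>x. 0 \<le> A x \<bullet> x)"

lemma symmetric_opD: "symmetric_op A \<Longrightarrow> A x \<bullet> y = x \<bullet> A y"
  by (simp add: symmetric_op_def)

lemma symmetric_op_add: "symmetric_op A \<Longrightarrow> symmetric_op B \<Longrightarrow> symmetric_op (A + B)"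
  by (simp add: symmetric_op_def blinfun.add_left inner_add_left inner_add_right)

lemma symmetric_op_diff: "symmetric_op A \<Longrightarrow> symmetric_op B \<Longrightarrow> symmetric_op (A - B)"
  by (simp add: symmetric_op_def blinfun.diff_left inner_diff_left inner_diff_right)

lemma symmetric_op_scaleR: "symmetric_op A \<Longrightarrow> symmetric_op (r *\<^sub>R A)"
  by (simp add: symmetric_op_def blinfun.scaleR_left)

lemma symmetric_op_id [simp]: "symmetric_op id_blinfun"
  by (simp add: symmetric_op_def)

lemma symmetric_op_limit:
  assumes "\<And>j. symmetric_op (A j)" "A \<longlonglongrightarrow> B"
  shows "symmetric_op B"
  unfolding symmetric_op_def
proof (intro allI)
  fix x y
  have "(\<lambda>j. A j x \<bullet> y) \<longlonglongrightarrow> B x \<bullet> y" "(\<lambda>j. x \<bullet> A j y) \<longlonglongrightarrow> x \<bullet> B y"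
    by (intro tendsto_intros assms)+
  then show "B x \<bullet> y = x \<bullet> B y"
    using assms(1) by (simp add: symmetric_op_def LIMSEQ_unique)
qed

lemma symmetric_form_zero:
  fixes b :: "'a::real_vector \<Rightarrow> 'a \<Rightarrow> real"
  assumes "\<And>x y z. b (x + y) z = b x z + b y z" "\<And>x y z. b z (x + y) = b z x + b z y"
    and "\<And>x y. b x y = b y x" "\<And>x. b x x = 0"
  shows "b x y = 0"
  using assms(4)[of "x + y"] assms(3)[of x y] assms(4)[of x] assms(4)[of y] by (simp add: assms(1,2))

text \<open>Polarization. Over the reals a quadratic form determines only the symmetric part of an
  operator (a quarter turn of the plane has form zero), so both operators must be symmetric. This
  uniqueness makes the definite description in \<open>rint\<close> meaningful.\<close>

lemma symmetric_op_eqI: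
  assumes "symmetric_op A" "symmetric_op B" "\<And>x. A x \<bullet> x = B x \<bullet> x"
  shows "A = B"
proof (rule blinfun_eqI)
  fix x
  have "(A x - B x) \<bullet> y = 0" for y
  proof (rule symmetric_form_zero[of "\<lambda>x y. (A x - B x) \<bullet> y"])
    show "(A x - B x) \<bullet> y = (A y - B y) \<bullet> x" for x y
      using symmetric_opD[OF assms(1), of x y] symmetric_opD[OF assms(2), of x y]
      by (simp add: inner_diff_left inner_diff_right inner_commute)
  qed (simp_all add: blinfun.add_right inner_add_right inner_diff_left inner_add_left assms(3))
  from this[of "A x - B x"] show "A x = B x"
    by simp
qed

text \<open>By symmetry 4 (A x \<bullet> y) is the difference of the quadratic form at x + y and at
  x - y; the parallelogram law then bounds it by the squared lengths of x and y.\<close>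

lemma symmetric_op_norm_le:
  assumes A: "symmetric_op A" and c: "\<And>x. \<bar>A x \<bullet> x\<bar> \<le> c * (norm x)\<^sup>2" and c0: "0 \<le> c"
  shows "norm A \<le> c"
proof (rule norm_blinfun_bound[OF c0])
  fix x
  have *: "4 * (A x \<bullet> y) \<le> 2 * c * ((norm x)\<^sup>2 + (norm y)\<^sup>2)" for y
  proof -
    have "4 * (A x \<bullet> y) = A (x + y) \<bullet> (x + y) - A (x - y) \<bullet> (x - y)"
      using symmetric_opD[OF A, of y x]
      by (simp add: blinfun.add_right blinfun.diff_right inner_add_left inner_add_right
          inner_diff_left inner_diff_right inner_commute)
    also have "\<dots> \<le> c * (norm (x + y))\<^sup>2 + c * (norm (x - y))\<^sup>2"
      using c[of "x + y"] c[of "x - y"] by linarith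
    also have "\<dots> = 2 * c * ((norm x)\<^sup>2 + (norm y)\<^sup>2)"
      by (simp add: power2_norm_eq_inner inner_add_left inner_add_right
          inner_diff_left inner_diff_right inner_commute algebra_simps)
    finally show ?thesis .
  qed
  show "norm (A x) \<le> c * norm x"
  proof (cases "A x = 0 \<or> x = 0")
    case True
    then show ?thesis using c0 by auto
  next
    case False
    \<comment> \<open>Rescaling A x to the length of x makes the two squares in the bound equal, the
      case in which it is sharp.\<close>
    define s where "s = norm x / norm (A x)"
    have s: "s > 0" using False by (simp add: s_def)
    have n: "norm (s *\<^sub>R A x) = norm x" using False by (simp add: s_def)
    have "4 * (s * (norm (A x))\<^sup>2) \<le> 4 * c * (norm x)\<^sup>2"
      using *[of "s *\<^sub>R A x"] unfolding n by (simp add: power2_norm_eq_inner)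
    then have "norm x * norm (A x) \<le> c * (norm x * norm x)"
      using False by (simp add: s_def power2_eq_square)
    then show ?thesis
      using False by (simp add: mult.left_commute[of c])
  qed
qed

section \<open>Riesz representation and adjoints over the reals\<close>

lemma riesz_representation:
  fixes \<phi> :: "'a::{real_inner,banach} \<Rightarrow> real"
  assumes "bounded_linear \<phi>"
  obtains z where "\<And>x. \<phi> x = z \<bullet> x"
proof -
  note add = linear_add[OF bounded_linear.linear[OF assms]]
    and scaleR = linear_scale[OF bounded_linear.linear[OF assms]]
    and zero = linear_0[OF bounded_linear.linear[OF assms]]
    and tendsto = bounded_linear.tendsto[OF assms]
  obtain K where K: "\<And>x. \<bar>\<phi> x\<bar> \<le> norm x * K"
    using bounded_linear.bounded[OF assms] by auto
  \<comment> \<open>If \<phi> x = z \<bullet> x, then F x = |x - z|^2 - |z|^2, so the vector sought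
    must be the minimizer of F.\<close>
  define F where "F x = (norm x)\<^sup>2 - 2 * \<phi> x" for x
  \<comment> \<open>Completing the square: F x \<ge> |x|^2 - 2 K |x| = (|x| - K)^2 - K^2.\<close>
  have "- K\<^sup>2 \<le> F x" for x
    using K[of x] sum_squares_ge_zero[of "norm x - K" 0]
    by (simp add: F_def power2_eq_square algebra_simps)
  then have bdd: "bdd_below (range F)"
    by (intro bdd_belowI[of _ "- K\<^sup>2"]) auto
  define m where "m = Inf (range F)"
  have m_le: "m \<le> F x" for x
    unfolding m_def by (rule cInf_lower[OF _ bdd]) simp
  have "\<exists>x. F x < m + inverse (Suc n)" for n
    using cInf_lessD[of "range F" "m + inverse (Suc n)"] by (auto simp: m_def)
  then obtain X where X: "\<And>n. F (X n) < m + inverse (Suc n)"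
    by metis
  \<comment> \<open>The parallelogram law makes minimizing sequences of \<open>F\<close> Cauchy; the minimizer represents \<open>\<phi>\<close>.\<close>
  have par: "(norm (x - y))\<^sup>2 \<le> 2 * F x + 2 * F y - 4 * m" for x y
  proof -
    define q where "q = F ((1/2) *\<^sub>R (x + y))"
    have "4 * q = (norm (x + y))\<^sup>2 - 4 * \<phi> x - 4 * \<phi> y"
    proof -
      have n1: "(norm ((1/2) *\<^sub>R (x + y)))\<^sup>2 = (norm (x + y))\<^sup>2 / 4"
        unfolding norm_scaleR by (simp add: power_divide)
      have n2: "\<phi> ((1/2) *\<^sub>R (x + y)) = (\<phi> x + \<phi> y) / 2"
        unfolding scaleR add by simp
      show ?thesis
        unfolding q_def F_def n1 n2 by (simp add: field_simps)
    qed
    moreover have "(norm (x - y))\<^sup>2 + (norm (x + y))\<^sup>2 = 2 * (norm x)\<^sup>2 + 2 * (norm y)\<^sup>2"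
      unfolding power2_norm_eq_inner
      by (simp add: inner_add_left inner_add_right inner_diff_left inner_diff_right inner_commute)
    ultimately have "(norm (x - y))\<^sup>2 = 2 * F x + 2 * F y - 4 * q"
      unfolding F_def by argo
    moreover have "m \<le> q"
      unfolding q_def by (rule m_le)
    ultimately show ?thesis by argo
  qed
  have "Cauchy X"
  proof (rule metric_CauchyI)
    fix e :: real assume e: "e > 0"
    obtain N where N: "inverse (Suc N) < e\<^sup>2 / 4"
      using reals_Archimedean[of "e\<^sup>2 / 4"] e by auto
    have "dist (X i) (X j) < e" if "i \<ge> N" "j \<ge> N" for i j
    proof -
      have le: "inverse (real (Suc k)) \<le> inverse (Suc N)" if "k \<ge> N" for k
        using that by (simp add: field_simps)
      have "(norm (X i - X j))\<^sup>2 < e\<^sup>2"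
        using par[of "X i" "X j"] X[of i] X[of j] le[OF that(1)] le[OF that(2)] N by linarith
      then show ?thesis
        using e by (simp add: dist_norm power_less_imp_less_base)
    qed
    then show "\<exists>M. \<forall>i\<ge>M. \<forall>j\<ge>M. dist (X i) (X j) < e"
      by blast
  qed
  then obtain z where z: "X \<longlonglongrightarrow> z"
    by (auto simp: Cauchy_convergent_iff convergent_def)
  have "(\<lambda>n. F (X n)) \<longlonglongrightarrow> F z"
    unfolding F_def by (intro tendsto_intros z tendsto)
  moreover have "(\<lambda>n. m + inverse (real (Suc n))) \<longlonglongrightarrow> m + 0"
    by (intro tendsto_intros LIMSEQ_inverse_real_of_nat)
  ultimately have Fz: "F z \<le> m"
    using X by (intro LIMSEQ_le[of "\<lambda>n. F (X n)" _ "\<lambda>n. m + inverse (real (Suc n))"])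
      (auto intro: less_imp_le)
  have "\<phi> x = z \<bullet> x" for x
  proof (cases "x = 0")
    case True
    then show ?thesis by (simp add: zero)
  next
    case False
    define d where "d = z \<bullet> x - \<phi> x"
    \<comment> \<open>The parabola t \<mapsto> F (z + t x) has its vertex here and lies below F z by
      d^2 / (x \<bullet> x).\<close>
    define t where "t = - d / (x \<bullet> x)"
    have xx: "x \<bullet> x > 0" using False by simp
    have "F z \<le> F (z + t *\<^sub>R x)"
      using Fz m_le order_trans by blast
    also have "F (z + t *\<^sub>R x) = F z + t * (t * (x \<bullet> x) + 2 * d)"
      unfolding F_def power2_norm_eq_inner d_def
      by (simp add: scaleR add inner_add_left inner_add_right inner_commute algebra_simps)
    also have "t * (x \<bullet> x) = - d" using xx by (simp add: t_def)
    finally have "d * d / (x \<bullet> x) \<le> 0"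
      using xx by (simp add: t_def)
    then have "d * d \<le> 0"
      using xx by (simp add: divide_le_0_iff)
    then have "d = 0"
      by (metis mult_eq_0_iff mult_nonneg_nonneg linorder_linear mult_nonpos_nonpos order_antisym)
    then show ?thesis by (simp add: d_def)
  qed
  then show ?thesis using that by blast
qed

lemma real_adjoint_exists:
  fixes A :: "'a::{real_inner,banach} \<Rightarrow>\<^sub>L 'a"
  obtains B :: "'a \<Rightarrow>\<^sub>L 'a" where "\<And>x y. A x \<bullet> y = x \<bullet> B y"
proof -
  have "\<exists>z. \<forall>x. A x \<bullet> y = z \<bullet> x" for y
    by (rule riesz_representation[of "\<lambda>x. A x \<bullet> y"])
       (auto intro!: bounded_linear_intros)
  then obtain B where B: "\<And>x y. A x \<bullet> y = B y \<bullet> x"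
    by metis
  have eqI: "u = v" if "\<And>x. u \<bullet> x = v \<bullet> x" for u v :: 'a
    using that[of "u - v"] by (metis inner_diff_left inner_eq_zero_iff right_minus_eq)
  have "bounded_linear B"
  proof (rule bounded_linear_intro)
    show "B (x + y) = B x + B y" for x y
      by (rule eqI) (simp add: B[symmetric] inner_add_left inner_add_right)
    show "B (r *\<^sub>R x) = r *\<^sub>R B x" for r x
      by (rule eqI) (simp add: B[symmetric])
    show "norm (B y) \<le> norm y * norm A" for y
    proof -
      have "(norm (B y))\<^sup>2 = A (B y) \<bullet> y"
        by (simp add: B power2_norm_eq_inner)
      also have "\<dots> \<le> norm (A (B y)) * norm y"
        by (rule norm_cauchy_schwarz)
      also have "\<dots> \<le> norm A * norm (B y) * norm y"
        by (intro mult_right_mono norm_blinfun) auto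
      finally have "norm (B y) * norm (B y) \<le> norm (B y) * (norm y * norm A)"
        by (simp add: power2_eq_square ac_simps)
      then show ?thesis
        by (cases "B y = 0") auto
    qed
  qed
  then have "A x \<bullet> y = x \<bullet> Blinfun B y" for x y
    by (simp add: bounded_linear_Blinfun_apply) (metis B inner_commute)
  then show ?thesis using that by blast
qed

section \<open>Positive square roots: existence and uniqueness\<close>

lemma positive_contraction_sqrt_exists:
  fixes A :: "'a::{real_inner,banach} \<Rightarrow>\<^sub>L 'a"
  assumes A: "symmetric_op A" "positive_op A" "norm A \<le> 1"
  obtains B where "symmetric_op B" "positive_op B" "B o\<^sub>L B = A"
    "\<And>C. C o\<^sub>L A = A o\<^sub>L C \<Longrightarrow> C o\<^sub>L B = B o\<^sub>L C"
proof -
  define t where "t = id_blinfun - A"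
  have t_sym: "symmetric_op t"
    unfolding t_def by (intro symmetric_op_diff A) simp
  have "\<bar>A x \<bullet> x\<bar> \<le> 1 * (norm x)\<^sup>2" for x
  proof -
    have "\<bar>A x \<bullet> x\<bar> \<le> norm (A x) * norm x"
      by (rule Cauchy_Schwarz_ineq2)
    also have "\<dots> \<le> norm A * norm x * norm x"
      by (intro mult_right_mono norm_blinfun) auto
    also have "\<dots> \<le> 1 * norm x * norm x"
      by (intro mult_right_mono A) auto
    finally show ?thesis by (simp add: power2_eq_square)
  qed
  then have tb: "\<bar>t x \<bullet> x\<bar> \<le> 1 * (norm x)\<^sup>2" for x
    using A(2) by (simp add: t_def blinfun.diff_left inner_diff_left positive_op_def
        power2_norm_eq_inner abs_le_iff)
  have t_norm: "norm t \<le> 1"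
    by (rule symmetric_op_norm_le[OF t_sym tb]) simp
  \<comment> \<open>\<open>1 - w\<close> squares to \<open>A = 1 - t\<close> iff \<open>w = (t + w\<^sup>2) / 2\<close>.  The iteration for this fixed point is
     dominated, increments included, by the same iteration \<open>r\<close> for the scalar \<open>t = 1\<close>.\<close>
  define W where "W = rec_nat 0 (\<lambda>_ w. (1/2) *\<^sub>R (t + (w o\<^sub>L w)))"
  have W_0: "W 0 = 0" and W_Suc: "W (Suc k) = (1/2) *\<^sub>R (t + (W k o\<^sub>L W k))" for k
    by (simp_all add: W_def)
  define r :: "nat \<Rightarrow> real" where "r = rec_nat 0 (\<lambda>_ w. (1/2) * (1 + w * w))"
  have r_0: "r 0 = 0" and r_Suc: "r (Suc k) = (1/2) * (1 + r k * r k)" for k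
    by (simp_all add: r_def)
  have r_bd: "0 \<le> r k \<and> r k \<le> 1" for k
  proof (induction k)
    case (Suc k)
    then have "r k * r k \<le> 1 * 1" by (intro mult_mono) auto
    then show ?case by (simp add: r_Suc)
  qed (simp add: r_0)
  have W_sym: "symmetric_op (W k)" for k
  proof (induction k)
    case (Suc k)
    then have "symmetric_op (W k o\<^sub>L W k)" by (simp add: symmetric_op_def)
    then show ?case unfolding W_Suc by (intro symmetric_op_scaleR symmetric_op_add t_sym)
  qed (simp add: W_0 symmetric_op_def)
  have W_le: "norm (W k) \<le> r k" for k
  proof (induction k)
    case (Suc k)
    have "norm (W k o\<^sub>L W k) \<le> r k * r k"
      using norm_blinfun_compose[of "W k" "W k"] mult_mono[OF Suc Suc] r_bd[of k] by auto
    then have "norm (t + (W k o\<^sub>L W k)) \<le> 1 + r k * r k"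
      using norm_triangle_ineq[of t "W k o\<^sub>L W k"] t_norm by linarith
    then show ?case by (simp add: W_Suc r_Suc)
  qed (simp add: W_0 r_0)
  have W_step: "norm (W (Suc k) - W k) \<le> r (Suc k) - r k" for k
  proof (induction k)
    case 0
    then show ?case using t_norm by (simp add: W_Suc W_0 r_Suc r_0)
  next
    case (Suc k)
    let ?U = "W (Suc k)" and ?V = "W k"
    have "0 \<le> r (Suc k) - r k"
      using Suc.IH norm_ge_zero order_trans by blast
    \<comment> \<open>The splitting U^2 - V^2 = (U - V) U + V (U - V) needs no commutation, and the
      scalar iteration obeys the same identity, so the bound by the increments of r is
      inherited.\<close>
    have "W (Suc (Suc k)) - ?U = (1/2) *\<^sub>R (((?U - ?V) o\<^sub>L ?U) + (?V o\<^sub>L (?U - ?V)))"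
      unfolding W_Suc[of "Suc k"] W_Suc[of k, symmetric]
      by (subst (2) W_Suc[of k])
         (rule blinfun_eqI, simp add: blinfun.bilinear_simps algebra_simps)
    then have "norm (W (Suc (Suc k)) - ?U) \<le>
        (1/2) * (norm ((?U - ?V) o\<^sub>L ?U) + norm (?V o\<^sub>L (?U - ?V)))"
      by (simp add: norm_triangle_ineq)
    also have "\<dots> \<le> (1/2) * (norm (?U - ?V) * norm ?U + norm ?V * norm (?U - ?V))"
      by (intro mult_left_mono add_mono norm_blinfun_compose) auto
    also have "\<dots> \<le> (1/2) * ((r (Suc k) - r k) * r (Suc k) + r k * (r (Suc k) - r k))"
      using r_bd[of k] \<open>0 \<le> r (Suc k) - r k\<close>
      by (intro mult_left_mono add_mono mult_mono W_le Suc.IH) auto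
    also have "\<dots> = r (Suc (Suc k)) - r (Suc k)"
      by (subst r_Suc[of "Suc k"], subst (4) r_Suc[of k]) (simp add: algebra_simps)
    finally show ?case .
  qed
  have W_diff: "norm (W (k + l) - W k) \<le> r (k + l) - r k" for k l
  proof (induction l)
    case (Suc l)
    have "norm (W (k + Suc l) - W k) \<le> norm (W (Suc (k + l)) - W (k + l)) + norm (W (k + l) - W k)"
      using norm_triangle_ineq[of "W (Suc (k + l)) - W (k + l)" "W (k + l) - W k"] by simp
    then show ?case using Suc W_step[of "k + l"] by simp
  qed simp
  \<comment> \<open>The increments of r dominate norms, hence are nonnegative. Being bounded by 1, r
    converges, and W inherits the Cauchy property.\<close>
  have "r k \<le> r (Suc k)" for k
    using W_step[of k] norm_ge_zero[of "W (Suc k) - W k"] by linarith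
  then have "incseq r"
    by (rule incseq_SucI)
  then have "convergent r"
    using r_bd by (intro Bseq_mono_convergent BseqI'[of _ 1]) (auto simp: incseq_def)
  then have "Cauchy r" by (rule convergent_Cauchy)
  have "Cauchy W"
  proof (rule metric_CauchyI)
    fix e :: real assume "e > 0"
    then obtain N where N: "\<And>i j. i \<ge> N \<Longrightarrow> j \<ge> N \<Longrightarrow> dist (r i) (r j) < e"
      using \<open>Cauchy r\<close> unfolding Cauchy_def by blast
    have "dist (W i) (W j) < e" if "i \<ge> N" "j \<ge> N" "j \<ge> i" for i j
      using W_diff[of i "j - i"] N[OF that(1,2)] that by (simp add: dist_norm norm_minus_commute)
    then show "\<exists>M. \<forall>i\<ge>M. \<forall>j\<ge>M. dist (W i) (W j) < e"
      by (metis dist_commute linorder_linear)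
  qed
  then obtain w where w: "W \<longlonglongrightarrow> w"
    by (auto simp: Cauchy_convergent_iff convergent_def)
  have w_sym: "symmetric_op w"
    by (rule symmetric_op_limit[OF W_sym w])
  have "(\<lambda>k. W (Suc k)) \<longlonglongrightarrow> (1/2) *\<^sub>R (t + (w o\<^sub>L w))"
    unfolding W_Suc by (intro tendsto_intros w bounded_bilinear.tendsto[OF bounded_bilinear_blinfun_compose])
  then have w_eq: "w = (1/2) *\<^sub>R (t + (w o\<^sub>L w))"
    using LIMSEQ_Suc[OF w] LIMSEQ_unique by blast
  have "norm w \<le> 1"
    by (rule LIMSEQ_le_const2[OF tendsto_norm[OF w]]) (meson W_le order_trans r_bd)
  define B where "B = id_blinfun - w"
  have "symmetric_op B"
    unfolding B_def by (intro symmetric_op_diff w_sym) simp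
  moreover have "positive_op B"
    unfolding positive_op_def
  proof
    fix x
    have "w x \<bullet> x \<le> norm (w x) * norm x"
      by (rule norm_cauchy_schwarz)
    also have "\<dots> \<le> norm w * norm x * norm x"
      by (intro mult_right_mono norm_blinfun) auto
    also have "\<dots> \<le> 1 * norm x * norm x"
      by (intro mult_right_mono \<open>norm w \<le> 1\<close>) auto
    finally show "0 \<le> B x \<bullet> x"
      by (simp add: B_def blinfun.diff_left inner_diff_left power2_norm_eq_inner flip: power2_eq_square)
  qed
  moreover have "B o\<^sub>L B = A"
  proof (rule blinfun_eqI)
    fix x
    have "w x = (1/2) *\<^sub>R (x - A x + w (w x))"
      by (subst w_eq) (simp add: t_def blinfun.bilinear_simps)
    from arg_cong[OF this, of "scaleR 2"] have "2 *\<^sub>R w x = x - A x + w (w x)"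
      by simp
    then show "(B o\<^sub>L B) x = A x"
      by (simp add: B_def blinfun.bilinear_simps scaleR_2 algebra_simps)
  qed
  \<comment> \<open>Each iterate is a polynomial in A, so whatever commutes with A commutes with all
    \<open>W k\<close> and with their limit. This serves to compare arbitrary roots and to recognize
    a root as a multiplication in the algebra.\<close>
  moreover have "C o\<^sub>L B = B o\<^sub>L C" if C: "C o\<^sub>L A = A o\<^sub>L C" for C
  proof -
    have CA: "C (A x) = A (C x)" for x
      using arg_cong[OF C, of "\<lambda>D. blinfun_apply D x"] by simp
    have CW: "C (W k x) = W k (C x)" for k x
    proof (induction k arbitrary: x)
      case (Suc k)
      then show ?case by (simp add: W_Suc t_def blinfun.bilinear_simps CA)
    qed (simp add: W_0)
    have "C (w x) = w (C x)" for x
    proof (rule LIMSEQ_unique)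
      show "(\<lambda>k. C (W k x)) \<longlonglongrightarrow> C (w x)" by (intro tendsto_intros w)
      show "(\<lambda>k. C (W k x)) \<longlonglongrightarrow> w (C x)" unfolding CW by (intro tendsto_intros w)
    qed
    then show ?thesis
      by (intro blinfun_eqI) (simp add: B_def blinfun.bilinear_simps)
  qed
  ultimately show ?thesis using that by blast
qed

lemma positive_sqrt_exists:
  fixes A :: "'a::{real_inner,banach} \<Rightarrow>\<^sub>L 'a"
  assumes A: "symmetric_op A" "positive_op A"
  obtains B where "symmetric_op B" "positive_op B" "B o\<^sub>L B = A"
    "\<And>C. C o\<^sub>L A = A o\<^sub>L C \<Longrightarrow> C o\<^sub>L B = B o\<^sub>L C"
proof -
  \<comment> \<open>The summand 1 keeps c positive when A = 0.\<close>
  define c where "c = norm A + 1"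
  have c: "c > 0" by (simp add: c_def add_nonneg_pos)
  let ?A = "(1/c) *\<^sub>R A"
  have "symmetric_op ?A" by (intro symmetric_op_scaleR A)
  moreover have "positive_op ?A"
    using A(2) c by (simp add: positive_op_def blinfun.scaleR_left)
  moreover have "norm ?A \<le> 1"
    using c by (simp add: c_def)
  ultimately obtain B where B: "symmetric_op B" "positive_op B" "B o\<^sub>L B = ?A"
    "\<And>C. C o\<^sub>L ?A = ?A o\<^sub>L C \<Longrightarrow> C o\<^sub>L B = B o\<^sub>L C"
    using positive_contraction_sqrt_exists by metis
  show ?thesis
  proof (rule that[of "sqrt c *\<^sub>R B"])
    show "symmetric_op (sqrt c *\<^sub>R B)" by (intro symmetric_op_scaleR B)
    show "positive_op (sqrt c *\<^sub>R B)"
      using B(2) c by (simp add: positive_op_def blinfun.scaleR_left)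
    have BB: "B (B x) = (1/c) *\<^sub>R A x" for x
      using arg_cong[OF B(3), of "\<lambda>D. blinfun_apply D x"] by (simp add: blinfun.scaleR_left)
    have "sqrt c * sqrt c = c" using c by simp
    then show "(sqrt c *\<^sub>R B) o\<^sub>L (sqrt c *\<^sub>R B) = A"
      using c by (intro blinfun_eqI) (simp add: blinfun.bilinear_simps BB)
    show "C o\<^sub>L sqrt c *\<^sub>R B = sqrt c *\<^sub>R B o\<^sub>L C" if "C o\<^sub>L A = A o\<^sub>L C" for C
    proof -
      have "C o\<^sub>L ?A = ?A o\<^sub>L C"
        using that by (metis bounded_bilinear.scaleR_left bounded_bilinear.scaleR_right
            bounded_bilinear_blinfun_compose)
      then have "C o\<^sub>L B = B o\<^sub>L C" by (rule B(4))
      then show ?thesis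
        by (metis bounded_bilinear.scaleR_left bounded_bilinear.scaleR_right
            bounded_bilinear_blinfun_compose)
    qed
  qed
qed

text \<open>With D = P - B, commutation gives (P + B) D = P^2 - B^2 = 0. Both forms being
  nonnegative, P and B have form 0 on the range of D, hence so does D. Polarization then yields D^3
  = 0, and symmetry lowers the power to D = 0.\<close>

lemma commuting_positive_sqrt_unique:
  fixes P B :: "'a::real_inner \<Rightarrow>\<^sub>L 'a"
  assumes P: "symmetric_op P" "positive_op P" and B: "symmetric_op B" "positive_op B"
    and PB: "P o\<^sub>L B = B o\<^sub>L P" and sq: "P o\<^sub>L P = B o\<^sub>L B"
  shows "P = B"
proof -
  define D where "D = P - B"
  have D: "symmetric_op D" unfolding D_def by (intro symmetric_op_diff P B)
  have com: "P (B x) = B (P x)" and sq': "P (P x) = B (B x)" for x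
    using arg_cong[OF PB, of "\<lambda>D. blinfun_apply D x"] arg_cong[OF sq, of "\<lambda>D. blinfun_apply D x"]
    by simp_all
  have zero: "D (D x) \<bullet> D x = 0" for x
  proof -
    have "P (D x) + B (D x) = 0"
      by (simp add: D_def blinfun.bilinear_simps com sq')
    then have "P (D x) \<bullet> D x + B (D x) \<bullet> D x = 0"
      by (metis inner_add_left inner_zero_left)
    moreover have "P (D x) \<bullet> D x \<ge> 0" "B (D x) \<bullet> D x \<ge> 0"
      using P(2) B(2) by (auto simp: positive_op_def)
    ultimately have "P (D x) \<bullet> D x = 0" "B (D x) \<bullet> D x = 0" by auto
    then show ?thesis by (simp add: D_def blinfun.diff_left inner_diff_left)
  qed
  have "D (D x) \<bullet> D z = 0" for x z
    by (rule symmetric_form_zero[of "\<lambda>x z. D (D x) \<bullet> D z"])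
       (simp_all add: zero blinfun.add_right inner_add_left inner_add_right, metis D inner_commute symmetric_opD)
  then have "D (D x) \<bullet> D (D x) = 0" for x by blast
  then have "D x \<bullet> D x = 0" for x
    by (metis D inner_eq_zero_iff inner_zero_left symmetric_opD)
  then have "D = 0" by (intro blinfun_eqI) simp
  then show ?thesis by (simp add: D_def)
qed

text \<open>Two roots need not be known to commute with each other. But each commutes with its own
  square, so with the root B constructed from the common square, and both equal B.\<close>

lemma positive_sqrt_unique:
  fixes P Q :: "'a::{real_inner,banach} \<Rightarrow>\<^sub>L 'a"
  assumes P: "symmetric_op P" "positive_op P" and Q: "symmetric_op Q" "positive_op Q"
    and sq: "P o\<^sub>L P = Q o\<^sub>L Q"
  shows "P = Q"
proof -
  have "symmetric_op (P o\<^sub>L P)"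
    by (simp add: symmetric_op_def symmetric_opD[OF P(1)])
  moreover have "positive_op (P o\<^sub>L P)"
    unfolding positive_op_def by (simp add: symmetric_opD[OF P(1), of "P _"])
  ultimately obtain B where B: "symmetric_op B" "positive_op B" "B o\<^sub>L B = P o\<^sub>L P"
    "\<And>C. C o\<^sub>L (P o\<^sub>L P) = (P o\<^sub>L P) o\<^sub>L C \<Longrightarrow> C o\<^sub>L B = B o\<^sub>L C"
    using positive_sqrt_exists by metis
  have "P o\<^sub>L B = B o\<^sub>L P"
    by (rule B(4), rule blinfun_eqI) simp
  then have "P = B"
    by (rule commuting_positive_sqrt_unique[OF P B(1,2) _ B(3)[symmetric]])
  have "Q o\<^sub>L (P o\<^sub>L P) = (P o\<^sub>L P) o\<^sub>L Q"
    unfolding sq by (rule blinfun_eqI) simp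
  then have "Q o\<^sub>L B = B o\<^sub>L Q"
    by (rule B(4))
  then have "Q = B"
    by (rule commuting_positive_sqrt_unique[OF Q B(1,2) _ B(3)[symmetric, unfolded sq]])
  with \<open>P = B\<close> show ?thesis by simp
qed

section \<open>The Clifford algebra and its modules\<close>

lemma cl_conj_conj [simp]: "cl_conj (cl_conj a) = a"
  by (simp add: cl_conj_def vec_eq_iff cl_sign_square flip: mult.assoc)

lemma cl_expand_basis: "(a :: 'n::{finite,linorder} clifford) = (\<Sum>\<beta>\<in>UNIV. a $ \<beta> *\<^sub>R cl_basis \<beta>)"
  by (simp add: vec_eq_iff cl_basis_def axis_def if_distrib cong: if_cong)

lemma cl_re_mult_conj: "cl_re (a \<odot> cl_conj b) = a \<bullet> b"
  by (simp add: cl_re_def cl_mult_nth cl_conj_def inner_vec_def cl_sign_square mult.commute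
      flip: mult.assoc)

lemma cl_re_mult_commute: "cl_re (a \<odot> b) = cl_re (b \<odot> (a :: 'n::{finite,linorder} clifford))"
  by (simp add: cl_re_def cl_mult_nth ac_simps)

lemma cl_inner_add_left: "cl_inner (x + y) z = cl_inner x z + cl_inner y z"
  by (simp add: cl_inner_def inner_add_left scaleR_add_left sum.distrib)

lemma cl_inner_sum_left: "cl_inner (sum f A) z = (\<Sum>i\<in>A. cl_inner (f i) z)"
proof (induction A rule: infinite_finite_induct)
  case (insert i A)
  then show ?case by (simp add: cl_inner_add_left)
qed (simp_all add: cl_inner_def)

lemma cl_inner_axis: "cl_inner (axis \<alpha> h) y = (\<Sum>\<beta>\<in>UNIV. (h \<bullet> y $ \<beta>) *\<^sub>R (cl_conj (cl_basis \<beta>) \<odot> cl_basis \<alpha>))"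
proof -
  have "cl_inner (axis \<alpha> h) y = (\<Sum>\<gamma>\<in>UNIV. if \<gamma> = \<alpha> then
      (\<Sum>\<beta>\<in>UNIV. (h \<bullet> y $ \<beta>) *\<^sub>R (cl_conj (cl_basis \<beta>) \<odot> cl_basis \<alpha>)) else 0)"
    unfolding cl_inner_def by (intro sum.cong refl) (simp add: axis_def)
  then show ?thesis by simp
qed

lemma cl_inner_mult_left: "cl_inner (x \<odot> a) y = cl_inner x y \<odot> a"
proof -
  have "cl_inner (x \<odot> a) y = (\<Sum>\<alpha>\<in>UNIV. \<Sum>\<beta>\<in>UNIV. \<Sum>\<delta>\<in>UNIV.
      (x $ \<alpha> \<bullet> y $ \<delta>) *\<^sub>R a $ \<beta> *\<^sub>R (cl_conj (cl_basis \<delta>) \<odot> (cl_basis \<alpha> \<odot> cl_basis \<beta>)))"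
    unfolding cl_mult_def[of x a]
    by (simp add: cl_inner_sum_left cl_inner_axis cl_mult_basis cl_mult_scaleR_right ac_simps)
  also have "\<dots> = (\<Sum>\<alpha>\<in>UNIV. \<Sum>\<delta>\<in>UNIV. \<Sum>\<beta>\<in>UNIV.
      (x $ \<alpha> \<bullet> y $ \<delta>) *\<^sub>R a $ \<beta> *\<^sub>R (cl_conj (cl_basis \<delta>) \<odot> (cl_basis \<alpha> \<odot> cl_basis \<beta>)))"
    by (intro sum.cong refl sum.swap)
  also have "\<dots> = (\<Sum>\<alpha>\<in>UNIV. \<Sum>\<delta>\<in>UNIV.
      (x $ \<alpha> \<bullet> y $ \<delta>) *\<^sub>R (cl_conj (cl_basis \<delta>) \<odot> cl_basis \<alpha>)) \<odot> (\<Sum>\<beta>\<in>UNIV. a $ \<beta> *\<^sub>R cl_basis \<beta>)"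
    unfolding cl_mult_sum_left cl_mult_scaleR_left
    by (simp add: cl_mult_assoc cl_mult_sum_right cl_mult_scaleR_right scaleR_sum_right)
  finally show ?thesis
    by (simp add: cl_inner_def flip: cl_expand_basis)
qed

lemma cl_conj_inner: "cl_conj (cl_inner x y) = cl_inner y x"
  unfolding cl_inner_def
  by (subst sum.swap)
     (simp add: cl_conj_sum cl_conj_scaleR cl_conj_mult inner_commute)

lemma cl_inner_mult_right: "cl_inner x (y \<odot> a) = cl_conj a \<odot> cl_inner x y"
  by (metis cl_conj_conj cl_conj_inner cl_conj_mult cl_inner_mult_left)

lemma cl_re_inner: "cl_re (cl_inner x y) = x \<bullet> y"
proof -
  have "cl_re (cl_inner x y) =
      (\<Sum>\<alpha>\<in>UNIV. \<Sum>\<beta>\<in>UNIV. (x $ \<alpha> \<bullet> y $ \<beta>) * cl_re (cl_conj (cl_basis \<beta>) \<odot> cl_basis \<alpha>))"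
    by (simp add: cl_inner_def cl_re_def)
  then show ?thesis
    by (simp add: cl_re_conj_basis_mult if_distrib inner_vec_def cong: if_cong)
qed

text \<open>The bridge to the real Hilbert space: a right linear operator commutes with the
  multiplication on the right, so a real identity valid for all vectors gives every component of the
  Clifford identity.\<close>

lemma cl_inner_nth: "cl_inner x y $ \<alpha> = (x \<odot> cl_conj (cl_basis \<alpha>)) \<bullet> y"
proof -
  have "(x \<odot> cl_conj (cl_basis \<alpha>)) \<bullet> y = cl_inner x y \<bullet> cl_basis \<alpha>"
    unfolding cl_re_inner[symmetric] cl_inner_mult_left cl_re_mult_conj ..
  then show ?thesis by (simp add: cl_basis_def inner_axis)
qed

lemma cl_mult_inner: "(x \<odot> a) \<bullet> y = x \<bullet> (y \<odot> cl_conj a)"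
  by (metis cl_conj_conj cl_inner_mult_left cl_inner_mult_right cl_re_inner cl_re_mult_commute)

lemma bounded_linear_vec_components:
  fixes f :: "'a::real_normed_vector \<Rightarrow> 'b::real_normed_vector ^ 'i"
  assumes "\<And>i. bounded_linear (\<lambda>x. f x $ i)"
  shows "bounded_linear f"
proof -
  obtain K where K: "\<And>i x. norm (f x $ i) \<le> norm x * K i"
    using bounded_linear.bounded[OF assms] by metis
  show ?thesis
  proof (rule bounded_linear_intro)
    show "f (x + y) = f x + f y" "f (r *\<^sub>R x) = r *\<^sub>R f x" for x y r
      using linear_add[OF bounded_linear.linear[OF assms]] linear_scale[OF bounded_linear.linear[OF assms]]
      by (simp_all add: vec_eq_iff)
    show "norm (f x) \<le> norm x * sum K UNIV" for x
    proof -
      have "norm (f x) \<le> (\<Sum>i\<in>UNIV. norm (f x $ i))"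
        unfolding norm_vec_def by (rule L2_set_le_sum) simp
      also have "\<dots> \<le> (\<Sum>i\<in>UNIV. norm x * K i)"
        by (intro sum_mono K)
      finally show ?thesis
        by (simp add: sum_distrib_left)
    qed
  qed
qed

lemma bounded_linear_cl_mult_left:
  "bounded_linear (\<lambda>x :: ('h::real_normed_vector, 'n::{finite,linorder}) cmodule. x \<odot> a)"
  unfolding cl_mult_nth
  by (rule bounded_linear_vec_components)
     (auto simp: cl_mult_nth intro!: bounded_linear_sum bounded_linear_const_scaleR bounded_linear_vec_nth)

subsection \<open>Right linear operators\<close>

lemma cl_opsD: "T \<in> cl_ops \<Longrightarrow> T (x \<odot> a) = T x \<odot> a"
  by (simp add: cl_ops_def)

lemma cl_ops_compose: "A \<in> cl_ops \<Longrightarrow> B \<in> cl_ops \<Longrightarrow> A o\<^sub>L B \<in> cl_ops"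
  by (simp add: cl_ops_def)

lemma cl_ops_add: "A \<in> cl_ops \<Longrightarrow> B \<in> cl_ops \<Longrightarrow> A + B \<in> cl_ops"
  by (simp add: cl_ops_def blinfun.add_left cl_mult_add_left)

text \<open>Right linearity lets \<open>cl_conj (cl_basis \<alpha>)\<close> pass through T, so the
  real adjoint relation yields all components. Uniqueness is read off from the real part
  alone.\<close>

lemma cl_adjoint_eqI:
  assumes T: "T \<in> cl_ops" and S: "S \<in> cl_ops" and adj: "\<And>x y. T x \<bullet> y = x \<bullet> S y"
  shows "cl_adjoint T = S"
  unfolding cl_adjoint_def
proof (rule the_equality)
  have "cl_inner (T x) y = cl_inner x (S y)" for x y
    by (simp add: vec_eq_iff cl_inner_nth adj flip: cl_opsD[OF T])
  then show "S \<in> cl_ops \<and> (\<forall>x y. cl_inner (T x) y = cl_inner x (S y))"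
    using S by blast
next
  fix S' assume "S' \<in> cl_ops \<and> (\<forall>x y. cl_inner (T x) y = cl_inner x (S' y))"
  then have "T x \<bullet> y = x \<bullet> S' y" for x y
    by (metis cl_re_inner)
  then have "x \<bullet> S' y = x \<bullet> S y" for x y
    by (simp add: adj)
  then have "S' y = S y" for y
    using vector_eq_ldot by blast
  then show "S' = S"
    by (rule blinfun_eqI)
qed

text \<open>Right multiplication by a has right multiplication by \<open>cl_conj a\<close> as its
  real adjoint; hence the real adjoint of a right linear operator is again right linear and serves
  as the Clifford adjoint.\<close>

lemma cl_adjoint:
  fixes T :: "('h::{real_inner,banach}, 'n::{finite,linorder}) cop"
  assumes T: "T \<in> cl_ops"
  shows "cl_adjoint T \<in> cl_ops" "T x \<bullet> y = x \<bullet> cl_adjoint T y"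
proof -
  obtain B :: "('h, 'n) cop" where B: "\<And>x y. T x \<bullet> y = x \<bullet> B y"
    using real_adjoint_exists[of T] by blast
  have "x \<bullet> B (y \<odot> a) = x \<bullet> (B y \<odot> a)" for x y a
  proof -
    have "x \<bullet> B (y \<odot> a) = (T x \<odot> cl_conj a) \<bullet> y"
      by (simp add: B[symmetric] cl_mult_inner)
    also have "\<dots> = x \<bullet> (B y \<odot> a)"
      by (simp add: B cl_mult_inner flip: cl_opsD[OF T])
    finally show ?thesis .
  qed
  then have "B (y \<odot> a) = B y \<odot> a" for y a
    using vector_eq_ldot by blast
  then have "B \<in> cl_ops"
    by (simp add: cl_ops_def)
  then have "cl_adjoint T = B"
    by (rule cl_adjoint_eqI[OF T _ B])
  then show "cl_adjoint T \<in> cl_ops" "T x \<bullet> y = x \<bullet> cl_adjoint T y"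
    using \<open>B \<in> cl_ops\<close> B by auto
qed

lemma cl_projectionD:
  fixes P :: "('h::{real_inner,banach}, 'n::{finite,linorder}) cop"
  assumes "cl_projection P"
  shows "symmetric_op P" "P (P x) = P x" "P \<in> cl_ops"
proof -
  from assms show P: "P \<in> cl_ops"
    by (simp add: cl_projection_def)
  show "symmetric_op P"
    using cl_adjoint(2)[OF P] assms by (simp add: symmetric_op_def cl_projection_def)
  show "P (P x) = P x"
    using assms by (metis blinfun_apply_blinfun_compose cl_projection_def)
qed

lemma cl_projectionI:
  assumes "P \<in> cl_ops" "symmetric_op P" "\<And>x. P (P x) = P x"
  shows "cl_projection P"
  using assms cl_adjoint_eqI[OF assms(1,1)]
  by (auto simp: cl_projection_def symmetric_op_def intro!: blinfun_eqI)

lemma cl_imaginaryD: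
  fixes J :: "('h::{real_inner,banach}, 'n::{finite,linorder}) cop"
  assumes "cl_imaginary J"
  shows "J \<in> cl_ops" "J (J x) = - x" "J x \<bullet> y = - (x \<bullet> J y)"
proof -
  from assms show J: "J \<in> cl_ops"
    by (simp add: cl_imaginary_def)
  show "J (J x) = - x"
    by (rule cl_imaginary_square[OF assms])
  show "J x \<bullet> y = - (x \<bullet> J y)"
    using cl_adjoint(2)[OF J, of x y] assms
    by (simp add: cl_imaginary_def uminus_blinfun.rep_eq)
qed

subsection \<open>Positivity\<close>

text \<open>\<open>cl_nonneg\<close> asks for an explicit factor b. Left multiplication by a =
  \<open>cl_inner y y\<close> is a positive operator on the algebra, because its form at c is the
  squared norm of \<open>y \<odot> c\<close>. Its positive root is left multiplication by some b;
  symmetry of the root means that b is its own conjugate, so a = b b is the factorization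
  wanted.\<close>

lemma cl_nonneg_inner_self:
  fixes y :: "('h::real_inner, 'n::{finite,linorder}) cmodule"
  shows "cl_nonneg (cl_inner y y)"
proof -
  define a where "a = cl_inner y y"
  have lin: "bounded_linear (\<lambda>c. a \<odot> c)"
    by (simp flip: linear_conv_bounded_linear add: linear_iff cl_mult_add_right cl_mult_scaleR_right)
  define L where "L = Blinfun (\<lambda>c. a \<odot> c)"
  have L: "L c = a \<odot> c" for c
    using lin by (simp add: L_def bounded_linear_Blinfun_apply)
  have form: "L c \<bullet> d = (y \<odot> c) \<bullet> (y \<odot> d)" for c d
  proof -
    have "L c \<bullet> d = cl_re (cl_conj d \<odot> (a \<odot> c))"
      by (simp add: L cl_re_mult_commute[of "cl_conj d"] cl_re_mult_conj)
    also have "\<dots> = (y \<odot> c) \<bullet> (y \<odot> d)"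
      by (simp add: a_def cl_inner_mult_left cl_inner_mult_right cl_mult_assoc flip: cl_re_inner)
    finally show ?thesis .
  qed
  have "symmetric_op L" "positive_op L"
    unfolding symmetric_op_def positive_op_def
    by (metis form inner_commute, simp add: form)
  \<comment> \<open>The square root of \<open>L\<close> commutes with all right multiplications, so it is again a left multiplication.\<close>
  then obtain B where B: "symmetric_op B" "B o\<^sub>L B = L"
    and com: "\<And>C. C o\<^sub>L L = L o\<^sub>L C \<Longrightarrow> C o\<^sub>L B = B o\<^sub>L C"
    using positive_sqrt_exists[of L] by metis
  have B_mult: "B (c \<odot> d) = B c \<odot> d" for c d
  proof -
    define R where "R = Blinfun (\<lambda>c :: 'n clifford. c \<odot> d)"
    have R: "R c = c \<odot> d" for c
      by (simp add: R_def bounded_linear_Blinfun_apply bounded_linear_cl_mult_left)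
    have "R o\<^sub>L B = B o\<^sub>L R"
      by (rule com, rule blinfun_eqI) (simp add: R L cl_mult_assoc)
    from arg_cong[OF this, of "\<lambda>A. blinfun_apply A c"] show ?thesis
      by (simp add: R)
  qed
  define b where "b = B cl_one"
  have Bb: "B c = b \<odot> c" for c
    using B_mult[of cl_one c] by (simp add: b_def)
  have "c \<bullet> cl_conj b = c \<bullet> b" for c
  proof -
    have "c \<bullet> b = B c \<bullet> cl_one"
      by (simp add: b_def symmetric_opD[OF B(1)])
    also have "\<dots> = cl_re (c \<odot> b)"
      using cl_re_mult_conj[of "B c" cl_one] by (simp add: Bb cl_re_mult_commute)
    also have "\<dots> = c \<bullet> cl_conj b"
      using cl_re_mult_conj[of c "cl_conj b"] by simp
    finally show ?thesis by simp
  qed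
  then have "cl_conj b = b"
    using vector_eq_ldot by blast
  moreover have "b \<odot> b = a"
    using arg_cong[OF B(2), of "\<lambda>A. blinfun_apply A cl_one"] by (simp add: L Bb)
  ultimately show ?thesis
    unfolding cl_nonneg_def a_def by metis
qed

lemma cl_nonneg_conj: "cl_nonneg a \<Longrightarrow> cl_conj a = a"
  by (auto simp: cl_nonneg_def cl_conj_mult)

lemma cl_nonneg_re: "cl_nonneg a \<Longrightarrow> 0 \<le> cl_re a"
  by (auto simp: cl_nonneg_def cl_re_mult_conj)

text \<open>Over the reals a nonnegative quadratic form does not force symmetry; the nonreal
  components of the Clifford-valued form do. This makes \<open>positive_sqrt_unique\<close>
  applicable to the modulus.\<close>

lemma cl_positiveD:
  assumes R: "R \<in> cl_ops" "cl_positive R"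
  shows "positive_op R" "symmetric_op R"
proof -
  have nn: "cl_nonneg (cl_inner (R x) x)" for x
    using R(2) by (simp add: cl_positive_def)
  show "positive_op R"
    using cl_nonneg_re[OF nn] by (simp add: positive_op_def cl_re_inner)
  \<comment> \<open>Conjugation fixes \<open>cl_inner (R x) x\<close> and flips the sign of its \<open>e\<close>-component, so
     \<open>(R x \<odot> e) \<bullet> y\<close> is alternating; replacing \<open>y\<close> by \<open>y \<odot> e\<close> gives symmetry.\<close>
  fix j :: 'b
  define e where "e = cl_gen j"
  have conj_e: "cl_conj e = - e" and ee: "e \<odot> e = - cl_one"
    by (simp_all add: e_def cl_conj_gen cl_gen_square)
  have alt: "(R x \<odot> e) \<bullet> x = 0" for x
  proof -
    have "cl_inner (R x) x \<bullet> e = cl_re (cl_inner (R x) x \<odot> cl_conj e)"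
      by (simp add: cl_re_mult_conj)
    also have "\<dots> = - ((R x \<odot> e) \<bullet> x)"
      by (simp add: conj_e cl_mult_minus_right cl_inner_mult_left cl_re_def flip: cl_re_inner)
    finally have 1: "(R x \<odot> e) \<bullet> x = - (cl_inner (R x) x \<bullet> e)" by simp
    have "cl_sign {j} {j} = - 1"
      by (simp add: cl_sign_def)
    then have "cl_inner (R x) x $ {j} = - (cl_inner (R x) x $ {j})"
      by (subst cl_nonneg_conj[OF nn[of x], symmetric]) (simp add: cl_conj_def)
    moreover have "cl_inner (R x) x \<bullet> e = cl_inner (R x) x $ {j}"
      by (simp add: e_def cl_gen_def cl_basis_def inner_axis)
    ultimately show ?thesis
      using 1 by simp
  qed
  have anti: "(R x \<odot> e) \<bullet> y = - ((R y \<odot> e) \<bullet> x)" for x y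
    using alt[of "x + y"] alt[of x] alt[of y]
    by (simp add: blinfun.add_right cl_mult_add_left inner_add_left inner_add_right)
  have ortho: "(x \<odot> e) \<bullet> (y \<odot> e) = x \<bullet> y" for x y :: "('a, 'b) cmodule"
    by (simp add: cl_mult_inner conj_e cl_mult_assoc cl_mult_minus_right ee)
  show "symmetric_op R"
    unfolding symmetric_op_def
  proof (intro allI)
    fix x y
    have "R x \<bullet> y = - ((R (y \<odot> e) \<odot> e) \<bullet> x)"
      using anti[of x "y \<odot> e"] ortho by simp
    also have "\<dots> = R y \<bullet> x"
      by (simp add: cl_opsD[OF R(1)] cl_mult_assoc ee cl_mult_minus_right)
    finally show "R x \<bullet> y = x \<bullet> R y" by (simp add: inner_commute)
  qed
qed

lemma cl_abs_eqI:
  fixes T R :: "('h::{real_inner,banach}, 'n::{finite,linorder}) cop"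
  assumes R: "R \<in> cl_ops" "cl_positive R" "R o\<^sub>L R = cl_adjoint T o\<^sub>L T"
  shows "cl_abs T = R"
  unfolding cl_abs_def
proof (rule the_equality)
  show "R \<in> cl_ops \<and> cl_positive R \<and> R o\<^sub>L R = cl_adjoint T o\<^sub>L T"
    using R by blast
  fix R' assume "R' \<in> cl_ops \<and> cl_positive R' \<and> R' o\<^sub>L R' = cl_adjoint T o\<^sub>L T"
  with R show "R' = R"
    by (metis cl_positiveD positive_sqrt_unique)
qed

subsection \<open>The complex planes\<close>

lemma cl_re_add: "cl_re (a + b) = cl_re a + cl_re b"
  and cl_re_scaleR: "cl_re (r *\<^sub>R a) = r * cl_re a"
  and cl_im_add: "cl_im \<II> (a + b) = cl_im \<II> a + cl_im \<II> b"
  and cl_im_scaleR: "cl_im \<II> (r *\<^sub>R a) = r * cl_im \<II> a"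
  by (simp_all add: cl_re_def cl_im_def inner_add_left)

lemma bounded_linear_cl_re: "bounded_linear cl_re"
  unfolding cl_re_def by (rule bounded_linear_vec_nth)

lemma bounded_linear_cl_im: "bounded_linear (cl_im \<II>)"
  unfolding cl_im_def by (rule bounded_linear_inner_left)

lemma cplaneI [simp]: "a *\<^sub>R cl_one + b *\<^sub>R \<II> \<in> cplane \<II>"
  by (auto simp: cplane_def)

context
  fixes \<II> :: "'n::{finite,linorder} clifford"
  assumes \<II>: "\<II> \<in> cl_sphere"
begin

lemma cplane_eq: "c \<in> cplane \<II> \<Longrightarrow> c = cl_re c *\<^sub>R cl_one + cl_im \<II> c *\<^sub>R \<II>"
  using cplane_re_im[OF \<II>] by (auto simp: cplane_def)

lemma cplane_iff: "c \<in> cplane \<II> \<longleftrightarrow> c = cl_re c *\<^sub>R cl_one + cl_im \<II> c *\<^sub>R \<II>"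
  using cplane_eq cplaneI by metis

lemma cplane_upper_iff: "c \<in> cplane_upper \<II> \<longleftrightarrow> c \<in> cplane \<II> \<and> 0 \<le> cl_im \<II> c"
  using cplane_re_im(2)[OF \<II>] by (fastforce simp: cplane_def cplane_upper_def)

lemma cplane_one: "cl_one \<in> cplane \<II>" and cplane_unit: "\<II> \<in> cplane \<II>" and cplane_0: "0 \<in> cplane \<II>"
  using cplaneI[of 1 0 \<II>] cplaneI[of 0 1 \<II>] cplaneI[of 0 0 \<II>] by simp_all

lemma cl_re_im_simps [simp]: "cl_re (cl_one :: 'n clifford) = 1" "cl_im \<II> cl_one = 0" "cl_re \<II> = 0" "cl_im \<II> \<II> = 1"
  using cplane_re_im[OF \<II>, of 1 0] cplane_re_im[OF \<II>, of 0 1] by simp_all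

lemma cplane_norm: 
  assumes "c \<in> cplane \<II>"
  shows "(norm c)\<^sup>2 = (cl_re c)\<^sup>2 + (cl_im \<II> c)\<^sup>2"
proof -
  have 1: "(cl_one :: 'n clifford) \<bullet> cl_one = 1" "\<II> \<bullet> \<II> = 1"
    using cl_sphere_norm[OF \<II>]
    by (simp_all add: cl_one_def cl_basis_def inner_axis_axis norm_eq_1)
  have "(norm c)\<^sup>2 = c \<bullet> c"
    by (rule power2_norm_eq_inner)
  also have "\<dots> = (cl_re c)\<^sup>2 + (cl_im \<II> c)\<^sup>2"
  proof -
    have "(a *\<^sub>R cl_one + b *\<^sub>R \<II>) \<bullet> (a *\<^sub>R cl_one + b *\<^sub>R \<II>) = a\<^sup>2 + b\<^sup>2" for a b
      using cl_sphere_orth[OF \<II>]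
      by (simp add: inner_add_left inner_add_right 1 inner_commute[of \<II> cl_one] power2_eq_square)
    then show ?thesis using cplane_eq[OF assms] by metis
  qed
  finally show ?thesis .
qed

lemma cplane_conj_eq:
  assumes "c \<in> cplane \<II>"
  shows "cl_conj c = cl_re c *\<^sub>R cl_one + (- cl_im \<II> c) *\<^sub>R \<II>"
  by (subst cplane_eq[OF assms]) (simp add: cl_conj_add cl_conj_scaleR cl_sphere_conj[OF \<II>])

lemma cplane_conj:
  assumes "c \<in> cplane \<II>"
  shows "cl_conj c \<in> cplane \<II>" "cl_re (cl_conj c) = cl_re c" "cl_im \<II> (cl_conj c) = - cl_im \<II> c"
  unfolding cplane_conj_eq[OF assms] cplane_re_im[OF \<II>] by (rule cplaneI refl)+

lemma cplane_mult_eq: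
  assumes "c \<in> cplane \<II>" "d \<in> cplane \<II>"
  shows "c \<odot> d = (cl_re c * cl_re d - cl_im \<II> c * cl_im \<II> d) *\<^sub>R cl_one
    + (cl_re c * cl_im \<II> d + cl_im \<II> c * cl_re d) *\<^sub>R \<II>"
proof -
  have "(a *\<^sub>R cl_one + b *\<^sub>R \<II>) \<odot> (a' *\<^sub>R cl_one + b' *\<^sub>R \<II>) =
      (a * a' - b * b') *\<^sub>R cl_one + (a * b' + b * a') *\<^sub>R \<II>" for a b a' b'
    using cl_sphere_square[OF \<II>]
    by (simp add: cl_mult_add_left cl_mult_add_right cl_mult_scaleR_left cl_mult_scaleR_right
        scaleR_add_left scaleR_diff_left algebra_simps)
  then show ?thesis
    using cplane_eq[OF assms(1)] cplane_eq[OF assms(2)] by metis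
qed

lemma cplane_mult:
  assumes "c \<in> cplane \<II>" "d \<in> cplane \<II>"
  shows "c \<odot> d \<in> cplane \<II>"
    "cl_re (c \<odot> d) = cl_re c * cl_re d - cl_im \<II> c * cl_im \<II> d"
    "cl_im \<II> (c \<odot> d) = cl_re c * cl_im \<II> d + cl_im \<II> c * cl_re d"
  unfolding cplane_mult_eq[OF assms] cplane_re_im[OF \<II>] by (rule cplaneI refl)+

lemma cplane_add:
  assumes "c \<in> cplane \<II>" "d \<in> cplane \<II>"
  shows "c + d \<in> cplane \<II>"
proof -
  have "c + d = (cl_re c + cl_re d) *\<^sub>R cl_one + (cl_im \<II> c + cl_im \<II> d) *\<^sub>R \<II>"
    by (subst cplane_eq[OF assms(1)], subst cplane_eq[OF assms(2)]) (simp add: scaleR_add_left)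
  then show ?thesis
    by (simp only: cplaneI)
qed

lemma cplane_scaleR:
  assumes "c \<in> cplane \<II>"
  shows "r *\<^sub>R c \<in> cplane \<II>"
proof -
  have "r *\<^sub>R c = (r * cl_re c) *\<^sub>R cl_one + (r * cl_im \<II> c) *\<^sub>R \<II>"
    by (subst cplane_eq[OF assms]) (simp add: scaleR_add_right)
  then show ?thesis
    by (simp only: cplaneI)
qed

lemma cplane_norm_mult:
  assumes "c \<in> cplane \<II>" "d \<in> cplane \<II>"
  shows "norm (c \<odot> d) = norm c * norm d"
proof -
  have "(norm (c \<odot> d))\<^sup>2 = (norm c * norm d)\<^sup>2"
    unfolding power_mult_distrib cplane_norm[OF assms(1)] cplane_norm[OF assms(2)]
      cplane_norm[OF cplane_mult(1)[OF assms]] cplane_mult(2,3)[OF assms]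
    by (simp add: power2_eq_square algebra_simps)
  then show ?thesis by simp
qed

lemma cplane_eqI:
  assumes "c \<in> cplane \<II>" "d \<in> cplane \<II>" "cl_re c = cl_re d" "cl_im \<II> c = cl_im \<II> d"
  shows "c = d"
  using cplane_eq[OF assms(1)] cplane_eq[OF assms(2)] assms(3,4) by simp

lemma cplane_paravector: "c \<in> cplane \<II> \<Longrightarrow> c \<in> paravectors"
proof -
  assume c: "c \<in> cplane \<II>"
  obtain t where t: "\<II> = (\<Sum>j\<in>UNIV. t j *\<^sub>R cl_gen j)"
    using \<II> by (auto simp: cl_sphere_def)
  have "c = cl_re c *\<^sub>R cl_one + (\<Sum>j\<in>UNIV. (cl_im \<II> c * t j) *\<^sub>R cl_gen j)"
    using cplane_eq[OF c] by (simp add: t scaleR_sum_right)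
  then show ?thesis unfolding paravectors_def mem_Collect_eq by (intro exI conjI TrueI)
qed

lemma cl_inverse_cplane: "c \<in> cplane \<II> \<Longrightarrow> cl_inverse c \<in> cplane \<II>"
  by (simp add: cl_inverse_def cplane_scaleR cplane_conj)

lemma norm_cl_inverse:
  assumes "c \<in> cplane \<II>"
  shows "norm (cl_inverse c) = 1 / norm c"
proof -
  have "norm (cl_conj c) = norm c"
    using cplane_norm[OF assms] cplane_norm[OF cplane_conj(1)[OF assms]] cplane_conj(2,3)[OF assms]
    by (metis norm_ge_zero power2_eq_iff_nonneg power2_minus)
  then show ?thesis
    by (simp add: cl_inverse_def power2_eq_square)
qed

lemma closed_cplane: "closed (cplane \<II>)"
proof -
  have "closed {c. c = cl_re c *\<^sub>R cl_one + cl_im \<II> c *\<^sub>R \<II>}"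
    by (intro closed_Collect_eq continuous_intros linear_continuous_on bounded_linear_cl_re bounded_linear_cl_im)
  then show ?thesis by (simp flip: cplane_iff)
qed

lemma closed_cplane_upper: "closed (cplane_upper \<II>)"
proof -
  have "closed (cplane \<II> \<inter> {c. 0 \<le> cl_im \<II> c})"
    by (intro closed_Int closed_cplane closed_Collect_le continuous_intros linear_continuous_on
        bounded_linear_cl_im)
  moreover have "cplane_upper \<II> = cplane \<II> \<inter> {c. 0 \<le> cl_im \<II> c}"
    by (auto simp: cplane_upper_iff)
  ultimately show ?thesis by simp
qed

end

section \<open>Bounded measurable functions\<close>

definition bmeas :: "'a measure \<Rightarrow> ('a \<Rightarrow> real) set" where
  "bmeas S = {h \<in> borel_measurable S. bounded (h ` space S)}"

lemma bmeasI: "h \<in> borel_measurable S \<Longrightarrow> (\<And>l. l \<in> space S \<Longrightarrow> \<bar>h l\<bar> \<le> c) \<Longrightarrow> h \<in> bmeas S"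
  by (auto simp: bmeas_def bounded_iff)

lemma bmeas_measurable [measurable_dest]: "h \<in> bmeas S \<Longrightarrow> h \<in> borel_measurable S"
  by (simp add: bmeas_def)

lemma bmeas_bound:
  assumes "h \<in> bmeas S"
  obtains c where "0 \<le> c" "\<And>l. l \<in> space S \<Longrightarrow> \<bar>h l\<bar> \<le> c"
proof -
  obtain c where "\<And>l. l \<in> space S \<Longrightarrow> \<bar>h l\<bar> \<le> c"
    using assms by (auto simp: bmeas_def bounded_iff)
  then show ?thesis
    using that[of "max c 0"] by fastforce
qed

lemma bmeas_cong: "h \<in> bmeas S \<Longrightarrow> (\<And>l. l \<in> space S \<Longrightarrow> h l = k l) \<Longrightarrow> k \<in> bmeas S"
  unfolding bmeas_def using measurable_cong[of S h k borel] image_cong[of "space S" _ h k] by force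

lemma bmeas_const [simp]: "(\<lambda>l. c) \<in> bmeas S"
  by (rule bmeasI[of _ _ "\<bar>c\<bar>"]) auto

lemma bmeas_indicator: "A \<in> sets S \<Longrightarrow> indicator A \<in> bmeas S"
  by (rule bmeasI[of _ _ 1]) (auto simp: indicator_def)

lemma bmeas_add:
  assumes "h \<in> bmeas S" "k \<in> bmeas S"
  shows "(\<lambda>l. h l + k l) \<in> bmeas S"
proof -
  obtain c d where "\<And>l. l \<in> space S \<Longrightarrow> \<bar>h l\<bar> \<le> c" "\<And>l. l \<in> space S \<Longrightarrow> \<bar>k l\<bar> \<le> d"
    using assms by (metis bmeas_bound)
  then show ?thesis
    using assms by (intro bmeasI[of _ _ "c + d"]) (force simp: bmeas_def)+
qed

lemma bmeas_mult:
  assumes "h \<in> bmeas S" "k \<in> bmeas S"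
  shows "(\<lambda>l. h l * k l) \<in> bmeas S"
proof -
  obtain c d where "0 \<le> c" "\<And>l. l \<in> space S \<Longrightarrow> \<bar>h l\<bar> \<le> c" "0 \<le> d" "\<And>l. l \<in> space S \<Longrightarrow> \<bar>k l\<bar> \<le> d"
    using assms by (metis bmeas_bound)
  then show ?thesis
    using assms by (intro bmeasI[of _ _ "c * d"]) (auto simp: bmeas_def abs_mult intro!: mult_mono)
qed

lemma bmeas_scale: "h \<in> bmeas S \<Longrightarrow> (\<lambda>l. r * h l) \<in> bmeas S"
  using bmeas_mult[of "\<lambda>l. r"] by simp

lemma bmeas_uminus: "h \<in> bmeas S \<Longrightarrow> (\<lambda>l. - h l) \<in> bmeas S"
  using bmeas_scale[of h S "-1"] by simp

lemma bmeas_diff: "h \<in> bmeas S \<Longrightarrow> k \<in> bmeas S \<Longrightarrow> (\<lambda>l. h l - k l) \<in> bmeas S"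
  using bmeas_add[OF _ bmeas_uminus] by fastforce

text \<open>A bounded set in a Euclidean space has compact closure, so the continuous function c is
  bounded on the values of \<phi>.\<close>

lemma bmeas_continuous:
  fixes \<phi> :: "'a \<Rightarrow> 'b::euclidean_space"
  assumes "\<phi> \<in> borel_measurable S" "bounded (\<phi> ` space S)" "continuous_on UNIV c"
  shows "(\<lambda>l. c (\<phi> l)) \<in> bmeas S"
proof -
  have "compact (c ` closure (\<phi> ` space S))"
    by (intro compact_continuous_image continuous_on_subset[OF assms(3)])
       (auto simp: compact_closure assms(2))
  then have "bounded (c ` closure (\<phi> ` space S))"
    by (rule compact_imp_bounded)
  then have "bounded ((\<lambda>l. c (\<phi> l)) ` space S)"
    by (rule bounded_subset) (use closure_subset in force)
  moreover have "c \<in> borel_measurable borel"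
    by (rule borel_measurable_continuous_onI[OF assms(3)])
  ultimately show ?thesis
    using assms(1) by (simp add: bmeas_def)
qed

lemma bmeas_simple_approximation:
  assumes h: "h \<in> bmeas S"
  obtains F where "\<And>j. simple_function S (F j)"
    "\<And>j l. l \<in> space S \<Longrightarrow> \<bar>F j l - h l\<bar> \<le> inverse (real (Suc j))"
proof -
  have [measurable]: "h \<in> borel_measurable S"
    using h by (rule bmeas_measurable)
  obtain c where c: "\<And>l. l \<in> space S \<Longrightarrow> \<bar>h l\<bar> \<le> c"
    using h by (metis bmeas_bound)
  \<comment> \<open>Rounding down to the grid of mesh 1/(j+1). Since h is bounded, the integer parts
    take finitely many values.\<close>
  define F where "F j l = real_of_int \<lfloor>h l * real (Suc j)\<rfloor> / real (Suc j)" for j l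
  show ?thesis
  proof (rule that)
    fix j
    have "\<lfloor>h l * real (Suc j)\<rfloor> \<in> {-\<lceil>c * real (Suc j)\<rceil> - 1..\<lceil>c * real (Suc j)\<rceil>}" if "l \<in> space S" for l
    proof -
      have "\<bar>h l * real (Suc j)\<bar> \<le> c * real (Suc j)"
        unfolding abs_mult using c[OF that] by (intro mult_mono) auto
      then show ?thesis
        unfolding atLeastAtMost_iff by linarith
    qed
    then have "(\<lambda>l. \<lfloor>h l * real (Suc j)\<rfloor>) ` space S \<subseteq> {-\<lceil>c * real (Suc j)\<rceil> - 1..\<lceil>c * real (Suc j)\<rceil>}"
      by blast
    then have "finite ((\<lambda>l. \<lfloor>h l * real (Suc j)\<rfloor>) ` space S)"
      by (rule finite_subset) simp
    then have "simple_function S (\<lambda>l. \<lfloor>h l * real (Suc j)\<rfloor>)"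
      by (simp add: simple_function_eq_measurable)
    then show "simple_function S (F j)"
      unfolding F_def by (rule simple_function_compose1)
    fix l
    have "\<bar>\<lfloor>h l * real (Suc j)\<rfloor> - h l * real (Suc j)\<bar> \<le> 1"
      by linarith
    moreover have "F j l - h l = (\<lfloor>h l * real (Suc j)\<rfloor> - h l * real (Suc j)) / real (Suc j)"
      by (simp add: F_def field_simps)
    ultimately show "\<bar>F j l - h l\<bar> \<le> inverse (real (Suc j))"
      by (simp only: abs_divide) (simp add: divide_simps)
  qed
qed

lemma simple_function_indicator_sum:
  fixes p :: "'b \<Rightarrow> real"
  assumes "simple_function S F" "l \<in> space S"
  shows "p (F l) = (\<Sum>c\<in>F ` space S. p c * indicator (F -` {c} \<inter> space S) l)"
proof -
  have "(\<Sum>c\<in>F ` space S. p c * indicator (F -` {c} \<inter> space S) l) = (\<Sum>c\<in>F ` space S. if c = F l then p c else 0)"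
    using assms(2) by (intro sum.cong refl) (auto simp: indicator_def)
  then show ?thesis
    using simple_functionD(1)[OF assms(1)] assms(2) by simp
qed

text \<open>Uniform limits at a fixed rate replace the usual monotone ones: they need no sign and
  are controlled by operator norms, as the construction of \<open>rint\<close> requires. The case
  \<open>cong\<close> is there because a simple function is the combination of its level set
  indicators only on \<open>space S\<close>.\<close>

lemma bmeas_induct [consumes 1, case_names cong indicator scale add limit]:
  assumes h: "h \<in> bmeas S"
    and cong: "\<And>h k. h \<in> bmeas S \<Longrightarrow> P h \<Longrightarrow> (\<And>l. l \<in> space S \<Longrightarrow> h l = k l) \<Longrightarrow> P k"
    and ind: "\<And>A. A \<in> sets S \<Longrightarrow> P (indicator A)"
    and scale: "\<And>r h. h \<in> bmeas S \<Longrightarrow> P h \<Longrightarrow> P (\<lambda>l. r * h l)"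
    and add: "\<And>h k. h \<in> bmeas S \<Longrightarrow> k \<in> bmeas S \<Longrightarrow> P h \<Longrightarrow> P k \<Longrightarrow> P (\<lambda>l. h l + k l)"
    and limit: "\<And>F h. h \<in> bmeas S \<Longrightarrow> (\<And>j. F j \<in> bmeas S) \<Longrightarrow> (\<And>j. P (F j)) \<Longrightarrow>
      (\<And>j l. l \<in> space S \<Longrightarrow> \<bar>F j l - h l\<bar> \<le> inverse (real (Suc j))) \<Longrightarrow> P h"
  shows "P h"
proof -
  have zero: "P (\<lambda>l. 0)"
    using scale[OF bmeas_indicator[OF sets.empty_sets] ind[OF sets.empty_sets], of 0] by simp
  have sum: "(\<lambda>l. \<Sum>c\<in>K. c * indicator (A c) l) \<in> bmeas S \<and> P (\<lambda>l. \<Sum>c\<in>K. c * indicator (A c) l)"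
    if "finite K" and A: "\<And>c. A c \<in> sets S" for K A
    using that(1)
  proof (induction K)
    case (insert c K)
    then show ?case
      using bmeas_add[OF bmeas_scale[OF bmeas_indicator[OF A]] insert.IH[THEN conjunct1]]
        add[OF bmeas_scale[OF bmeas_indicator[OF A]] insert.IH[THEN conjunct1]
          scale[OF bmeas_indicator[OF A] ind[OF A]] insert.IH[THEN conjunct2]]
      unfolding sum.insert[OF insert.hyps] by blast
  qed (simp add: zero)
  have simple: "F \<in> bmeas S \<and> P F" if F: "simple_function S F" for F
  proof -
    note s = sum[OF simple_functionD(1)[OF F] simple_functionD(2)[OF F]]
    note eq = simple_function_indicator_sum[OF F, of _ "\<lambda>c. c", symmetric]
    show ?thesis
      using bmeas_cong[OF s[THEN conjunct1] eq] cong[OF s[THEN conjunct1] s[THEN conjunct2] eq] by blast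
  qed
  obtain F where "\<And>j. simple_function S (F j)"
    "\<And>j l. l \<in> space S \<Longrightarrow> \<bar>F j l - h l\<bar> \<le> inverse (real (Suc j))"
    using bmeas_simple_approximation[OF h] by blast
  then show ?thesis
    using limit[OF h, of F] simple by blast
qed

section \<open>Integrals and other bounded linear maps on bounded functions\<close>

lemma bmeas_integrable:
  assumes "h \<in> bmeas S" "finite_measure N" "sets N = sets S"
  shows "integrable N h"
proof -
  obtain c where "\<And>l. l \<in> space S \<Longrightarrow> \<bar>h l\<bar> \<le> c"
    using assms by (metis bmeas_bound)
  then show ?thesis
    using assms sets_eq_imp_space_eq[OF assms(3)] measurable_cong_sets[OF assms(3) refl]
    by (intro finite_measure.integrable_const_bound[of N h c]) (auto simp: bmeas_def)
qed

lemma bmeas_integral_bound: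
  assumes "h \<in> bmeas S" "finite_measure N" "sets N = sets S" and c: "\<And>l. l \<in> space S \<Longrightarrow> \<bar>h l\<bar> \<le> c"
  shows "\<bar>\<integral>l. h l \<partial>N\<bar> \<le> c * measure N (space S)"
proof -
  interpret finite_measure N by fact
  have sp: "space N = space S" by (rule sets_eq_imp_space_eq[OF assms(3)])
  have "\<bar>\<integral>l. h l \<partial>N\<bar> \<le> (\<integral>l. \<bar>h l\<bar> \<partial>N)"
    by (rule integral_abs_bound)
  also have "\<dots> \<le> (\<integral>l. c \<partial>N)"
    using bmeas_integrable[OF assms(1-3)] c by (intro integral_mono) (auto simp: sp)
  finally show ?thesis by (simp add: sp mult.commute)
qed

lemma LIMSEQ_inverse_Suc_bound:
  fixes X :: "nat \<Rightarrow> 'a::real_normed_vector"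
  assumes "\<And>j. norm (X j - L) \<le> inverse (real (Suc j)) * K"
  shows "X \<longlonglongrightarrow> L"
proof -
  have "(\<lambda>j. inverse (real (Suc j)) * K) \<longlonglongrightarrow> 0"
    by (rule tendsto_mult_left_zero[OF LIMSEQ_inverse_real_of_nat])
  then have "(\<lambda>j. X j - L) \<longlonglongrightarrow> 0"
    by (rule Lim_null_comparison[OF always_eventually, rotated]) (use assms in blast)
  then show ?thesis by (rule LIM_zero_cancel)
qed

lemma bmeas_integral_limit:
  assumes F: "\<And>j. F j \<in> bmeas S" and h: "h \<in> bmeas S"
    and le: "\<And>j l. l \<in> space S \<Longrightarrow> \<bar>F j l - h l\<bar> \<le> inverse (real (Suc j))"
    and N: "finite_measure N" "sets N = sets S"
  shows "(\<lambda>j. \<integral>l. F j l \<partial>N) \<longlonglongrightarrow> (\<integral>l. h l \<partial>N)"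
proof (rule LIMSEQ_inverse_Suc_bound[where K = "measure N (space S)"])
  fix j
  have "(\<integral>l. F j l \<partial>N) - (\<integral>l. h l \<partial>N) = (\<integral>l. F j l - h l \<partial>N)"
    by (rule Bochner_Integration.integral_diff[symmetric]) (intro bmeas_integrable[OF _ N] F h)+
  then show "norm ((\<integral>l. F j l \<partial>N) - (\<integral>l. h l \<partial>N)) \<le> inverse (real (Suc j)) * measure N (space S)"
    using bmeas_integral_bound[OF bmeas_diff[OF F h] N le] by simp
qed

text \<open>Linear, and bounded by K for the supremum over \<open>space S\<close>. This supremum is
  a mere seminorm, as values elsewhere are ignored; hence the formulation through upper bounds c.
  For maps of this kind identities need to be checked on indicators only.\<close>

definition bmeas_operator :: "'a measure \<Rightarrow> real \<Rightarrow> (('a \<Rightarrow> real) \<Rightarrow> 'b::real_normed_vector) \<Rightarrow> bool" where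
  "bmeas_operator S K \<Phi> \<longleftrightarrow>
     (\<forall>h\<in>bmeas S. \<forall>k\<in>bmeas S. \<Phi> (\<lambda>l. h l + k l) = \<Phi> h + \<Phi> k) \<and>
     (\<forall>h\<in>bmeas S. \<forall>r. \<Phi> (\<lambda>l. r * h l) = r *\<^sub>R \<Phi> h) \<and>
     (\<forall>h\<in>bmeas S. \<forall>c\<ge>0. (\<forall>l\<in>space S. \<bar>h l\<bar> \<le> c) \<longrightarrow> norm (\<Phi> h) \<le> c * K)"

lemma bmeas_operatorI:
  assumes "\<And>h k. h \<in> bmeas S \<Longrightarrow> k \<in> bmeas S \<Longrightarrow> \<Phi> (\<lambda>l. h l + k l) = \<Phi> h + \<Phi> k"
    and "\<And>r h. h \<in> bmeas S \<Longrightarrow> \<Phi> (\<lambda>l. r * h l) = r *\<^sub>R \<Phi> h"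
    and "\<And>h c. h \<in> bmeas S \<Longrightarrow> 0 \<le> c \<Longrightarrow> (\<And>l. l \<in> space S \<Longrightarrow> \<bar>h l\<bar> \<le> c) \<Longrightarrow> norm (\<Phi> h) \<le> c * K"
  shows "bmeas_operator S K \<Phi>"
  unfolding bmeas_operator_def using assms by blast

lemma bmeas_operatorD:
  assumes "bmeas_operator S K \<Phi>" "h \<in> bmeas S"
  shows "k \<in> bmeas S \<Longrightarrow> \<Phi> (\<lambda>l. h l + k l) = \<Phi> h + \<Phi> k" "\<Phi> (\<lambda>l. r * h l) = r *\<^sub>R \<Phi> h"
    "0 \<le> c \<Longrightarrow> (\<And>l. l \<in> space S \<Longrightarrow> \<bar>h l\<bar> \<le> c) \<Longrightarrow> norm (\<Phi> h) \<le> c * K"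
  using assms by (simp_all add: bmeas_operator_def)

lemma bmeas_operator_minus:
  assumes "bmeas_operator S K \<Phi>" "h \<in> bmeas S" "k \<in> bmeas S"
  shows "\<Phi> (\<lambda>l. h l - k l) = \<Phi> h - \<Phi> k"
  using bmeas_operatorD(1)[OF assms(1,2) bmeas_scale[OF assms(3), of "-1"]]
    bmeas_operatorD(2)[OF assms(1,3), of "-1"] by simp

lemma bmeas_operator_compose:
  assumes \<Phi>: "bmeas_operator S K \<Phi>" and L: "bounded_linear L"
  shows "bmeas_operator S (K * onorm L) (\<lambda>h. L (\<Phi> h))"
proof (rule bmeas_operatorI)
  show "norm (L (\<Phi> h)) \<le> c * (K * onorm L)"
    if "h \<in> bmeas S" "0 \<le> c" "\<And>l. l \<in> space S \<Longrightarrow> \<bar>h l\<bar> \<le> c" for h c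
    using onorm[OF L, of "\<Phi> h"] mult_right_mono[OF bmeas_operatorD(3)[OF \<Phi> that] onorm_pos_le[OF L]]
    by (simp add: ac_simps)
qed (simp_all add: bmeas_operatorD[OF \<Phi>] linear_add[OF bounded_linear.linear[OF L]]
    linear_scale[OF bounded_linear.linear[OF L]])

lemma bmeas_operator_diff:
  assumes \<Phi>: "bmeas_operator S K \<Phi>" and \<Psi>: "bmeas_operator S K' \<Psi>"
  shows "bmeas_operator S (K + K') (\<lambda>h. \<Phi> h - \<Psi> h)"
proof (rule bmeas_operatorI)
  show "norm (\<Phi> h - \<Psi> h) \<le> c * (K + K')"
    if "h \<in> bmeas S" "0 \<le> c" "\<And>l. l \<in> space S \<Longrightarrow> \<bar>h l\<bar> \<le> c" for h c
    using norm_triangle_ineq4[of "\<Phi> h" "\<Psi> h"] bmeas_operatorD(3)[OF \<Phi> that] bmeas_operatorD(3)[OF \<Psi> that]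
    by (simp add: distrib_left)
qed (simp_all add: bmeas_operatorD(1,2)[OF \<Phi>] bmeas_operatorD(1,2)[OF \<Psi>] scaleR_diff_right)

lemma bmeas_operator_mult:
  assumes \<Phi>: "bmeas_operator S K \<Phi>" and k: "k \<in> bmeas S" "0 \<le> d" "\<And>l. l \<in> space S \<Longrightarrow> \<bar>k l\<bar> \<le> d"
  shows "bmeas_operator S (d * K) (\<lambda>h. \<Phi> (\<lambda>l. h l * k l))"
proof (rule bmeas_operatorI)
  fix h h' and r c
  assume h: "h \<in> bmeas S"
  show "\<Phi> (\<lambda>l. r * h l * k l) = r *\<^sub>R \<Phi> (\<lambda>l. h l * k l)"
    using bmeas_operatorD(2)[OF \<Phi> bmeas_mult[OF h k(1)], of r] by (simp add: mult.assoc)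
  show "\<Phi> (\<lambda>l. (h l + h' l) * k l) = \<Phi> (\<lambda>l. h l * k l) + \<Phi> (\<lambda>l. h' l * k l)" if "h' \<in> bmeas S"
    using bmeas_operatorD(1)[OF \<Phi> bmeas_mult[OF h k(1)] bmeas_mult[OF that k(1)]]
    by (simp add: distrib_right)
  show "norm (\<Phi> (\<lambda>l. h l * k l)) \<le> c * (d * K)"
    if "0 \<le> c" "\<And>l. l \<in> space S \<Longrightarrow> \<bar>h l\<bar> \<le> c"
    using bmeas_operatorD(3)[OF \<Phi> bmeas_mult[OF h k(1)], of "c * d"] that k(2,3)
    by (simp add: abs_mult mult_mono mult.assoc)
qed

text \<open>Combinations of indicators are uniformly dense, and the difference of the two maps is
  continuous for uniform convergence.\<close>

lemma bmeas_operator_ext: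
  assumes \<Phi>: "bmeas_operator S K \<Phi>" and \<Psi>: "bmeas_operator S K' \<Psi>"
    and ind: "\<And>A. A \<in> sets S \<Longrightarrow> \<Phi> (indicator A) = \<Psi> (indicator A)" and h: "h \<in> bmeas S"
  shows "\<Phi> h = \<Psi> h"
proof -
  define \<Delta> where "\<Delta> h = \<Phi> h - \<Psi> h" for h
  have \<Delta>: "bmeas_operator S (K + K') \<Delta>"
    unfolding \<Delta>_def by (rule bmeas_operator_diff[OF \<Phi> \<Psi>])
  have "\<Delta> h = 0"
    using h
  proof (induction h rule: bmeas_induct)
    case (cong h k)
    have k: "k \<in> bmeas S"
      by (rule bmeas_cong[OF cong.hyps])
    \<comment> \<open>The bound with c = 0 shows that functions equal on \<open>space S\<close> have
      the same image.\<close>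
    have "norm (\<Delta> (\<lambda>l. h l - k l)) \<le> 0 * (K + K')"
      by (rule bmeas_operatorD(3)[OF \<Delta> bmeas_diff[OF cong.hyps(1) k]]) (simp_all add: cong.hyps(2))
    then show ?case
      using cong.IH by (simp add: bmeas_operator_minus[OF \<Delta> cong.hyps(1) k])
  next
    case (limit F h)
    have "norm (\<Delta> (F j) - \<Delta> h) \<le> inverse (real (Suc j)) * (K + K')" for j
      using bmeas_operatorD(3)[OF \<Delta> bmeas_diff[OF limit.hyps(2,1)] _ limit.hyps(3)]
      by (simp add: bmeas_operator_minus[OF \<Delta> limit.hyps(2,1)])
    then have "(\<lambda>j. \<Delta> (F j)) \<longlonglongrightarrow> \<Delta> h"
      by (rule LIMSEQ_inverse_Suc_bound)
    then show ?case
      by (simp add: limit.IH LIMSEQ_const_iff)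
  qed (simp_all add: bmeas_operatorD(1,2)[OF \<Delta>], simp add: \<Delta>_def ind)
  then show ?thesis
    by (simp add: \<Delta>_def)
qed

lemma bmeas_operator_integral:
  assumes N: "finite_measure N" "sets N = sets S"
  shows "bmeas_operator S (measure N (space S)) (\<lambda>h. \<integral>l. h l \<partial>N)"
  by (rule bmeas_operatorI)
     (simp_all add: bmeas_integrable[OF _ N] bmeas_integral_bound[OF _ N])

subsection \<open>Signed measures\<close>

text \<open>On a Hahn set Y the supremum defining \<open>jordan_pos\<close> is attained at M
  \<inter> Y: passing from A to A \<inter> Y and on to M \<inter> Y only increases \<mu>. So
  \<open>jordan_pos\<close> is M \<mapsto> \<mu> (M \<inter> Y), whose countable additivity comes
  from the two finite measures.\<close>

lemma jordan_pos_Hahn: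
  assumes N: "finite_measure N1" "finite_measure N2" "sets N1 = sets S" "sets N2 = sets S"
    and \<mu>: "\<And>M. M \<in> sets S \<Longrightarrow> \<mu> M = measure N1 M - measure N2 M"
    and Y: "Y \<in> sets S" "\<And>X. X \<in> sets S \<Longrightarrow> X \<subseteq> Y \<Longrightarrow> 0 \<le> \<mu> X"
      "\<And>X. X \<in> sets S \<Longrightarrow> X \<inter> Y = {} \<Longrightarrow> \<mu> X \<le> 0"
  shows "M \<in> sets S \<Longrightarrow> measure (jordan_pos S \<mu>) M = \<mu> (M \<inter> Y)"
    and "finite_measure (jordan_pos S \<mu>)" and "sets (jordan_pos S \<mu>) = sets S"
proof -
  have add: "\<mu> (A \<union> B) = \<mu> A + \<mu> B" if "A \<in> sets S" "B \<in> sets S" "A \<inter> B = {}" for A B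
    using that N by (simp add: \<mu> finite_measure.finite_measure_Union)
  have sup: "(SUP A\<in>{A \<in> sets S. A \<subseteq> M}. ennreal (\<mu> A)) = ennreal (\<mu> (M \<inter> Y))" if M: "M \<in> sets S" for M
  proof (rule SUP_eqI)
    fix A assume "A \<in> {A \<in> sets S. A \<subseteq> M}"
    then have A: "A \<in> sets S" "A \<subseteq> M" by auto
    have "\<mu> A = \<mu> (A \<inter> Y) + \<mu> (A - Y)"
      using add[of "A \<inter> Y" "A - Y"] A Y(1) by (simp add: Int_Diff_disjoint Int_Diff_Un sets.Int sets.Diff)
    moreover have "\<mu> (A - Y) \<le> 0"
      using A Y(1) by (intro Y(3)) auto
    moreover have "\<mu> (M \<inter> Y) = \<mu> (A \<inter> Y) + \<mu> ((M - A) \<inter> Y)"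
    proof -
      have "M \<inter> Y = (A \<inter> Y) \<union> ((M - A) \<inter> Y)" "(A \<inter> Y) \<inter> ((M - A) \<inter> Y) = {}"
        using A by auto
      then show ?thesis
        using add[of "A \<inter> Y" "(M - A) \<inter> Y"] A M Y(1) by auto
    qed
    moreover have "0 \<le> \<mu> ((M - A) \<inter> Y)"
      using A M Y(1) by (intro Y(2)) auto
    ultimately show "ennreal (\<mu> A) \<le> ennreal (\<mu> (M \<inter> Y))"
      by (intro ennreal_leI) linarith
  next
    fix u assume "\<And>A. A \<in> {A \<in> sets S. A \<subseteq> M} \<Longrightarrow> ennreal (\<mu> A) \<le> u"
    then show "ennreal (\<mu> (M \<inter> Y)) \<le> u"
      using M Y(1) by auto
  qed
  have eq: "jordan_pos S \<mu> = measure_of (space S) (sets S) (\<lambda>M. ennreal (\<mu> (M \<inter> Y)))"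
    unfolding jordan_pos_def by (rule measure_of_eq) (use sets.space_closed sup in \<open>auto simp: sets.sigma_sets_eq\<close>)
  show sets: "sets (jordan_pos S \<mu>) = sets S"
    by (simp add: jordan_pos_def)
  have em: "emeasure (jordan_pos S \<mu>) M = ennreal (\<mu> (M \<inter> Y))" if M: "M \<in> sets S" for M
    unfolding eq
  proof (rule emeasure_measure_of_sigma[OF _ _ _ M])
    show "sigma_algebra (space S) (sets S)" ..
    show "positive (sets S) (\<lambda>M. ennreal (\<mu> (M \<inter> Y)))"
      by (simp add: positive_def \<mu>)
    show "countably_additive (sets S) (\<lambda>M. ennreal (\<mu> (M \<inter> Y)))"
      unfolding countably_additive_def
    proof (intro allI impI)
      fix A :: "nat \<Rightarrow> 'a set" assume A: "range A \<subseteq> sets S" "disjoint_family A"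
      have "range (\<lambda>i. A i \<inter> Y) \<subseteq> sets S" "disjoint_family (\<lambda>i. A i \<inter> Y)"
        using A Y(1) by (auto simp: disjoint_family_on_def)
      then have "(\<lambda>i. measure N1 (A i \<inter> Y) - measure N2 (A i \<inter> Y)) sums
          (measure N1 (\<Union>i. A i \<inter> Y) - measure N2 (\<Union>i. A i \<inter> Y))"
        using N by (intro sums_diff finite_measure.finite_measure_UNION) auto
      then have "(\<lambda>i. \<mu> (A i \<inter> Y)) sums \<mu> (\<Union>(range A) \<inter> Y)"
        using A Y(1) by (simp add: \<mu> image_subset_iff sets.countable_UN' flip: UN_extend_simps)
      then show "(\<Sum>i. ennreal (\<mu> (A i \<inter> Y))) = ennreal (\<mu> (\<Union>(range A) \<inter> Y))"
        using A Y by (intro suminf_ennreal_eq) auto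
    qed
  qed
  have space: "space (jordan_pos S \<mu>) = space S"
    by (rule sets_eq_imp_space_eq[OF sets])
  show "finite_measure (jordan_pos S \<mu>)"
    by (rule finite_measureI) (simp add: space em)
  show "measure (jordan_pos S \<mu>) M = \<mu> (M \<inter> Y)" if "M \<in> sets S"
    using that Y by (simp add: measure_def em)
qed

text \<open>Any decomposition into finite measures may replace the Jordan one: for a Hahn set Y the
  positive part is \<mu> on Y and the negative part is - \<mu> off Y, and both differences of
  integrals are bounded linear in h and agree on indicators.\<close>

lemma signed_integral_diff:
  assumes N: "finite_measure N1" "finite_measure N2" "sets N1 = sets S" "sets N2 = sets S"
    and \<mu>: "\<And>M. M \<in> sets S \<Longrightarrow> \<mu> M = measure N1 M - measure N2 M"
    and h: "h \<in> bmeas S"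
  shows "signed_integral S \<mu> h = (\<integral>l. h l \<partial>N1) - (\<integral>l. h l \<partial>N2)"
proof -
  obtain Y where Y: "Y \<in> sets N1" "\<And>X. X \<in> sets N1 \<Longrightarrow> X \<subseteq> Y \<Longrightarrow> emeasure N2 X \<le> emeasure N1 X"
    "\<And>X. X \<in> sets N1 \<Longrightarrow> X \<inter> Y = {} \<Longrightarrow> emeasure N1 X \<le> emeasure N2 X"
    using finite_unsigned_Hahn_decomposition[OF N(1,2)] N(3,4) by metis
  have le: "measure N X \<le> measure N' X" if "emeasure N X \<le> emeasure N' X" "finite_measure N'" for N N' X
    unfolding measure_def using that(1)
    by (rule enn2real_mono) (simp add: finite_measure.emeasure_finite[OF that(2)] less_top[symmetric])
  have Y1: "0 \<le> \<mu> X" if "X \<in> sets S" "X \<subseteq> Y" for X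
    using le[OF Y(2) N(1)] that by (simp add: \<mu> N)
  have Y2: "\<mu> X \<le> 0" if "X \<in> sets S" "X \<inter> Y = {}" for X
    using le[OF Y(3) N(2)] that by (simp add: \<mu> N)
  have Ys: "Y \<in> sets S" "space S - Y \<in> sets S"
    using Y(1) N by auto
  define P where "P = jordan_pos S \<mu>"
  define Q where "Q = jordan_pos S (\<lambda>A. - \<mu> A)"
  have P: "finite_measure P" "sets P = sets S" "\<And>M. M \<in> sets S \<Longrightarrow> measure P M = \<mu> (M \<inter> Y)"
    unfolding P_def using jordan_pos_Hahn[OF N \<mu> Ys(1) Y1 Y2] by blast+
  have mneg: "- \<mu> M = measure N2 M - measure N1 M" if "M \<in> sets S" for M
    using \<mu>[OF that] by simp
  have Y3: "0 \<le> - \<mu> X" if "X \<in> sets S" "X \<subseteq> space S - Y" for X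
    using Y2[of X] that by auto
  have Y4: "- \<mu> X \<le> 0" if "X \<in> sets S" "X \<inter> (space S - Y) = {}" for X
    using Y1[of X] that sets.sets_into_space[OF that(1)] by auto
  have Q: "finite_measure Q" "sets Q = sets S" "\<And>M. M \<in> sets S \<Longrightarrow> measure Q M = - \<mu> (M \<inter> (space S - Y))"
    unfolding Q_def using jordan_pos_Hahn[OF N(2,1,4,3) mneg Ys(2) Y3 Y4] by blast+
  have "(\<integral>l. h l \<partial>P) - (\<integral>l. h l \<partial>Q) = (\<integral>l. h l \<partial>N1) - (\<integral>l. h l \<partial>N2)"
  proof (rule bmeas_operator_ext[OF
        bmeas_operator_diff[OF bmeas_operator_integral[OF P(1,2)] bmeas_operator_integral[OF Q(1,2)]]
        bmeas_operator_diff[OF bmeas_operator_integral[OF N(1,3)] bmeas_operator_integral[OF N(2,4)]] _ h])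
    fix A assume A: "A \<in> sets S"
    have split: "measure N (A \<inter> Y) + measure N (A \<inter> (space S - Y)) = measure N A" if "finite_measure N" "sets N = sets S" for N
      using A Ys that sets.sets_into_space[OF A]
      by (subst finite_measure.finite_measure_Union[symmetric]) (auto intro!: arg_cong[of _ _ "measure N"])
    have int: "(\<integral>l. indicator A l \<partial>N) = measure N A" if "sets N = sets S" for N
      using sets.sets_into_space[OF A] sets_eq_imp_space_eq[OF that] by (simp add: Int_absorb2)
    show "(\<integral>l. (indicator A l :: real) \<partial>P) - (\<integral>l. indicator A l \<partial>Q) = (\<integral>l. indicator A l \<partial>N1) - (\<integral>l. indicator A l \<partial>N2)"
      unfolding int[OF P(2)] int[OF Q(2)] int[OF N(3)] int[OF N(4)]
      using A Ys split[OF N(1,3)] split[OF N(2,4)] by (simp add: P(3) Q(3) \<mu>)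
  qed
  then show ?thesis
    by (simp add: signed_integral_def P_def Q_def)
qed

section \<open>Projection-valued measures\<close>

locale pvm =
  fixes S :: "'a measure" and E :: "'a set \<Rightarrow> 'v::{real_inner,banach} \<Rightarrow>\<^sub>L 'v"
  assumes E_symmetric: "M \<in> sets S \<Longrightarrow> symmetric_op (E M)"
    and E_idem: "M \<in> sets S \<Longrightarrow> E M (E M x) = E M x"
    and E_space: "E (space S) = id_blinfun"
    and E_sums: "range A \<subseteq> sets S \<Longrightarrow> disjoint_family A \<Longrightarrow> (\<lambda>i. E (A i) x) sums E (\<Union>i. A i) x"
begin

lemma E_inner: "M \<in> sets S \<Longrightarrow> E M x \<bullet> y = E M x \<bullet> E M y"
  by (metis E_idem E_symmetric symmetric_opD)

lemma E_quad: "M \<in> sets S \<Longrightarrow> E M x \<bullet> x = (norm (E M x))\<^sup>2"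
  by (simp add: E_inner[of M x x] power2_norm_eq_inner)

text \<open>Additivity along the constant sequence of empty sets: a summable series with constant
  terms has terms 0.\<close>

lemma E_empty [simp]: "E {} = 0"
proof (rule blinfun_eqI)
  fix x
  have "summable (\<lambda>i :: nat. E {} x)"
    using E_sums[of "\<lambda>_. {}" x] by (auto simp: disjoint_family_on_def sums_iff)
  then have "(\<lambda>i :: nat. E {} x) \<longlonglongrightarrow> 0"
    by (rule summable_LIMSEQ_zero)
  then show "E {} x = blinfun_apply 0 x"
    by (simp add: LIMSEQ_const_iff)
qed

lemma E_Un:
  assumes "A \<in> sets S" "B \<in> sets S" "A \<inter> B = {}"
  shows "E (A \<union> B) x = E A x + E B x"
proof -
  have "(\<lambda>i. E (binaryset A B i) x) sums E (\<Union>i. binaryset A B i) x"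
    using assms by (intro E_sums) (auto simp: range_binaryset_eq disjoint_family_on_def binaryset_def)
  moreover have "(\<lambda>i. E (binaryset A B i) x) sums (E A x + E B x)"
    by (rule binaryset_sums) simp
  ultimately show ?thesis
    by (simp add: UN_binaryset_eq sums_unique2)
qed

lemma E_norm_le:
  assumes M: "M \<in> sets S"
  shows "norm (E M x) \<le> norm x"
proof -
  have "(norm (E M x))\<^sup>2 \<le> norm (E M x) * norm x"
    unfolding E_quad[OF M, symmetric] by (rule norm_cauchy_schwarz)
  then show ?thesis
    by (cases "E M x = 0") (simp_all add: power2_eq_square)
qed

text \<open>Orthogonality is forced by the sum being a projection. On E B x the projection for A
  \<union> B has squared norm |E A E B x|^2 + |E B x|^2, but it cannot enlarge |E B x|.\<close>

lemma E_disjoint: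
  assumes "A \<in> sets S" "B \<in> sets S" "A \<inter> B = {}"
  shows "E A (E B x) = 0"
proof -
  have "(norm (E (A \<union> B) (E B x)))\<^sup>2 = E (A \<union> B) (E B x) \<bullet> E B x"
    using assms by (simp add: E_quad sets.Un)
  also have "\<dots> = E A (E B x) \<bullet> E B x + E B (E B x) \<bullet> E B x"
    unfolding E_Un[OF assms] by (rule inner_add_left)
  also have "\<dots> = (norm (E A (E B x)))\<^sup>2 + (norm (E B x))\<^sup>2"
    unfolding E_quad[OF assms(1)] E_idem[OF assms(2)] by (simp add: power2_norm_eq_inner)
  finally have "(norm (E (A \<union> B) (E B x)))\<^sup>2 = (norm (E A (E B x)))\<^sup>2 + (norm (E B x))\<^sup>2" .
  moreover have "(norm (E (A \<union> B) (E B x)))\<^sup>2 \<le> (norm (E B x))\<^sup>2"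
    using assms by (intro power_mono E_norm_le) auto
  ultimately show ?thesis by simp
qed

lemma E_Int:
  assumes A: "A \<in> sets S" and B: "B \<in> sets S"
  shows "E A (E B x) = E (A \<inter> B) x"
proof -
  have sets: "A \<inter> B \<in> sets S" "A - B \<in> sets S" "B - A \<in> sets S"
    using A B by auto
  have un: "(A \<inter> B) \<union> (B - A) = B" "(A \<inter> B) \<union> (A - B) = A"
    and disj: "(A \<inter> B) \<inter> (B - A) = {}" "(A \<inter> B) \<inter> (A - B) = {}" "A \<inter> (B - A) = {}" "(A - B) \<inter> (A \<inter> B) = {}"
    by auto
  have "E B x = E (A \<inter> B) x + E (B - A) x"
    using E_Un[OF sets(1,3) disj(1), of x] by (simp only: un)
  then have "E A (E B x) = E A (E (A \<inter> B) x)"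
    using E_disjoint[OF A sets(3) disj(3), of x] by (simp add: blinfun.add_right)
  also have "\<dots> = E (A \<inter> B) (E (A \<inter> B) x) + E (A - B) (E (A \<inter> B) x)"
    using E_Un[OF sets(1,2) disj(2), of "E (A \<inter> B) x"] by (simp only: un)
  also have "\<dots> = E (A \<inter> B) x"
    using E_disjoint[OF sets(2,1) disj(4), of x] by (simp add: E_idem sets)
  finally show ?thesis .
qed

section \<open>Integrating bounded real functions against a projection-valued measure\<close>

definition quad_measure :: "'v \<Rightarrow> 'a measure" where
  "quad_measure x = measure_of (space S) (sets S) (\<lambda>M. ennreal (E M x \<bullet> x))"

lemma sets_quad_measure [simp, measurable_cong]: "sets (quad_measure x) = sets S"
  by (simp add: quad_measure_def)

lemma space_quad_measure [simp]: "space (quad_measure x) = space S"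
  by (simp add: quad_measure_def)

lemma emeasure_quad_measure:
  assumes M: "M \<in> sets S"
  shows "emeasure (quad_measure x) M = ennreal (E M x \<bullet> x)"
  unfolding quad_measure_def
proof (rule emeasure_measure_of_sigma[OF _ _ _ M])
  show "sigma_algebra (space S) (sets S)" ..
  show "positive (sets S) (\<lambda>M. ennreal (E M x \<bullet> x))"
    by (simp add: positive_def)
  show "countably_additive (sets S) (\<lambda>M. ennreal (E M x \<bullet> x))"
    unfolding countably_additive_def
  proof (intro allI impI)
    fix A :: "nat \<Rightarrow> 'a set" assume A: "range A \<subseteq> sets S" "disjoint_family A"
    then have "(\<lambda>i. E (A i) x \<bullet> x) sums (E (\<Union>(range A)) x \<bullet> x)"
      by (intro bounded_linear.sums[OF bounded_linear_inner_left] E_sums)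
    then show "(\<Sum>i. ennreal (E (A i) x \<bullet> x)) = ennreal (E (\<Union>(range A)) x \<bullet> x)"
      using A by (intro suminf_ennreal_eq) (auto simp: E_quad)
  qed
qed

lemma finite_quad_measure [simp]: "finite_measure (quad_measure x)"
  by (rule finite_measureI) (simp add: emeasure_quad_measure)

lemma measure_quad_measure: "M \<in> sets S \<Longrightarrow> measure (quad_measure x) M = E M x \<bullet> x"
  by (simp add: measure_def emeasure_quad_measure E_quad)

lemmas quad_integrable = bmeas_integrable[OF _ finite_quad_measure sets_quad_measure]

lemma quad_integral_bound:
  assumes "h \<in> bmeas S" "\<And>l. l \<in> space S \<Longrightarrow> \<bar>h l\<bar> \<le> c"
  shows "\<bar>\<integral>l. h l \<partial>quad_measure x\<bar> \<le> c * (norm x)\<^sup>2"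
  using bmeas_integral_bound[OF assms(1) finite_quad_measure sets_quad_measure assms(2)]
  by (simp add: measure_quad_measure E_space power2_norm_eq_inner)

text \<open>Describing the integral by its quadratic form, not as a limit, lets linearity, changes
  of variables and indifference to null sets be read off from scalar integrals through
  \<open>rint_eqI\<close>.\<close>

definition rint :: "('a \<Rightarrow> real) \<Rightarrow> 'v \<Rightarrow>\<^sub>L 'v" where
  "rint h = (THE A. symmetric_op A \<and> (\<forall>x. A x \<bullet> x = (\<integral>l. h l \<partial>quad_measure x)))"

lemma rint_eqI:
  assumes "symmetric_op A" "\<And>x. A x \<bullet> x = (\<integral>l. h l \<partial>quad_measure x)"
  shows "rint h = A"
  unfolding rint_def
  by (rule the_equality) (use assms in \<open>auto intro: symmetric_op_eqI\<close>)

text \<open>Only the passage to uniform limits is not algebraic: the forms of the approximants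
  differ by at most a multiple of the squared norm, and for symmetric operators this bounds the
  operator norm, so the approximants are Cauchy.\<close>

lemma rint_exists:
  assumes "h \<in> bmeas S"
  shows "\<exists>A. symmetric_op A \<and> (\<forall>x. A x \<bullet> x = (\<integral>l. h l \<partial>quad_measure x))"
  using assms
proof (induction h rule: bmeas_induct)
  case (cong h k)
  have "(\<integral>l. h l \<partial>quad_measure x) = (\<integral>l. k l \<partial>quad_measure x)" for x
    by (rule Bochner_Integration.integral_cong[OF refl]) (use cong.hyps(2) in simp)
  then show ?case
    using cong.IH by simp
next
  case (indicator A)
  then show ?case
    by (intro exI[of _ "E A"]) (simp add: E_symmetric measure_quad_measure)
next
  case (scale r h)
  then obtain A where "symmetric_op A" "\<And>x. A x \<bullet> x = (\<integral>l. h l \<partial>quad_measure x)" by blast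
  then show ?case
    by (intro exI[of _ "r *\<^sub>R A"]) (simp add: symmetric_op_scaleR blinfun.scaleR_left)
next
  case (add h k)
  then obtain A B where "symmetric_op A" "\<And>x. A x \<bullet> x = (\<integral>l. h l \<partial>quad_measure x)"
    "symmetric_op B" "\<And>x. B x \<bullet> x = (\<integral>l. k l \<partial>quad_measure x)" by blast
  then show ?case
    using add by (intro exI[of _ "A + B"])
      (simp add: symmetric_op_add blinfun.add_left inner_add_left quad_integrable)
next
  case (limit F h)
  then obtain A where A: "\<And>j. symmetric_op (A j)" "\<And>j x. A j x \<bullet> x = (\<integral>l. F j l \<partial>quad_measure x)"
    by metis
  have le: "norm (A i - A j) \<le> inverse (real (Suc i)) + inverse (real (Suc j))" for i j
  proof (rule symmetric_op_norm_le[OF symmetric_op_diff[OF A(1) A(1)]])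
    fix x
    have "(A i - A j) x \<bullet> x = (\<integral>l. F i l - F j l \<partial>quad_measure x)"
      using limit by (simp add: blinfun.diff_left inner_diff_left A(2) quad_integrable)
    moreover have "\<bar>F i l - F j l\<bar> \<le> inverse (real (Suc i)) + inverse (real (Suc j))" if "l \<in> space S" for l
      using limit.hyps(3)[OF that, of i] limit.hyps(3)[OF that, of j] by linarith
    ultimately show "\<bar>(A i - A j) x \<bullet> x\<bar> \<le> (inverse (real (Suc i)) + inverse (real (Suc j))) * (norm x)\<^sup>2"
      using quad_integral_bound[OF bmeas_diff[OF limit.hyps(2,2)]] by simp
  qed simp
  have "Cauchy A"
  proof (rule metric_CauchyI)
    fix e :: real assume "0 < e"
    then obtain N where N: "inverse (real (Suc N)) < e / 2"
      using reals_Archimedean[of "e / 2"] by auto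
    have "dist (A i) (A j) < e" if "i \<ge> N" "j \<ge> N" for i j
    proof -
      have "inverse (real (Suc i)) \<le> inverse (Suc N)" "inverse (real (Suc j)) \<le> inverse (Suc N)"
        using that by (simp_all add: field_simps)
      then show ?thesis
        using le[of i j] N unfolding dist_norm by linarith
    qed
    then show "\<exists>M. \<forall>i\<ge>M. \<forall>j\<ge>M. dist (A i) (A j) < e" by blast
  qed
  then obtain B where B: "A \<longlonglongrightarrow> B"
    by (auto simp: Cauchy_convergent_iff convergent_def)
  have "B x \<bullet> x = (\<integral>l. h l \<partial>quad_measure x)" for x
  proof (rule LIMSEQ_unique)
    show "(\<lambda>j. A j x \<bullet> x) \<longlonglongrightarrow> B x \<bullet> x"
      by (intro tendsto_intros B)
    show "(\<lambda>j. A j x \<bullet> x) \<longlonglongrightarrow> (\<integral>l. h l \<partial>quad_measure x)"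
      unfolding A(2) by (rule bmeas_integral_limit[OF limit.hyps(2,1,3)]) simp_all
  qed
  then show ?case
    using symmetric_op_limit[OF A(1) B] by blast
qed

lemma rint_symmetric: "h \<in> bmeas S \<Longrightarrow> symmetric_op (rint h)"
  and rint_quad: "h \<in> bmeas S \<Longrightarrow> rint h x \<bullet> x = (\<integral>l. h l \<partial>quad_measure x)"
  using rint_exists[of h] rint_eqI[of _ h] by auto

lemma rint_cong: "(\<And>l. l \<in> space S \<Longrightarrow> h l = k l) \<Longrightarrow> rint h = rint k"
  unfolding rint_def
  by (intro arg_cong[of _ _ The] ext arg_cong2[of _ _ _ _ "(\<and>)"] all_cong1
      arg_cong2[of _ _ _ _ "(=)"] Bochner_Integration.integral_cong refl) simp

lemma rint_indicator: "A \<in> sets S \<Longrightarrow> rint (indicator A) = E A"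
  by (rule rint_eqI) (simp_all add: E_symmetric measure_quad_measure)

lemma rint_scale: "h \<in> bmeas S \<Longrightarrow> rint (\<lambda>l. r * h l) = r *\<^sub>R rint h"
  by (rule rint_eqI) (simp_all add: symmetric_op_scaleR rint_symmetric rint_quad blinfun.scaleR_left)

lemma rint_add: "h \<in> bmeas S \<Longrightarrow> k \<in> bmeas S \<Longrightarrow> rint (\<lambda>l. h l + k l) = rint h + rint k"
  by (rule rint_eqI)
     (simp_all add: symmetric_op_add rint_symmetric rint_quad blinfun.add_left inner_add_left quad_integrable)

lemma rint_uminus: "h \<in> bmeas S \<Longrightarrow> rint (\<lambda>l. - h l) = - rint h"
  using rint_scale[of h "-1"] by simp

lemma rint_diff: "h \<in> bmeas S \<Longrightarrow> k \<in> bmeas S \<Longrightarrow> rint (\<lambda>l. h l - k l) = rint h - rint k"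
  using rint_add[OF _ bmeas_uminus, of h k] by (simp add: rint_uminus)

lemma rint_1: "rint (\<lambda>l. 1) = id_blinfun"
  using rint_indicator[of "space S"] rint_cong[of "indicator (space S)" "\<lambda>l. 1"] by (simp add: E_space)

lemma rint_const: "rint (\<lambda>l. c) = c *\<^sub>R id_blinfun"
  using rint_scale[of "\<lambda>l. 1" c] by (simp add: rint_1)

lemma rint_norm_le:
  assumes "h \<in> bmeas S" "\<And>l. l \<in> space S \<Longrightarrow> \<bar>h l\<bar> \<le> c" "0 \<le> c"
  shows "norm (rint h) \<le> c"
  by (rule symmetric_op_norm_le[OF rint_symmetric[OF assms(1)] _ assms(3)])
     (use assms in \<open>simp add: rint_quad quad_integral_bound\<close>)

lemma bmeas_operator_rint: "bmeas_operator S 1 rint"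
  by (rule bmeas_operatorI) (simp_all add: rint_add rint_scale rint_norm_le)

text \<open>Both sides are bounded linear in h and agree on indicators. Applied to J it gives
  \<open>J_rint\<close>, applied to right multiplications it gives the right linearity of the
  integral.\<close>

lemma rint_commute:
  assumes "h \<in> bmeas S" and C: "\<And>M x. M \<in> sets S \<Longrightarrow> C (E M x) = E M (C x)" "bounded_linear C"
  shows "C (rint h x) = rint h (C x)"
  by (rule bmeas_operator_ext[OF bmeas_operator_compose bmeas_operator_compose _ assms(1)])
     (auto intro!: bmeas_operator_rint bounded_linear_compose[OF C(2)] blinfun.bounded_linear_left
        simp: rint_indicator C)

text \<open>Multiplicativity is extended one factor at a time: \<open>E_Int\<close> settles two
  indicators, this lemma frees one factor, and \<open>rint_mult\<close> the other. In each round
  both sides are bounded linear in the factor being freed.\<close>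

lemma rint_mult_indicator:
  assumes h: "h \<in> bmeas S" and A: "A \<in> sets S"
  shows "rint (\<lambda>l. indicator A l * h l) = E A o\<^sub>L rint h"
proof -
  have "rint (\<lambda>l. h l * indicator A l) = E A o\<^sub>L rint h"
  proof (rule bmeas_operator_ext[OF bmeas_operator_mult[OF bmeas_operator_rint bmeas_indicator[OF A], of 1]
        bmeas_operator_compose[OF bmeas_operator_rint
          bounded_bilinear.bounded_linear_right[OF bounded_bilinear_blinfun_compose]] _ h])
    show "rint (\<lambda>l. indicator B l * indicator A l) = E A o\<^sub>L rint (indicator B)" if "B \<in> sets S" for B
      using A that
      by (intro blinfun_eqI) (simp add: rint_indicator E_Int sets.Int Int_commute flip: indicator_inter_arith)
  qed (simp_all add: indicator_def)
  then show ?thesis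
    by (simp add: mult.commute)
qed

lemma rint_mult:
  assumes h: "h \<in> bmeas S" and k: "k \<in> bmeas S"
  shows "rint (\<lambda>l. h l * k l) = rint h o\<^sub>L rint k"
proof -
  obtain d where d: "0 \<le> d" "\<And>l. l \<in> space S \<Longrightarrow> \<bar>k l\<bar> \<le> d"
    using bmeas_bound[OF k] by metis
  show ?thesis
    by (rule bmeas_operator_ext[OF bmeas_operator_mult[OF bmeas_operator_rint k d]
          bmeas_operator_compose[OF bmeas_operator_rint
            bounded_bilinear.bounded_linear_left[OF bounded_bilinear_blinfun_compose]] _ h])
       (simp_all add: rint_mult_indicator k rint_indicator)
qed

lemma rint_mult_apply: "h \<in> bmeas S \<Longrightarrow> k \<in> bmeas S \<Longrightarrow> rint h (rint k x) = rint (\<lambda>l. h l * k l) x"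
  by (simp add: rint_mult)

lemma rint_rint_commute:
  assumes "h \<in> bmeas S" "k \<in> bmeas S"
  shows "rint h (rint k x) = rint k (rint h x)"
  unfolding rint_mult_apply[OF assms] rint_mult_apply[OF assms(2,1)] by (simp add: mult.commute)

lemma quad_measure_null:
  assumes "M \<in> sets S" "E M = 0"
  shows "AE l in quad_measure x. l \<notin> M"
  by (rule AE_I[where N = M]) (use assms in \<open>auto simp: emeasure_quad_measure\<close>)

lemma rint_cong_null:
  assumes "h \<in> bmeas S" "k \<in> bmeas S" "M \<in> sets S" "E M = 0" "\<And>l. l \<in> space S - M \<Longrightarrow> h l = k l"
  shows "rint h = rint k"
proof (rule rint_eqI[OF rint_symmetric[OF assms(2)]])
  fix x
  have "(\<integral>l. h l \<partial>quad_measure x) = (\<integral>l. k l \<partial>quad_measure x)"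
  proof (rule integral_cong_AE)
    show "AE l in quad_measure x. h l = k l"
      using quad_measure_null[OF assms(3,4)] AE_space by eventually_elim (use assms(5) in simp)
  qed (use assms(1,2) in \<open>simp_all add: bmeas_measurable\<close>)
  then show "rint k x \<bullet> x = (\<integral>l. h l \<partial>quad_measure x)"
    by (simp add: rint_quad assms)
qed

lemma rint_positive:
  assumes "h \<in> bmeas S" "\<And>l. l \<in> space S \<Longrightarrow> 0 \<le> h l"
  shows "positive_op (rint h)"
  unfolding positive_op_def
  by (auto simp: rint_quad assms intro!: Bochner_Integration.integral_nonneg)

text \<open>Polarization writes M \<mapsto> E M x \<bullet> y as the difference of two quadratic
  measures, at vectors u and v that do not depend on M; \<open>signed_integral_diff\<close> then
  applies.\<close>

lemma signed_integral_rint: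
  assumes h: "h \<in> bmeas S"
  shows "signed_integral S (\<lambda>M. E M x \<bullet> y) h = rint h x \<bullet> y"
proof -
  define u where "u = (1/2) *\<^sub>R (x + y)"
  define v where "v = (1/2) *\<^sub>R (x - y)"
  have polar: "A x \<bullet> y = A u \<bullet> u - A v \<bullet> v" if "symmetric_op A" for A
    using symmetric_opD[OF that, of y x]
    by (simp add: u_def v_def blinfun.bilinear_simps inner_add_left inner_add_right
        inner_diff_left inner_diff_right inner_commute field_simps)
  have "signed_integral S (\<lambda>M. E M x \<bullet> y) h = (\<integral>l. h l \<partial>quad_measure u) - (\<integral>l. h l \<partial>quad_measure v)"
    by (rule signed_integral_diff) (simp_all add: h measure_quad_measure polar[OF E_symmetric])
  then show ?thesis
    by (simp add: polar[OF rint_symmetric[OF h]] rint_quad h)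
qed

end

section \<open>Image measures and change of variables\<close>

lemma (in pvm) pvm_image:
  fixes S' :: "'c measure"
  assumes f: "f \<in> measurable S S'"
  shows "pvm S' (\<lambda>M. E (f -` M \<inter> space S))"
proof
  fix M x assume "M \<in> sets S'"
  then have "f -` M \<inter> space S \<in> sets S" using f by (rule measurable_sets[rotated])
  then show "symmetric_op (E (f -` M \<inter> space S))" "E (f -` M \<inter> space S) (E (f -` M \<inter> space S) x) = E (f -` M \<inter> space S) x"
    by (simp_all add: E_symmetric E_idem)
next
  have "f -` space S' \<inter> space S = space S"
    using measurable_space[OF f] by auto
  then show "E (f -` space S' \<inter> space S) = id_blinfun"
    by (simp add: E_space)
next
  fix A :: "nat \<Rightarrow> 'c set" and x assume A: "range A \<subseteq> sets S'" "disjoint_family A"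
  have "(\<lambda>i. E (f -` A i \<inter> space S) x) sums E (\<Union>i. f -` A i \<inter> space S) x"
    using A f by (intro E_sums) (auto simp: disjoint_family_on_def intro!: measurable_sets[of f S S'])
  then show "(\<lambda>i. E (f -` A i \<inter> space S) x) sums E (f -` (\<Union>i. A i) \<inter> space S) x"
    by (simp add: vimage_UN)
qed

lemma (in pvm) rint_image:
  assumes f: "f \<in> measurable S S'" and h: "h \<in> bmeas S'"
  shows "pvm.rint S' (\<lambda>M. E (f -` M \<inter> space S)) h = rint (\<lambda>l. h (f l))"
    and "(\<lambda>l. h (f l)) \<in> bmeas S"
proof -
  interpret image: pvm S' "\<lambda>M. E (f -` M \<inter> space S)" by (rule pvm_image[OF f])
  obtain c where c: "\<And>l. l \<in> space S' \<Longrightarrow> \<bar>h l\<bar> \<le> c"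
    using h by (metis bmeas_bound)
  show hf: "(\<lambda>l. h (f l)) \<in> bmeas S"
    by (rule bmeasI[OF measurable_compose[OF f bmeas_measurable[OF h]] c[OF measurable_space[OF f]]])
  have "image.quad_measure x = distr (quad_measure x) S' f" for x
  proof (rule measure_eqI)
    fix M assume "M \<in> sets (image.quad_measure x)"
    then have M: "M \<in> sets S'" by simp
    have f': "f \<in> measurable (quad_measure x) S'"
      using f measurable_cong_sets[OF sets_quad_measure refl] by blast
    show "emeasure (image.quad_measure x) M = emeasure (distr (quad_measure x) S' f) M"
      using measurable_sets[OF f M]
      by (simp add: emeasure_distr[OF f' M] image.emeasure_quad_measure M emeasure_quad_measure)
  qed simp
  moreover have "(\<integral>l. h l \<partial>distr (quad_measure x) S' f) = (\<integral>l. h (f l) \<partial>quad_measure x)" for x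
    by (rule integral_distr) (use f h in \<open>auto simp: bmeas_measurable cong: measurable_cong_sets\<close>)
  ultimately show "image.rint h = rint (\<lambda>l. h (f l))"
    by (intro image.rint_eqI rint_symmetric[OF hf]) (simp add: rint_quad[OF hf])
qed

subsection \<open>Uniqueness\<close>

text \<open>Indicators of closed sets are pointwise limits of continuous functions with values
  between 0 and 1, and the closed sets are an intersection-stable generator of the Borel
  sets.\<close>

lemma finite_borel_measure_eqI:
  fixes N1 N2 :: "'b::{metric_space,second_countable_topology} measure"
  assumes N: "finite_measure N1" "finite_measure N2" "sets N1 = sets borel" "sets N2 = sets borel"
    and eq: "\<And>c :: 'b \<Rightarrow> real. continuous_on UNIV c \<Longrightarrow> (\<And>v. 0 \<le> c v \<and> c v \<le> 1) \<Longrightarrow> (\<integral>v. c v \<partial>N1) = (\<integral>v. c v \<partial>N2)"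
  shows "N1 = N2"
proof -
  have closed_eq: "measure N1 K = measure N2 K" if K: "closed K" "K \<noteq> {}" for K
  proof -
    \<comment> \<open>A tent over K that reaches 0 at distance 1/j. K is nonempty here because
      \<open>infdist v {}\<close> is 0, which would make the tent constantly 1.\<close>
    define c where "c j v = max 0 (1 - real j * infdist v K)" for j v
    have c: "0 \<le> c j v \<and> c j v \<le> 1" for j v
      by (simp add: c_def infdist_nonneg)
    have cont: "continuous_on UNIV (c j)" for j
      unfolding c_def by (intro continuous_intros)
    have lim: "(\<lambda>j. c j v) \<longlonglongrightarrow> indicator K v" for v
    proof (cases "v \<in> K")
      case True
      then show ?thesis by (simp add: c_def)
    next
      case False
      then have pos: "infdist v K > 0"
        using K in_closed_iff_infdist_zero[of K v] infdist_nonneg[of v K] by (metis less_eq_real_def)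
      then obtain m where m: "real m * infdist v K > 1"
        using reals_Archimedean3 by blast
      have "c j v = 0" if "j \<ge> m" for j
      proof -
        have "real m * infdist v K \<le> real j * infdist v K"
          using that pos by simp
        then have "1 - real j * infdist v K \<le> 0"
          using m by linarith
        then show ?thesis
          unfolding c_def by (rule max_absorb1)
      qed
      then have "eventually (\<lambda>j. c j v = indicator K v) sequentially"
        using False by (auto simp: eventually_sequentially)
      then show ?thesis by (rule tendsto_eventually)
    qed
    have "(\<lambda>j. \<integral>v. c j v \<partial>N) \<longlonglongrightarrow> measure N K" if "finite_measure N" "sets N = sets borel" for N
    proof -
      interpret finite_measure N by fact
      have "(\<lambda>j. \<integral>v. c j v \<partial>N) \<longlonglongrightarrow> (\<integral>v. indicator K v \<partial>N)"
      proof (rule integral_dominated_convergence[where w = "\<lambda>_. 1"])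
        show "c j \<in> borel_measurable N" for j
          using borel_measurable_continuous_onI[OF cont] measurable_cong_sets[OF that(2) refl] by blast
        show "(indicator K :: 'b \<Rightarrow> real) \<in> borel_measurable N"
          using K(1) that(2) by (intro borel_measurable_indicator) (simp add: borel_closed)
      qed (use c lim in auto)
      then show ?thesis
        using sets_eq_imp_space_eq[OF that(2)] by simp
    qed
    from this[OF N(1,3)] this[OF N(2,4)] show ?thesis
      unfolding eq[OF cont c] by (rule LIMSEQ_unique)
  qed
  show ?thesis
  proof (rule measure_eqI_generator_eq[where E = "{K. closed K}" and \<Omega> = UNIV and A = "\<lambda>_. UNIV"])
    show "Int_stable {K :: 'b set. closed K}"
      by (auto simp: Int_stable_def)
    show "emeasure N1 K = emeasure N2 K" if "K \<in> {K. closed K}" for K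
      using closed_eq[of K] that N(1,2) by (cases "K = {}") (auto simp: finite_measure.emeasure_eq_measure)
  qed (use N in \<open>auto simp: borel_eq_closed finite_measure.emeasure_finite\<close>)
qed

text \<open>The two measures live over different spaces, since later the identity on a spectrum is
  compared with f on \<Omega>; only their images in the common target are matched. Linear p suffice
  as hypothesis because \<open>rint\<close> is multiplicative, so agreement spreads to
  polynomials.\<close>

lemma pvm_uniqueness:
  fixes E1 :: "'a set \<Rightarrow> 'v::{real_inner,banach} \<Rightarrow>\<^sub>L 'v" and E2 :: "'c set \<Rightarrow> 'v \<Rightarrow>\<^sub>L 'v"
    and \<phi>1 :: "'a \<Rightarrow> 'b::euclidean_space" and \<phi>2 :: "'c \<Rightarrow> 'b"
  assumes "pvm S1 E1" "pvm S2 E2"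
    and \<phi>1: "\<phi>1 \<in> borel_measurable S1" "bounded (\<phi>1 ` space S1)"
    and \<phi>2: "\<phi>2 \<in> borel_measurable S2" "bounded (\<phi>2 ` space S2)"
    and lin: "\<And>p. bounded_linear p \<Longrightarrow> pvm.rint S1 E1 (\<lambda>l. p (\<phi>1 l)) = pvm.rint S2 E2 (\<lambda>l. p (\<phi>2 l))"
    and M: "M \<in> sets borel"
  shows "E1 (\<phi>1 -` M \<inter> space S1) = E2 (\<phi>2 -` M \<inter> space S2)"
proof -
  interpret A: pvm S1 E1 by fact
  interpret B: pvm S2 E2 by fact
  note bm = bmeas_continuous[OF \<phi>1] bmeas_continuous[OF \<phi>2]
  have poly: "A.rint (\<lambda>l. p (\<phi>1 l)) = B.rint (\<lambda>l. p (\<phi>2 l))" if "real_polynomial_function p" for p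
    using that
  proof (induction p rule: real_polynomial_function.induct)
    case (linear p)
    then show ?case by (rule lin)
  next
    case (const c)
    then show ?case by (simp add: A.rint_const B.rint_const)
  next
    case (add f g)
    have "continuous_on UNIV f" "continuous_on UNIV g"
      using add.hyps by (auto simp: real_polynomial_function_eq intro: continuous_on_polymonial_function)
    then show ?case using add.IH by (simp add: A.rint_add B.rint_add bm)
  next
    case (mult f g)
    have "continuous_on UNIV f" "continuous_on UNIV g"
      using mult.hyps by (auto simp: real_polynomial_function_eq intro: continuous_on_polymonial_function)
    then show ?case using mult.IH by (simp add: A.rint_mult B.rint_mult bm)
  qed
  have cont: "A.rint (\<lambda>l. c (\<phi>1 l)) = B.rint (\<lambda>l. c (\<phi>2 l))" if c: "continuous_on UNIV c" for c :: "'b \<Rightarrow> real"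
  proof -
    \<comment> \<open>One compact set holding the values of both functions, so that a single
      polynomial approximates c for both integrals.\<close>
    define K where "K = closure (\<phi>1 ` space S1 \<union> \<phi>2 ` space S2)"
    have K: "compact K" "\<And>l. l \<in> space S1 \<Longrightarrow> \<phi>1 l \<in> K" "\<And>l. l \<in> space S2 \<Longrightarrow> \<phi>2 l \<in> K"
      using \<phi>1(2) \<phi>2(2) closure_subset[of "\<phi>1 ` space S1 \<union> \<phi>2 ` space S2"]
      by (auto simp: K_def compact_closure)
    have "norm (A.rint (\<lambda>l. c (\<phi>1 l)) - B.rint (\<lambda>l. c (\<phi>2 l))) \<le> e" if "e > 0" for e
    proof -
      obtain p where p: "real_polynomial_function p" "\<And>v. v \<in> K \<Longrightarrow> \<bar>c v - p v\<bar> < e / 2"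
        using Stone_Weierstrass_real_polynomial_function[OF K(1) continuous_on_subset[OF c], of "e / 2"] \<open>e > 0\<close>
        by auto
      have pc: "continuous_on UNIV p"
        using p(1) by (auto simp: real_polynomial_function_eq intro: continuous_on_polymonial_function)
      have "norm (A.rint (\<lambda>l. c (\<phi>1 l)) - A.rint (\<lambda>l. p (\<phi>1 l))) \<le> e / 2"
        using A.rint_norm_le[OF bmeas_diff[OF bm(1)[OF c] bm(1)[OF pc]] less_imp_le[OF p(2)[OF K(2)]]]
          \<open>e > 0\<close> by (simp add: A.rint_diff bm c pc)
      moreover have "norm (B.rint (\<lambda>l. p (\<phi>2 l)) - B.rint (\<lambda>l. c (\<phi>2 l))) \<le> e / 2"
        using B.rint_norm_le[OF bmeas_diff[OF bm(2)[OF c] bm(2)[OF pc]] less_imp_le[OF p(2)[OF K(3)]]]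
          \<open>e > 0\<close> by (simp add: B.rint_diff bm c pc norm_minus_commute)
      ultimately show ?thesis
        using norm_triangle_ineq[of "A.rint (\<lambda>l. c (\<phi>1 l)) - A.rint (\<lambda>l. p (\<phi>1 l))"
            "B.rint (\<lambda>l. p (\<phi>2 l)) - B.rint (\<lambda>l. c (\<phi>2 l))"]
        by (simp add: poly[OF p(1)])
    qed
    then have "norm (A.rint (\<lambda>l. c (\<phi>1 l)) - B.rint (\<lambda>l. c (\<phi>2 l))) \<le> 0"
      by (rule field_le_epsilon[of _ 0, simplified])
    then show ?thesis by simp
  qed
  have distr_eq: "distr (A.quad_measure x) borel \<phi>1 = distr (B.quad_measure x) borel \<phi>2" for x
  proof (rule finite_borel_measure_eqI)
    show "finite_measure (distr (A.quad_measure x) borel \<phi>1)"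
      by (rule finite_measure.finite_measure_distr) (use \<phi>1 in simp_all)
    show "finite_measure (distr (B.quad_measure x) borel \<phi>2)"
      by (rule finite_measure.finite_measure_distr) (use \<phi>2 in simp_all)
    fix c :: "'b \<Rightarrow> real" assume c: "continuous_on UNIV c"
    have cb: "c \<in> borel_measurable borel" by (rule borel_measurable_continuous_onI[OF c])
    have "(\<integral>v. c v \<partial>distr (A.quad_measure x) borel \<phi>1) = A.rint (\<lambda>l. c (\<phi>1 l)) x \<bullet> x"
      using \<phi>1 by (simp add: A.rint_quad bm c integral_distr cb)
    also have "\<dots> = (\<integral>v. c v \<partial>distr (B.quad_measure x) borel \<phi>2)"
      using \<phi>2 by (simp add: B.rint_quad bm c integral_distr cb cont)
    finally show "(\<integral>v. c v \<partial>distr (A.quad_measure x) borel \<phi>1) = (\<integral>v. c v \<partial>distr (B.quad_measure x) borel \<phi>2)" .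
  qed simp_all
  have s1: "\<phi>1 -` M \<inter> space S1 \<in> sets S1" and s2: "\<phi>2 -` M \<inter> space S2 \<in> sets S2"
    using measurable_sets[OF \<phi>1(1) M] measurable_sets[OF \<phi>2(1) M] by auto
  show ?thesis
  proof (rule symmetric_op_eqI[OF A.E_symmetric[OF s1] B.E_symmetric[OF s2]])
    fix x
    have "measure (distr (A.quad_measure x) borel \<phi>1) M = measure (distr (B.quad_measure x) borel \<phi>2) M"
      by (simp only: distr_eq)
    then show "E1 (\<phi>1 -` M \<inter> space S1) x \<bullet> x = E2 (\<phi>2 -` M \<inter> space S2) x \<bullet> x"
      using \<phi>1(1) \<phi>2(1) M s1 s2
      by (simp add: measure_distr A.measure_quad_measure B.measure_quad_measure)
  qed
qed

section \<open>Null sets, essential range and restriction to sets of full measure\<close>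

context pvm
begin

lemma rint_sum:
  assumes "\<And>c. c \<in> K \<Longrightarrow> h c \<in> bmeas S"
  shows "rint (\<lambda>l. \<Sum>c\<in>K. h c l) = (\<Sum>c\<in>K. rint (h c))" "(\<lambda>l. \<Sum>c\<in>K. h c l) \<in> bmeas S"
  using assms
proof (induction K rule: infinite_finite_induct)
  case (insert c K)
  { case 1 then show ?case using insert by (simp add: rint_add) }
  { case 2 then show ?case using insert by (simp add: bmeas_add) }
qed (simp_all add: rint_const)

text \<open>Turns \<open>E\<close>-null sets into common null sets of ordinary measures; closure
  under countable unions is inherited from them.\<close>

lemma null_iff: "M \<in> sets S \<Longrightarrow> E M = 0 \<longleftrightarrow> (\<forall>x. emeasure (quad_measure x) M = 0)"
  by (auto simp: emeasure_quad_measure E_quad ennreal_eq_0_iff intro: blinfun_eqI)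

lemma null_subset:
  assumes "A \<in> sets S" "B \<in> sets S" "A \<subseteq> B" "E B = 0"
  shows "E A = 0"
proof (rule blinfun_eqI)
  fix x
  have "E A x = E A (E B x)"
    unfolding E_Int[OF assms(1,2)] using assms(3) by (simp add: Int_absorb2)
  then show "E A x = blinfun_apply 0 x"
    by (simp add: assms(4))
qed

lemma null_UN:
  assumes "countable K" "\<And>i. i \<in> K \<Longrightarrow> A i \<in> sets S" "\<And>i. i \<in> K \<Longrightarrow> E (A i) = 0"
  shows "E (\<Union>i\<in>K. A i) = 0"
proof -
  have U: "(\<Union>i\<in>K. A i) \<in> sets S"
    using assms by (intro sets.countable_UN'') auto
  have "(\<Union>i\<in>K. A i) \<in> null_sets (quad_measure x)" for x
    using assms(2,3) by (intro null_sets_UN' assms(1) null_setsI) (simp_all add: null_iff[THEN iffD1])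
  then show ?thesis
    unfolding null_iff[OF U] by blast
qed

lemma null_Un:
  assumes "A \<in> sets S" "B \<in> sets S" "E A = 0" "E B = 0"
  shows "E (A \<union> B) = 0"
  using null_UN[of "{A, B}" id] assms by auto

lemma E_cong_null:
  assumes "A \<in> sets S" "B \<in> sets S" "M \<in> sets S" "E M = 0" "\<And>l. l \<in> space S - M \<Longrightarrow> l \<in> A \<longleftrightarrow> l \<in> B"
  shows "E A = E B"
  using rint_cong_null[OF bmeas_indicator bmeas_indicator assms(3,4), of A B] assms
  by (simp add: rint_indicator indicator_def)

lemma E_conull:
  assumes "A \<in> sets S" "E (space S - A) = 0"
  shows "E A = id_blinfun"
  using E_cong_null[of A "space S" "space S - A"] assms by (auto simp: E_space)

definition ess_range :: "('a \<Rightarrow> 'b::metric_space) \<Rightarrow> 'b set" where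
  "ess_range \<phi> = {v. \<forall>e>0. E (\<phi> -` ball v e \<inter> space S) \<noteq> 0}"

text \<open>The complement is the union of all balls with null preimage. By Lindelof countably many
  of them cover it, so its preimage is null as well.\<close>

lemma ess_range_compl:
  fixes \<phi> :: "'a \<Rightarrow> 'b::{metric_space,second_countable_topology}"
  assumes \<phi>: "\<phi> \<in> borel_measurable S"
  shows "open (- ess_range \<phi>)" and "E (\<phi> -` (- ess_range \<phi>) \<inter> space S) = 0"
proof -
  define F where "F = {ball v e | v e. 0 < e \<and> E (\<phi> -` ball v e \<inter> space S) = 0}"
  have F: "\<And>U. U \<in> F \<Longrightarrow> open U" "\<And>U. U \<in> F \<Longrightarrow> E (\<phi> -` U \<inter> space S) = 0"
    by (auto simp: F_def)
  have meas: "\<phi> -` U \<inter> space S \<in> sets S" if "open U" for U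
    using that \<phi> by (intro measurable_sets[of \<phi> S borel]) auto
  have eq: "- ess_range \<phi> = \<Union>F"
  proof (intro equalityI subsetI)
    fix v assume "v \<in> - ess_range \<phi>"
    then obtain e where "e > 0" "E (\<phi> -` ball v e \<inter> space S) = 0"
      by (auto simp: ess_range_def)
    then have "ball v e \<in> F" "v \<in> ball v e"
      by (auto simp: F_def)
    then show "v \<in> \<Union>F" by blast
  next
    fix v assume "v \<in> \<Union>F"
    then obtain U where U: "U \<in> F" "v \<in> U" by blast
    then obtain e where e: "e > 0" "ball v e \<subseteq> U"
      using F(1) open_contains_ball by blast
    then have "\<phi> -` ball v e \<inter> space S \<subseteq> \<phi> -` U \<inter> space S"
      by blast
    then have "E (\<phi> -` ball v e \<inter> space S) = 0"
      by (rule null_subset[OF meas[OF open_ball] meas[OF F(1)[OF U(1)]] _ F(2)[OF U(1)]])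
    then show "v \<in> - ess_range \<phi>"
      using e(1) by (auto simp: ess_range_def)
  qed
  then show "open (- ess_range \<phi>)"
    using F(1) by auto
  obtain F' where F': "F' \<subseteq> F" "countable F'" "\<Union>F' = \<Union>F"
    using Lindelof[of F] F(1) by metis
  have "E (\<Union>U\<in>F'. \<phi> -` U \<inter> space S) = 0"
    using F' F by (intro null_UN meas) auto
  then show "E (\<phi> -` (- ess_range \<phi>) \<inter> space S) = 0"
    unfolding eq F'(3)[symmetric] by (simp add: vimage_Union)
qed

lemma ess_range_subset: "ess_range \<phi> \<subseteq> closure (\<phi> ` space S)"
proof
  fix v assume v: "v \<in> ess_range \<phi>"
  have "\<exists>y\<in>\<phi> ` space S. dist y v < e" if "e > 0" for e
  proof (rule ccontr)
    assume "\<not> ?thesis"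
    then have "\<phi> -` ball v e \<inter> space S = {}"
      by (auto simp: dist_commute)
    then show False
      using v that by (force simp: ess_range_def)
  qed
  then show "v \<in> closure (\<phi> ` space S)"
    by (simp add: closure_approachable)
qed

text \<open>Since A lies in \<open>sets S\<close>, the trace sets are sets of S and the map E stays
  the same. This carries a measure from the plane to the spectrum, where a representation is
  required to live.\<close>

lemma pvm_restrict:
  assumes A: "A \<in> sets S" "E A = id_blinfun"
  shows "pvm (restrict_space S A) E"
proof
  have sub: "sets (restrict_space S A) \<subseteq> sets S"
    using A(1) by (auto simp: sets_restrict_space)
  have "A \<subseteq> space S"
    using A(1) by (rule sets.sets_into_space)
  then show "E (space (restrict_space S A)) = id_blinfun"
    using A(2) by (simp add: space_restrict_space inf_absorb2 Int_absorb2)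
  fix M assume "M \<in> sets (restrict_space S A)"
  then show "symmetric_op (E M)" "E M (E M x) = E M x" for x
    using sub E_symmetric E_idem by auto
next
  have sub: "sets (restrict_space S A) \<subseteq> sets S"
    using A(1) by (auto simp: sets_restrict_space)
  fix B :: "nat \<Rightarrow> 'a set" and x assume "range B \<subseteq> sets (restrict_space S A)" "disjoint_family B"
  then show "(\<lambda>i. E (B i) x) sums E (\<Union>i. B i) x"
    using sub by (intro E_sums) auto
qed

lemma rint_restrict:
  assumes A: "A \<in> sets S" "E A = id_blinfun" and h: "h \<in> bmeas S"
  shows "pvm.rint (restrict_space S A) E h = rint h"
proof -
  interpret R: pvm "restrict_space S A" E by (rule pvm_restrict[OF A])
  have sp: "space (restrict_space S A) = A"
    using A(1) sets.sets_into_space[OF A(1)] by (auto simp: space_restrict_space)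
  have hA: "h \<in> bmeas (restrict_space S A)"
  proof -
    obtain c where c: "\<And>l. l \<in> space S \<Longrightarrow> \<bar>h l\<bar> \<le> c"
      using h by (metis bmeas_bound)
    show ?thesis
      by (rule bmeasI[OF measurable_restrict_space1[OF bmeas_measurable[OF h]], where c = c])
         (use sets.sets_into_space[OF A(1)] c sp in blast)
  qed
  have null: "E (space S - A) = 0"
  proof (rule blinfun_eqI)
    fix x show "E (space S - A) x = blinfun_apply 0 x"
      using E_Un[of A "space S - A" x] A sets.sets_into_space[OF A(1)]
      by (simp add: E_space Un_absorb1)
  qed
  have "R.quad_measure x = restrict_space (quad_measure x) A" for x
  proof (rule measure_eqI)
    fix M assume "M \<in> sets (R.quad_measure x)"
    then have M: "M \<in> sets (restrict_space S A)" by simp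
    then have "M \<in> sets S" "M \<subseteq> A"
      using A(1) by (auto simp: sets_restrict_space)
    then show "emeasure (R.quad_measure x) M = emeasure (restrict_space (quad_measure x) A) M"
      using A(1) sets.sets_into_space[OF A(1)]
      by (subst emeasure_restrict_space)
         (auto simp: R.emeasure_quad_measure M emeasure_quad_measure Int_absorb2)
  qed (simp add: sets_restrict_space)
  moreover have "(\<integral>l. h l \<partial>restrict_space (quad_measure x) A) = (\<integral>l. h l \<partial>quad_measure x)" for x
  proof -
    have "(\<integral>l. h l \<partial>restrict_space (quad_measure x) A) = (\<integral>l. indicator A l *\<^sub>R h l \<partial>quad_measure x)"
      by (rule integral_restrict_space) (use A(1) in auto)
    also have "\<dots> = (\<integral>l. h l \<partial>quad_measure x)"
    proof (rule integral_cong_AE)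
      show "AE l in quad_measure x. indicator A l *\<^sub>R h l = h l"
        using quad_measure_null[OF _ null, of x] A(1) AE_space[of "quad_measure x"]
        by (auto simp: indicator_def)
    qed (use A(1) h in \<open>auto simp: bmeas_measurable\<close>)
    finally show ?thesis .
  qed
  ultimately show ?thesis
    by (intro R.rint_eqI rint_symmetric[OF h]) (simp add: rint_quad[OF h])
qed

end

section \<open>Bounded functions with values in a complex plane\<close>

lemma bounded_borel_iff:
  assumes \<II>: "\<II> \<in> cl_sphere"
  shows "f \<in> bounded_borel \<II> S \<longleftrightarrow> (\<forall>l\<in>space S. f l \<in> cplane \<II>) \<and>
    (\<lambda>l. cl_re (f l)) \<in> bmeas S \<and> (\<lambda>l. cl_im \<II> (f l)) \<in> bmeas S"
proof
  assume f: "f \<in> bounded_borel \<II> S"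
  then show "(\<forall>l\<in>space S. f l \<in> cplane \<II>) \<and>
    (\<lambda>l. cl_re (f l)) \<in> bmeas S \<and> (\<lambda>l. cl_im \<II> (f l)) \<in> bmeas S"
    using bmeas_continuous[OF _ _ linear_continuous_on[OF bounded_linear_cl_re]]
      bmeas_continuous[OF _ _ linear_continuous_on[OF bounded_linear_cl_im]]
    by (auto simp: bounded_borel_def)
next
  assume *: "(\<forall>l\<in>space S. f l \<in> cplane \<II>) \<and>
    (\<lambda>l. cl_re (f l)) \<in> bmeas S \<and> (\<lambda>l. cl_im \<II> (f l)) \<in> bmeas S"
  then have [measurable]: "(\<lambda>l. cl_re (f l)) \<in> borel_measurable S" "(\<lambda>l. cl_im \<II> (f l)) \<in> borel_measurable S"
    by (auto simp: bmeas_measurable)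
  have eq: "f l = cl_re (f l) *\<^sub>R cl_one + cl_im \<II> (f l) *\<^sub>R \<II>" if "l \<in> space S" for l
    using * that cplane_eq[OF \<II>] by blast
  have "(\<lambda>l. cl_re (f l) *\<^sub>R cl_one + cl_im \<II> (f l) *\<^sub>R \<II>) \<in> borel_measurable S"
    by measurable
  then have "f \<in> borel_measurable S"
    by (subst measurable_cong[OF eq])
  moreover obtain c d where "\<And>l. l \<in> space S \<Longrightarrow> \<bar>cl_re (f l)\<bar> \<le> c" "\<And>l. l \<in> space S \<Longrightarrow> \<bar>cl_im \<II> (f l)\<bar> \<le> d"
    using * by (metis bmeas_bound)
  then have "norm (f l) \<le> c * norm (cl_one :: 'a clifford) + d * norm \<II>" if "l \<in> space S" for l
    using that by (subst eq[OF that]) (intro norm_triangle_mono, auto intro!: mult_right_mono)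
  then have "bounded (f ` space S)"
    by (auto simp: bounded_iff)
  ultimately show "f \<in> bounded_borel \<II> S"
    using * by (auto simp: bounded_borel_def)
qed

lemma bounded_borelD:
  assumes "f \<in> bounded_borel \<II> S"
  shows "f \<in> borel_measurable S" "bounded (f ` space S)" "l \<in> space S \<Longrightarrow> f l \<in> cplane \<II>"
  using assms by (auto simp: bounded_borel_def)

context
  fixes \<II> :: "'n::{finite,linorder} clifford"
  assumes \<II>: "\<II> \<in> cl_sphere"
begin

lemma bounded_borel_const: "c \<in> cplane \<II> \<Longrightarrow> (\<lambda>l. c) \<in> bounded_borel \<II> S"
  by (simp add: bounded_borel_iff[OF \<II>])

lemma bounded_borel_real: "h \<in> bmeas S \<Longrightarrow> (\<lambda>l. h l *\<^sub>R cl_one) \<in> bounded_borel \<II> S"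
  using cl_re_im_simps[OF \<II>]
  by (simp add: bounded_borel_iff[OF \<II>] cl_re_scaleR cl_im_scaleR cplane_scaleR[OF \<II>] cplane_one[OF \<II>])

lemma bounded_borel_add:
  "f \<in> bounded_borel \<II> S \<Longrightarrow> g \<in> bounded_borel \<II> S \<Longrightarrow> (\<lambda>l. f l + g l) \<in> bounded_borel \<II> S"
  by (simp add: bounded_borel_iff[OF \<II>] cl_re_add cl_im_add bmeas_add cplane_add[OF \<II>])

lemma bounded_borel_scaleR: "f \<in> bounded_borel \<II> S \<Longrightarrow> (\<lambda>l. r *\<^sub>R f l) \<in> bounded_borel \<II> S"
  by (simp add: bounded_borel_iff[OF \<II>] cl_re_scaleR cl_im_scaleR bmeas_scale cplane_scaleR[OF \<II>])

lemma bounded_borel_diff: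
  "f \<in> bounded_borel \<II> S \<Longrightarrow> g \<in> bounded_borel \<II> S \<Longrightarrow> (\<lambda>l. f l - g l) \<in> bounded_borel \<II> S"
  using bounded_borel_add[OF _ bounded_borel_scaleR[of g _ "-1"], of f] by simp

lemma bounded_borel_mult:
  assumes "f \<in> bounded_borel \<II> S" "g \<in> bounded_borel \<II> S"
  shows "(\<lambda>l. f l \<odot> g l) \<in> bounded_borel \<II> S"
  unfolding bounded_borel_iff[OF \<II>]
proof (intro conjI ballI)
  note f = assms[unfolded bounded_borel_iff[OF \<II>]]
  show "f l \<odot> g l \<in> cplane \<II>" if "l \<in> space S" for l
    using f that by (simp add: cplane_mult[OF \<II>])
  show "(\<lambda>l. cl_re (f l \<odot> g l)) \<in> bmeas S"
    by (rule bmeas_cong[of "\<lambda>l. cl_re (f l) * cl_re (g l) - cl_im \<II> (f l) * cl_im \<II> (g l)"])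
       (use f in \<open>auto simp: cplane_mult[OF \<II>] intro!: bmeas_diff bmeas_mult\<close>)
  show "(\<lambda>l. cl_im \<II> (f l \<odot> g l)) \<in> bmeas S"
    by (rule bmeas_cong[of "\<lambda>l. cl_re (f l) * cl_im \<II> (g l) + cl_im \<II> (f l) * cl_re (g l)"])
       (use f in \<open>auto simp: cplane_mult[OF \<II>] intro!: bmeas_add bmeas_mult\<close>)
qed

lemma bounded_borel_conj:
  assumes "f \<in> bounded_borel \<II> S"
  shows "(\<lambda>l. cl_conj (f l)) \<in> bounded_borel \<II> S"
  unfolding bounded_borel_iff[OF \<II>]
proof (intro conjI ballI)
  note f = assms[unfolded bounded_borel_iff[OF \<II>]]
  show "cl_conj (f l) \<in> cplane \<II>" if "l \<in> space S" for l
    using f that by (simp add: cplane_conj[OF \<II>])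
  show "(\<lambda>l. cl_re (cl_conj (f l))) \<in> bmeas S"
    by (rule bmeas_cong[of "\<lambda>l. cl_re (f l)"]) (use f in \<open>auto simp: cplane_conj[OF \<II>]\<close>)
  show "(\<lambda>l. cl_im \<II> (cl_conj (f l))) \<in> bmeas S"
    by (rule bmeas_cong[of "\<lambda>l. - cl_im \<II> (f l)"])
       (use f in \<open>auto simp: cplane_conj[OF \<II>] intro!: bmeas_uminus\<close>)
qed

lemma bmeas_norm_square:
  assumes "f \<in> bounded_borel \<II> S"
  shows "(\<lambda>l. (norm (f l))\<^sup>2) \<in> bmeas S"
  using bmeas_continuous[OF bounded_borelD(1,2)[OF assms], of "\<lambda>v. (norm v)\<^sup>2"]
  by (simp add: continuous_intros)

end

section \<open>Spectral integrals in the Clifford module\<close>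

text \<open>No operator T occurs: the locale is also instantiated with images of E and with a
  competing spectral measure, whose imaginary operator may be a different one.\<close>

locale clifford_spectral =
  fixes \<II> :: "'n::{finite,linorder} clifford" and S :: "'a measure"
    and E :: "'a set \<Rightarrow> ('h::{real_inner,banach}, 'n) cop" and J :: "('h, 'n) cop"
  assumes unit: "\<II> \<in> cl_sphere" and spectral: "spectral_measure S E"
    and assoc: "associated S E J" and imaginary: "cl_imaginary J"

lemma spectral_measure_pvm:
  fixes E :: "'a set \<Rightarrow> ('h::{real_inner,banach}, 'n::{finite,linorder}) cop"
  assumes "spectral_measure S E"
  shows "pvm S E"
  using assms by unfold_locales (auto simp: spectral_measure_def dest: cl_projectionD)

sublocale clifford_spectral \<subseteq> pvm S E
  by (rule spectral_measure_pvm[OF spectral])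

context clifford_spectral
begin

lemmas J_ops = cl_imaginaryD(1)[OF imaginary]
  and J_J [simp] = cl_imaginaryD(2)[OF imaginary]
  and J_antisymmetric = cl_imaginaryD(3)[OF imaginary]

lemma E_ops: "M \<in> sets S \<Longrightarrow> E M \<in> cl_ops"
  using spectral by (auto simp: spectral_measure_def dest: cl_projectionD)

lemma J_E: "M \<in> sets S \<Longrightarrow> J (E M x) = E M (J x)"
  using assoc unfolding associated_def by (metis blinfun_apply_blinfun_compose)

lemma J_rint: "h \<in> bmeas S \<Longrightarrow> J (rint h x) = rint h (J x)"
  by (rule rint_commute) (auto simp: J_E blinfun.bounded_linear_right)

lemma rint_ops:
  assumes "h \<in> bmeas S"
  shows "rint h \<in> cl_ops"
proof -
  have "rint h x \<odot> a = rint h (x \<odot> a)" for x a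
    by (rule rint_commute[OF assms _ bounded_linear_cl_mult_left]) (simp add: cl_opsD[OF E_ops])
  then show ?thesis by (simp add: cl_ops_def)
qed

text \<open>The closed form of the spectral integral. The definition by limits of simple functions
  is matched with it once, in \<open>spectral_integral_eq\<close>; all properties are computed from
  \<open>rint\<close>.\<close>

definition sint :: "('a \<Rightarrow> 'n clifford) \<Rightarrow> ('h, 'n) cop" where
  "sint f = rint (\<lambda>l. cl_re (f l)) + (rint (\<lambda>l. cl_im \<II> (f l)) o\<^sub>L J)"

abbreviation BB where "BB \<equiv> bounded_borel \<II> S"

lemma BB_bmeas:
  assumes "f \<in> BB"
  shows "(\<lambda>l. cl_re (f l)) \<in> bmeas S" "(\<lambda>l. cl_im \<II> (f l)) \<in> bmeas S"
  using assms by (simp_all add: bounded_borel_iff[OF unit])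

lemmas BB_cplane = bounded_borelD(3)[of _ \<II> S]

lemma sint_apply: "sint f x = rint (\<lambda>l. cl_re (f l)) x + rint (\<lambda>l. cl_im \<II> (f l)) (J x)"
  by (simp add: sint_def blinfun.add_left)

lemma sint_cong: "(\<And>l. l \<in> space S \<Longrightarrow> f l = g l) \<Longrightarrow> sint f = sint g"
  unfolding sint_def by (intro arg_cong2[of _ _ _ _ "(+)"] arg_cong2[of _ _ _ _ "(o\<^sub>L)"] rint_cong refl) simp_all

lemma sint_cong_null:
  assumes "f \<in> BB" "g \<in> BB" "M \<in> sets S" "E M = 0" "\<And>l. l \<in> space S - M \<Longrightarrow> f l = g l"
  shows "sint f = sint g"
  unfolding sint_def
  by (intro arg_cong2[of _ _ _ _ "(+)"] arg_cong2[of _ _ _ _ "(o\<^sub>L)"] refl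
      rint_cong_null[OF BB_bmeas(1)[OF assms(1)] BB_bmeas(1)[OF assms(2)] assms(3,4)]
      rint_cong_null[OF BB_bmeas(2)[OF assms(1)] BB_bmeas(2)[OF assms(2)] assms(3,4)])
     (simp_all add: assms(5))

lemma sint_ops: "f \<in> BB \<Longrightarrow> sint f \<in> cl_ops"
  unfolding sint_def by (intro cl_ops_add cl_ops_compose rint_ops J_ops BB_bmeas)

lemma sint_add: "f \<in> BB \<Longrightarrow> g \<in> BB \<Longrightarrow> sint (\<lambda>l. f l + g l) = sint f + sint g"
  by (rule blinfun_eqI) (simp add: sint_apply cl_re_add cl_im_add rint_add BB_bmeas blinfun.add_left)

lemma sint_scaleR: "f \<in> BB \<Longrightarrow> sint (\<lambda>l. r *\<^sub>R f l) = r *\<^sub>R sint f"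
  by (rule blinfun_eqI)
     (simp add: sint_apply cl_re_scaleR cl_im_scaleR rint_scale BB_bmeas blinfun.scaleR_left blinfun.add_left scaleR_add_right)

lemma sint_diff: "f \<in> BB \<Longrightarrow> g \<in> BB \<Longrightarrow> sint (\<lambda>l. f l - g l) = sint f - sint g"
  using sint_add[of f "\<lambda>l. (-1) *\<^sub>R g l"] sint_scaleR[of g "-1"] bounded_borel_scaleR[OF unit, of g S "-1"]
  by simp

lemma sint_real: "h \<in> bmeas S \<Longrightarrow> sint (\<lambda>l. h l *\<^sub>R cl_one) = rint h"
  using cl_re_im_simps[OF unit]
  by (intro blinfun_eqI) (simp add: sint_apply cl_re_scaleR cl_im_scaleR rint_const blinfun.scaleR_left)

lemma sint_one: "sint (\<lambda>l. cl_one) = id_blinfun"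
  using sint_real[of "\<lambda>l. 1"] by (simp add: rint_1)

lemma sint_unit: "sint (\<lambda>l. \<II>) = J"
  using cl_re_im_simps[OF unit]
  by (intro blinfun_eqI) (simp add: sint_apply rint_const blinfun.scaleR_left)

lemma sint_mult:
  assumes f: "f \<in> BB" and g: "g \<in> BB"
  shows "sint (\<lambda>l. f l \<odot> g l) = sint f o\<^sub>L sint g"
proof (rule blinfun_eqI)
  fix x
  note b = BB_bmeas[OF f] BB_bmeas[OF g]
  have re: "rint (\<lambda>l. cl_re (f l \<odot> g l)) =
      rint (\<lambda>l. cl_re (f l) * cl_re (g l)) - rint (\<lambda>l. cl_im \<II> (f l) * cl_im \<II> (g l))"
    using b by (subst rint_diff[symmetric])
      (auto intro!: rint_cong bmeas_mult simp: cplane_mult[OF unit] BB_cplane f g)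
  have im: "rint (\<lambda>l. cl_im \<II> (f l \<odot> g l)) =
      rint (\<lambda>l. cl_re (f l) * cl_im \<II> (g l)) + rint (\<lambda>l. cl_im \<II> (f l) * cl_re (g l))"
    using b by (subst rint_add[symmetric])
      (auto intro!: rint_cong bmeas_mult simp: cplane_mult[OF unit] BB_cplane f g)
  show "sint (\<lambda>l. f l \<odot> g l) x = (sint f o\<^sub>L sint g) x"
    by (simp add: sint_apply re im blinfun.add_left blinfun.diff_left blinfun.add_right J_rint b
        rint_mult blinfun.minus_right)
qed

lemma rint_conj:
  assumes f: "f \<in> BB"
  shows "rint (\<lambda>l. cl_re (cl_conj (f l))) = rint (\<lambda>l. cl_re (f l))"
    and "rint (\<lambda>l. cl_im \<II> (cl_conj (f l))) = - rint (\<lambda>l. cl_im \<II> (f l))"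
  unfolding rint_uminus[OF BB_bmeas(2)[OF f], symmetric]
  by (rule rint_cong, simp add: cplane_conj[OF unit] BB_cplane f)+

lemma sint_adjoint:
  assumes f: "f \<in> BB"
  shows "sint f x \<bullet> y = x \<bullet> sint (\<lambda>l. cl_conj (f l)) y"
proof -
  note b = BB_bmeas[OF f]
  have "rint (\<lambda>l. cl_im \<II> (f l)) (J x) \<bullet> y = - (x \<bullet> rint (\<lambda>l. cl_im \<II> (f l)) (J y))"
    by (simp add: symmetric_opD[OF rint_symmetric[OF b(2)]] J_antisymmetric J_rint b)
  then show ?thesis
    by (simp add: sint_apply rint_conj[OF f] inner_add_left inner_diff_right blinfun.minus_left
        symmetric_opD[OF rint_symmetric[OF b(1)]])
qed

lemma cl_adjoint_sint: "f \<in> BB \<Longrightarrow> cl_adjoint (sint f) = sint (\<lambda>l. cl_conj (f l))"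
  by (intro cl_adjoint_eqI sint_ops sint_adjoint bounded_borel_conj[OF unit])

lemma sint_conj_mult:
  assumes f: "f \<in> BB"
  shows "sint (\<lambda>l. cl_conj (f l)) o\<^sub>L sint f = rint (\<lambda>l. (norm (f l))\<^sup>2)"
    and "sint f o\<^sub>L sint (\<lambda>l. cl_conj (f l)) = rint (\<lambda>l. (norm (f l))\<^sup>2)"
proof -
  have "c \<odot> cl_conj c = (norm c)\<^sup>2 *\<^sub>R cl_one" "cl_conj c \<odot> c = (norm c)\<^sup>2 *\<^sub>R cl_one" if c: "c \<in> cplane \<II>" for c
    unfolding cplane_norm[OF unit c] cplane_mult_eq[OF unit c cplane_conj(1)[OF unit c]]
      cplane_mult_eq[OF unit cplane_conj(1)[OF unit c] c] cplane_conj(2,3)[OF unit c]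
    by (simp_all add: power2_eq_square)
  then show "sint (\<lambda>l. cl_conj (f l)) o\<^sub>L sint f = rint (\<lambda>l. (norm (f l))\<^sup>2)"
    "sint f o\<^sub>L sint (\<lambda>l. cl_conj (f l)) = rint (\<lambda>l. (norm (f l))\<^sup>2)"
    using f BB_cplane[OF f]
    by (auto simp: bounded_borel_conj[OF unit] bmeas_norm_square[OF unit] intro!: sint_cong
        simp flip: sint_mult sint_real)
qed

lemma cl_normal_sint: "f \<in> BB \<Longrightarrow> cl_normal (sint f)"
  by (simp add: cl_normal_def cl_adjoint_sint sint_conj_mult)

lemma norm_sint:
  assumes f: "f \<in> BB"
  shows "(norm (sint f x))\<^sup>2 = (\<integral>l. (norm (f l))\<^sup>2 \<partial>quad_measure x)"
proof -
  have "(norm (sint f x))\<^sup>2 = (sint (\<lambda>l. cl_conj (f l)) o\<^sub>L sint f) x \<bullet> x"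
    using sint_adjoint[OF f, of x "sint f x"] by (simp add: power2_norm_eq_inner inner_commute)
  then show ?thesis
    by (simp add: sint_conj_mult f rint_quad bmeas_norm_square[OF unit f])
qed

lemma norm_sint_le:
  assumes f: "f \<in> BB" and c: "\<And>l. l \<in> space S \<Longrightarrow> norm (f l) \<le> c" "0 \<le> c"
  shows "norm (sint f) \<le> c"
proof (rule norm_blinfun_bound[OF c(2)])
  fix x
  have "(norm (sint f x))\<^sup>2 \<le> c\<^sup>2 * (norm x)\<^sup>2"
    unfolding norm_sint[OF f]
    using quad_integral_bound[OF bmeas_norm_square[OF unit f], of "c\<^sup>2" x] c(1)
    by (simp add: power_mono)
  then show "norm (sint f x) \<le> c * norm x"
    using c(2) by (metis mult_nonneg_nonneg norm_ge_zero power2_le_imp_le power_mult_distrib)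
qed

lemma sint_uniform_limit:
  assumes "\<And>j. F j \<in> BB" "f \<in> BB" "uniform_limit (space S) F f sequentially"
  shows "(\<lambda>j. sint (F j)) \<longlonglongrightarrow> sint f"
proof (rule tendstoI)
  fix e :: real assume "e > 0"
  then have "\<forall>\<^sub>F j in sequentially. \<forall>l\<in>space S. dist (F j l) (f l) < e / 2"
    by (intro uniform_limitD[OF assms(3)]) simp
  then show "\<forall>\<^sub>F j in sequentially. dist (sint (F j)) (sint f) < e"
  proof eventually_elim
    case (elim j)
    have "norm (sint (\<lambda>l. F j l - f l)) \<le> e / 2"
      using elim \<open>e > 0\<close> by (intro norm_sint_le bounded_borel_diff[OF unit] assms) (auto simp: dist_norm less_imp_le)
    then show ?case
      using \<open>e > 0\<close> by (simp add: sint_diff assms dist_norm)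
  qed
qed

lemma simple_spectral_integral_eq:
  assumes F: "simple_function S F" "F ` space S \<subseteq> cplane \<II>"
  shows "F \<in> BB" "simple_spectral_integral \<II> S E J F = sint F"
proof -
  have fin: "finite (F ` space S)" and meas: "F \<in> borel_measurable S"
    using F(1) by (auto simp: simple_function_def intro: borel_measurable_simple_function)
  show BB: "F \<in> BB"
    using F fin meas by (auto simp: bounded_borel_def finite_imp_bounded)
  define A where "A c = F -` {c} \<inter> space S" for c
  have A: "A c \<in> sets S" for c
    unfolding A_def using F(1) by (rule simple_functionD)
  have repr: "rint (\<lambda>l. p (F l)) = (\<Sum>c\<in>F ` space S. p c *\<^sub>R E (A c))" for p
  proof -
    have "rint (\<lambda>l. p (F l)) = rint (\<lambda>l. \<Sum>c\<in>F ` space S. p c * indicator (A c) l)"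
      unfolding A_def by (rule rint_cong) (rule simple_function_indicator_sum[OF F(1)])
    then show ?thesis
      by (simp add: rint_sum bmeas_scale bmeas_indicator A rint_scale rint_indicator)
  qed
  show "simple_spectral_integral \<II> S E J F = sint F"
    unfolding simple_spectral_integral_def sint_def repr A_def[symmetric]
    by (simp add: sum.distrib bounded_bilinear.sum_left[OF bounded_bilinear_blinfun_compose]
        bounded_bilinear.scaleR_left[OF bounded_bilinear_blinfun_compose])
qed

lemma simple_approximation:
  assumes f: "f \<in> BB"
  obtains F where "\<And>j. simple_function S (F j)" "\<And>j. F j ` space S \<subseteq> cplane \<II>"
    "uniform_limit (space S) F f sequentially"
proof -
  obtain a where a: "\<And>j. simple_function S (a j)"
      "\<And>j l. l \<in> space S \<Longrightarrow> \<bar>a j l - cl_re (f l)\<bar> \<le> inverse (real (Suc j))"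
    using bmeas_simple_approximation[OF BB_bmeas(1)[OF f]] by metis
  obtain b where b: "\<And>j. simple_function S (b j)"
      "\<And>j l. l \<in> space S \<Longrightarrow> \<bar>b j l - cl_im \<II> (f l)\<bar> \<le> inverse (real (Suc j))"
    using bmeas_simple_approximation[OF BB_bmeas(2)[OF f]] by metis
  define F where "F j l = a j l *\<^sub>R cl_one + b j l *\<^sub>R \<II>" for j l
  show ?thesis
  proof (rule that)
    show "simple_function S (F j)" for j
      unfolding F_def by (rule simple_function_compose2[OF a(1) b(1)])
    show "F j ` space S \<subseteq> cplane \<II>" for j
      by (auto simp: F_def)
    show "uniform_limit (space S) F f sequentially"
    proof (rule uniform_limitI)
      fix e :: real assume "e > 0"
      then obtain N where N: "inverse (real (Suc N)) < e / 2"
        using reals_Archimedean[of "e / 2"] by auto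
      have n1: "norm (cl_one :: 'n clifford) = 1" "norm \<II> = 1"
        using cl_sphere_norm[OF unit] by (simp_all add: cl_one_def cl_basis_def)
      have "dist (F j l) (f l) < e" if "j \<ge> N" "l \<in> space S" for j l
      proof -
        have "F j l - f l = F j l - (cl_re (f l) *\<^sub>R cl_one + cl_im \<II> (f l) *\<^sub>R \<II>)"
          by (rule arg_cong[OF cplane_eq[OF unit BB_cplane[OF f that(2)]]])
        also have "\<dots> = (a j l - cl_re (f l)) *\<^sub>R cl_one + (b j l - cl_im \<II> (f l)) *\<^sub>R \<II>"
          by (simp add: F_def scaleR_diff_left)
        also have "norm \<dots> \<le> \<bar>a j l - cl_re (f l)\<bar> + \<bar>b j l - cl_im \<II> (f l)\<bar>"
          by (rule norm_triangle_mono) (simp_all add: n1)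
        also have "\<dots> \<le> inverse (real (Suc j)) + inverse (real (Suc j))"
          by (intro add_mono a(2) b(2) that)
        also have "\<dots> \<le> inverse (real (Suc N)) + inverse (real (Suc N))"
          using that(1) by (intro add_mono) (simp_all add: field_simps)
        finally show ?thesis
          using N by (simp add: dist_norm)
      qed
      then show "\<forall>\<^sub>F j in sequentially. \<forall>l\<in>space S. dist (F j l) (f l) < e"
        unfolding eventually_sequentially by blast
    qed
  qed
qed

text \<open>The definite description demands independence of the approximating sequence. As
  \<open>sint\<close> is bounded by the supremum norm, every uniform approximation by simple
  functions has integrals tending to \<open>sint f\<close>, and one such approximation
  exists.\<close>

lemma spectral_integral_eq:
  assumes f: "f \<in> BB"
  shows "spectral_integral \<II> S E J f = sint f"
  unfolding spectral_integral_def
proof (rule the_equality)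
  obtain F where F: "\<And>j. simple_function S (F j)" "\<And>j. F j ` space S \<subseteq> cplane \<II>"
    "uniform_limit (space S) F f sequentially"
    using simple_approximation[OF f] by metis
  moreover have "(\<lambda>j. simple_spectral_integral \<II> S E J (F j)) \<longlonglongrightarrow> sint f"
    unfolding simple_spectral_integral_eq(2)[OF F(1,2)]
    by (rule sint_uniform_limit[OF simple_spectral_integral_eq(1)[OF F(1,2)] f F(3)])
  ultimately show "\<exists>F. (\<forall>j. simple_function S (F j) \<and> F j ` space S \<subseteq> cplane \<II>) \<and>
      uniform_limit (space S) F f sequentially \<and>
      (\<lambda>j. simple_spectral_integral \<II> S E J (F j)) \<longlonglongrightarrow> sint f"
    by blast
next
  fix A assume "\<exists>F. (\<forall>j. simple_function S (F j) \<and> F j ` space S \<subseteq> cplane \<II>) \<and>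
      uniform_limit (space S) F f sequentially \<and>
      (\<lambda>j. simple_spectral_integral \<II> S E J (F j)) \<longlonglongrightarrow> A"
  then obtain F where F: "\<And>j. simple_function S (F j)" "\<And>j. F j ` space S \<subseteq> cplane \<II>"
    "uniform_limit (space S) F f sequentially"
    "(\<lambda>j. simple_spectral_integral \<II> S E J (F j)) \<longlonglongrightarrow> A"
    by metis
  have "(\<lambda>j. simple_spectral_integral \<II> S E J (F j)) \<longlonglongrightarrow> sint f"
    unfolding simple_spectral_integral_eq(2)[OF F(1,2)]
    by (rule sint_uniform_limit[OF simple_spectral_integral_eq(1)[OF F(1,2)] f F(3)])
  then show "A = sint f"
    using F(4) LIMSEQ_unique by blast
qed

text \<open>Two bounded representatives of f differ only on the union of two null sets, where
  \<open>sint\<close> does not see them.\<close>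

lemma spectral_integral_Linf_eq:
  assumes g: "g \<in> BB" "spectral_AE S E (\<lambda>l. g l = f l)"
  shows "spectral_integral_Linf \<II> S E J f = sint g"
  unfolding spectral_integral_Linf_def
proof (rule the_equality)
  show "\<exists>g'\<in>BB. spectral_AE S E (\<lambda>l. g' l = f l) \<and> sint g = spectral_integral \<II> S E J g'"
    using g spectral_integral_eq by metis
  fix A assume "\<exists>g\<in>BB. spectral_AE S E (\<lambda>l. g l = f l) \<and> A = spectral_integral \<II> S E J g"
  then obtain g' where g': "g' \<in> BB" "spectral_AE S E (\<lambda>l. g' l = f l)" "A = sint g'"
    using spectral_integral_eq by metis
  obtain M M' where "M \<in> sets S" "E M = 0" "\<And>l. l \<in> space S - M \<Longrightarrow> g l = f l"
    "M' \<in> sets S" "E M' = 0" "\<And>l. l \<in> space S - M' \<Longrightarrow> g' l = f l"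
    using g(2) g'(2) by (auto simp: spectral_AE_def)
  then show "A = sint g"
    unfolding g'(3) by (intro sint_cong_null[OF g'(1) g(1), of "M \<union> M'"] null_Un) auto
qed

end

subsection \<open>Signed and Clifford-valued integrals\<close>

lemma signed_integral_cong:
  assumes "\<And>M. M \<in> sets S \<Longrightarrow> \<mu> M = \<nu> M"
  shows "signed_integral S \<mu> h = signed_integral S \<nu> h"
proof -
  have "jordan_pos S \<mu> = jordan_pos S \<nu>" if "\<And>M. M \<in> sets S \<Longrightarrow> \<mu> M = \<nu> M" for \<mu> \<nu>
    unfolding jordan_pos_def
    by (intro arg_cong[of _ _ "measure_of (space S) (sets S)"] ext SUP_cong refl) (simp add: that)
  from this[of \<mu> \<nu>] this[of "\<lambda>A. - \<mu> A" "\<lambda>A. - \<nu> A"] show ?thesis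
    using assms by (simp add: signed_integral_def)
qed

lemma cl_integral_cong:
  assumes "\<And>M. M \<in> sets S \<Longrightarrow> \<mu> M = \<nu> M"
  shows "cl_integral S \<mu> h = cl_integral S \<nu> h"
  unfolding cl_integral_def
  by (intro arg_cong[of _ _ vec_lambda] ext signed_integral_cong) (simp add: assms)

lemma cl_inner_symmetric_op:
  assumes "A \<in> cl_ops" "symmetric_op A"
  shows "cl_inner (A x) y = cl_inner x (A y)"
  by (simp add: vec_eq_iff cl_inner_nth symmetric_opD[OF assms(2)] flip: cl_opsD[OF assms(1)])

context clifford_spectral
begin

text \<open>The \<alpha>-component of the Clifford-valued measure is the real measure M \<mapsto> E
  M x' \<bullet> y with x' = \<open>x \<odot> cl_conj (cl_basis \<alpha>)\<close>, because E M is
  right linear.\<close>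

lemma cl_integral_rint:
  assumes h: "h \<in> bmeas S"
  shows "cl_integral S (\<lambda>M. cl_inner (E M x) y) h = cl_inner (rint h x) y"
proof -
  have "signed_integral S (\<lambda>M. cl_inner (E M x) y $ \<alpha>) h = cl_inner (rint h x) y $ \<alpha>" for \<alpha>
  proof -
    let ?x = "x \<odot> cl_conj (cl_basis \<alpha>)"
    have "signed_integral S (\<lambda>M. cl_inner (E M x) y $ \<alpha>) h = signed_integral S (\<lambda>M. E M ?x \<bullet> y) h"
      by (rule signed_integral_cong) (simp add: cl_inner_nth cl_opsD[OF E_ops])
    also have "\<dots> = rint h ?x \<bullet> y"
      by (rule signed_integral_rint[OF h])
    finally show ?thesis
      by (simp add: cl_inner_nth cl_opsD[OF rint_ops[OF h]])
  qed
  then show ?thesis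
    by (simp add: cl_integral_def vec_eq_iff)
qed

lemma cl_integral_rint_J:
  assumes h: "h \<in> bmeas S"
  shows "cl_integral S (\<lambda>M. cl_inner (J (E M x)) y) h = cl_inner (rint h (J x)) y"
proof -
  have "cl_integral S (\<lambda>M. cl_inner (J (E M x)) y) h = cl_integral S (\<lambda>M. cl_inner (E M (J x)) y) h"
    by (rule cl_integral_cong) (simp add: J_E)
  then show ?thesis by (simp add: cl_integral_rint h)
qed

lemma cl_integral_right_rint:
  assumes f: "f \<in> BB"
  shows "cl_integral_right \<II> S (\<lambda>M. cl_inner (E M x) y) f =
    cl_inner (rint (\<lambda>l. cl_re (f l)) x + rint (\<lambda>l. cl_im \<II> (f l)) (x \<odot> \<II>)) y"
  using BB_bmeas[OF f]
  by (simp add: cl_integral_right_def cl_integral_rint cl_inner_add_left cl_opsD[OF rint_ops] cl_inner_mult_left)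

text \<open>J acts on \<open>Hplus\<close> as right multiplication by \<II> and on
  \<open>Hminus\<close> as right multiplication by - \<II>. The change of sign is absorbed by
  conjugating f in the second integral.\<close>

lemma sint_decomposition:
  assumes f: "f \<in> BB"
  shows "cl_inner (sint f x) y =
    cl_integral_right \<II> S (\<lambda>M. cl_inner (E M (Pi_plus J \<II> x)) y) f +
    cl_integral_right \<II> S (\<lambda>M. cl_inner (E M (Pi_minus J \<II> x)) y) (\<lambda>l. cl_conj (f l))"
proof -
  note b = BB_bmeas[OF f]
  let ?p = "Pi_plus J \<II> x" and ?m = "Pi_minus J \<II> x"
  have pm: "?p \<odot> \<II> = J ?p" "?m \<odot> \<II> = - J ?m" "x = ?p + ?m"
    using Pi_decomposition(1-3)[OF imaginary unit, of x] by (simp_all add: Hplus_def Hminus_def cl_mult_minus_right)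
  have "sint f x = sint f ?p + sint f ?m"
    by (subst pm(3)) (rule blinfun.add_right)
  then show ?thesis
    unfolding cl_integral_right_rint[OF f] cl_integral_right_rint[OF bounded_borel_conj[OF unit f]] pm(1,2) rint_conj[OF f]
    by (simp add: sint_apply cl_inner_add_left blinfun.minus_left blinfun.minus_right)
qed

section \<open>Norm estimates on spectral subspaces\<close>

lemma sint_E:
  assumes f: "f \<in> BB" and M: "M \<in> sets S"
  shows "sint f (E M x) = sint (\<lambda>l. indicator M l *\<^sub>R f l) x"
proof -
  have "sint (\<lambda>l. indicator M l *\<^sub>R f l) = sint (\<lambda>l. f l \<odot> (indicator M l *\<^sub>R cl_one))"
    by (simp add: cl_mult_scaleR_right)
  also have "\<dots> = sint f o\<^sub>L E M"
    using f M by (simp add: sint_mult bounded_borel_real[OF unit] bmeas_indicator sint_real rint_indicator)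
  finally show ?thesis by simp
qed

lemma bounded_borel_indicator:
  assumes f: "f \<in> BB" and M: "M \<in> sets S"
  shows "(\<lambda>l. indicator M l *\<^sub>R f l) \<in> BB"
  using bounded_borel_mult[OF unit f bounded_borel_real[OF unit bmeas_indicator[OF M]]]
  by (simp add: cl_mult_scaleR_right)

lemma norm_sint_E_le:
  assumes f: "f \<in> BB" and M: "M \<in> sets S" and c: "\<And>l. l \<in> M \<Longrightarrow> norm (f l) \<le> c" "0 \<le> c"
  shows "norm (sint f (E M x)) \<le> c * norm (E M x)"
proof -
  have "norm (sint (\<lambda>l. indicator M l *\<^sub>R f l)) \<le> c"
    using c by (intro norm_sint_le bounded_borel_indicator f M) (auto simp: indicator_def)
  then have "norm (sint (\<lambda>l. indicator M l *\<^sub>R f l) (E M x)) \<le> c * norm (E M x)"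
    by (meson mult_right_mono norm_blinfun norm_ge_zero order_trans)
  then show ?thesis
    using sint_E[OF f M, of "E M x"] M by (simp add: E_idem)
qed

lemma norm_sint_E_ge:
  assumes f: "f \<in> BB" and M: "M \<in> sets S" and c: "\<And>l. l \<in> M \<Longrightarrow> c \<le> norm (f l)" "0 \<le> c"
  shows "c * norm (E M x) \<le> norm (sint f (E M x))"
proof -
  have "(c * norm (E M x))\<^sup>2 = c\<^sup>2 * measure (quad_measure (E M x)) M"
    using M by (simp add: measure_quad_measure E_idem power_mult_distrib power2_norm_eq_inner)
  also have "\<dots> = (\<integral>l. c\<^sup>2 * indicator M l \<partial>quad_measure (E M x))"
    using sets.sets_into_space[OF M] by (simp add: Int_absorb2)
  also have "\<dots> \<le> (\<integral>l. (norm (f l))\<^sup>2 \<partial>quad_measure (E M x))"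
    by (intro integral_mono quad_integrable bmeas_scale bmeas_indicator M bmeas_norm_square[OF unit f])
       (auto simp: indicator_def intro!: power_mono c)
  finally show ?thesis
    unfolding norm_sint[OF f, symmetric] by (rule power2_le_imp_le) simp
qed

text \<open>On the range of E M the integral has norm at most c, so the estimate from below gives |E
  M x| \<le> K c |E M x| with K c < 1. Invertibility and the description of the spectrum both rest
  on this.\<close>

lemma E_null_if_small:
  assumes f: "f \<in> BB" and K: "\<And>x. norm x \<le> K * norm (sint f x)" and c: "0 \<le> c" "K * c < 1" "0 \<le> K"
    and M: "M \<in> sets S" "\<And>l. l \<in> M \<Longrightarrow> norm (f l) \<le> c"
  shows "E M = 0"
proof (rule blinfun_eqI)
  fix x
  have "norm (E M x) \<le> K * (c * norm (E M x))"
    using K[of "E M x"] mult_left_mono[OF norm_sint_E_le[OF f M c(1), of x] c(3)] by linarith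
  then have "(1 - K * c) * norm (E M x) \<le> 0"
    by (simp add: algebra_simps)
  then have "E M x = 0"
    using c(2) by (simp add: mult_le_0_iff)
  then show "E M x = blinfun_apply 0 x" by simp
qed

text \<open>Where |f| exceeds the operator norm by 1/(n+1), the integral would stretch the spectral
  subspace by more than its norm; so these sets are null, and their countable union is the set in
  question.\<close>

lemma null_norm_gt:
  assumes f: "f \<in> BB"
  shows "{l \<in> space S. norm (sint f) < norm (f l)} \<in> sets S" "E {l \<in> space S. norm (sint f) < norm (f l)} = 0"
proof -
  have [measurable]: "f \<in> borel_measurable S"
    using f by (rule bounded_borelD)
  show "{l \<in> space S. norm (sint f) < norm (f l)} \<in> sets S"
    by measurable
  define A where "A n = {l \<in> space S. norm (sint f) + inverse (real (Suc n)) \<le> norm (f l)}" for n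
  have A: "A n \<in> sets S" for n
    unfolding A_def by measurable
  have "E (A n) = 0" for n
  proof (rule blinfun_eqI)
    fix x
    have "(norm (sint f) + inverse (real (Suc n))) * norm (E (A n) x) \<le> norm (sint f (E (A n) x))"
      by (rule norm_sint_E_ge[OF f A]) (auto simp: A_def)
    also have "\<dots> \<le> norm (sint f) * norm (E (A n) x)"
      by (rule norm_blinfun)
    finally have "inverse (real (Suc n)) * norm (E (A n) x) \<le> 0"
      by (simp only: distrib_right)
    then have "E (A n) x = 0"
      by (simp add: mult_le_0_iff)
    then show "E (A n) x = blinfun_apply 0 x" by simp
  qed
  then have "E (\<Union>n\<in>UNIV. A n) = 0"
    by (intro null_UN A) auto
  moreover have "{l \<in> space S. norm (sint f) < norm (f l)} = (\<Union>n\<in>UNIV. A n)"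
  proof (intro equalityI subsetI)
    fix l assume l: "l \<in> {l \<in> space S. norm (sint f) < norm (f l)}"
    then obtain n where "inverse (real (Suc n)) < norm (f l) - norm (sint f)"
      using reals_Archimedean[of "norm (f l) - norm (sint f)"] by auto
    then show "l \<in> (\<Union>n\<in>UNIV. A n)"
      using l by (auto simp: A_def intro!: exI[of _ n])
  next
    fix l assume "l \<in> (\<Union>n\<in>UNIV. A n)"
    then obtain n where "l \<in> space S" "norm (sint f) + inverse (real (Suc n)) \<le> norm (f l)"
      by (auto simp: A_def)
    moreover have "0 < inverse (real (Suc n))" by simp
    ultimately have "l \<in> space S" "norm (sint f) < norm (f l)"
      by linarith+
    then show "l \<in> {l \<in> space S. norm (sint f) < norm (f l)}"
      by simp
  qed
  ultimately show "E {l \<in> space S. norm (sint f) < norm (f l)} = 0"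
    by simp
qed

lemma norm_sint_sup:
  assumes f: "f \<in> BB" and M: "M \<in> sets S" "E M = 0"
  shows "ennreal (norm (sint f)) \<le> (SUP l\<in>space S - M. ennreal (norm (f l)))"
proof (rule ccontr)
  assume "\<not> ?thesis"
  then have *: "(SUP l\<in>space S - M. ennreal (norm (f l))) < ennreal (norm (sint f))"
    by simp
  \<comment> \<open>The supremum lies strictly below a finite value, hence is a real number c. Over
    an empty set it is 0, so c = 0 covers a space that is null altogether.\<close>
  define c where "c = enn2real (SUP l\<in>space S - M. ennreal (norm (f l)))"
  have "(SUP l\<in>space S - M. ennreal (norm (f l))) < top"
    by (rule order_less_trans[OF * ennreal_less_top])
  then have c: "(SUP l\<in>space S - M. ennreal (norm (f l))) = ennreal c" "0 \<le> c"
    by (simp_all only: c_def ennreal_enn2real enn2real_nonneg)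
  have le: "norm (f l) \<le> c" if "l \<in> space S - M" for l
    using SUP_upper[OF that, of "\<lambda>l. ennreal (norm (f l))"] c by simp
  have SM: "space S - M \<in> sets S" using M by auto
  have "sint f = sint (\<lambda>l. indicator (space S - M) l *\<^sub>R f l)"
    by (rule sint_cong_null[OF f bounded_borel_indicator[OF f SM] M]) simp
  also have "norm \<dots> \<le> c"
    using le c(2) by (intro norm_sint_le bounded_borel_indicator f SM) (auto simp: indicator_def)
  finally have "ennreal (norm (sint f)) \<le> ennreal c"
    by (rule ennreal_leI)
  then show False
    using * c(1) by simp
qed

text \<open>The infimum is attained at the null set where |f| exceeds the operator norm, while
  removing any null set leaves the integral unchanged.\<close>

lemma Linf_norm_sint:
  assumes f: "f \<in> BB"
  shows "Linf_norm S E f = ennreal (norm (sint f))"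
  unfolding Linf_norm_def
proof (rule antisym)
  let ?M = "{l \<in> space S. norm (sint f) < norm (f l)}"
  have "(INF M\<in>{M \<in> sets S. E M = 0}. SUP l\<in>space S - M. ennreal (norm (f l)))
      \<le> (SUP l\<in>space S - ?M. ennreal (norm (f l)))"
    by (rule INF_lower) (use null_norm_gt[OF f] in simp)
  also have "\<dots> \<le> ennreal (norm (sint f))"
    by (rule SUP_least) (auto intro!: ennreal_leI)
  finally show "(INF M\<in>{M \<in> sets S. E M = 0}. SUP l\<in>space S - M. ennreal (norm (f l))) \<le> ennreal (norm (sint f))" .
  show "ennreal (norm (sint f)) \<le> (INF M\<in>{M \<in> sets S. E M = 0}. SUP l\<in>space S - M. ennreal (norm (f l)))"
    by (rule INF_greatest) (auto intro: norm_sint_sup[OF f])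
qed

lemma BB_Linf: "f \<in> BB \<Longrightarrow> f \<in> Linf \<II> S E"
  by (auto simp: bounded_borel_def Linf_def intro!: bexI[of _ "{}"])

text \<open>The norm formula turns strong convergence into scalar dominated convergence for |F j -
  f|^2, with a constant majorant that is integrable because the quadratic measures are
  finite.\<close>

lemma sint_dominated_convergence:
  assumes F: "\<And>j. F j \<in> BB" and f: "f \<in> BB"
    and lim: "spectral_AE S E (\<lambda>l. (\<lambda>j. F j l) \<longlonglongrightarrow> f l)"
    and \<kappa>: "\<And>j l. l \<in> space S \<Longrightarrow> norm (F j l) \<le> \<kappa>"
  shows "(\<lambda>j. sint (F j) x) \<longlonglongrightarrow> sint f x"
proof -
  obtain M where M: "M \<in> sets S" "E M = 0" "\<And>l. l \<in> space S - M \<Longrightarrow> (\<lambda>j. F j l) \<longlonglongrightarrow> f l"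
    using lim by (auto simp: spectral_AE_def)
  obtain c where c: "\<And>l. l \<in> space S \<Longrightarrow> norm (f l) \<le> c"
    using bounded_borelD(2)[OF f] by (auto simp: bounded_iff)
  have D: "(\<lambda>l. F j l - f l) \<in> BB" for j
    by (intro bounded_borel_diff[OF unit] F f)
  have "(\<lambda>j. \<integral>l. (norm (F j l - f l))\<^sup>2 \<partial>quad_measure x) \<longlonglongrightarrow> (\<integral>l. 0 \<partial>quad_measure x)"
  proof (rule integral_dominated_convergence[where w = "\<lambda>_. (\<kappa> + c)\<^sup>2"])
    show "integrable (quad_measure x) (\<lambda>_. (\<kappa> + c)\<^sup>2)"
      by (rule quad_integrable) simp
    show "(\<lambda>l. (norm (F j l - f l))\<^sup>2) \<in> borel_measurable (quad_measure x)" for j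
      using bmeas_measurable[OF bmeas_norm_square[OF unit D]] by simp
    show "AE l in quad_measure x. (\<lambda>j. (norm (F j l - f l))\<^sup>2) \<longlonglongrightarrow> 0"
      using quad_measure_null[OF M(1,2)] AE_space
    proof eventually_elim
      case (elim l)
      then have "(\<lambda>j. F j l - f l) \<longlonglongrightarrow> f l - f l"
        by (intro tendsto_diff M(3) tendsto_const) simp
      then have "(\<lambda>j. (norm (F j l - f l))\<^sup>2) \<longlonglongrightarrow> (norm (f l - f l))\<^sup>2"
        by (intro tendsto_power tendsto_norm)
      then show ?case by simp
    qed
    show "AE l in quad_measure x. norm ((norm (F j l - f l))\<^sup>2) \<le> (\<kappa> + c)\<^sup>2" for j
      using AE_space
    proof eventually_elim
      case (elim l)
      then have "norm (F j l - f l) \<le> \<kappa> + c"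
        using norm_triangle_ineq4[of "F j l" "f l"] \<kappa>[of l j] c[of l] by simp
      then show ?case by (simp add: power_mono)
    qed
  qed simp
  then have "(\<lambda>j. (norm (sint (F j) x - sint f x))\<^sup>2) \<longlonglongrightarrow> 0"
    by (simp add: norm_sint[OF D, symmetric] sint_diff F f blinfun.diff_left)
  then have "(\<lambda>j. sqrt ((norm (sint (F j) x - sint f x))\<^sup>2)) \<longlonglongrightarrow> sqrt 0"
    by (intro tendsto_real_sqrt)
  then have "(\<lambda>j. norm (sint (F j) x - sint f x)) \<longlonglongrightarrow> 0"
    by simp
  then show ?thesis
    by (simp add: tendsto_norm_zero_iff LIM_zero_iff)
qed

text \<open>With s the root of h, the Clifford form of \<open>rint h\<close> at x is that of the
  single vector \<open>rint s x\<close> with itself, which \<open>cl_nonneg_inner_self\<close>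
  handles.\<close>

lemma cl_positive_rint:
  assumes h: "h \<in> bmeas S" and pos: "\<And>l. l \<in> space S \<Longrightarrow> 0 \<le> h l"
  shows "cl_positive (rint h)"
proof -
  let ?s = "\<lambda>l. sqrt (h l)"
  obtain c where c: "\<And>l. l \<in> space S \<Longrightarrow> \<bar>h l\<bar> \<le> c"
    using h by (metis bmeas_bound)
  have s: "?s \<in> bmeas S"
    by (rule bmeasI[of _ _ "sqrt c"]) (use h c pos in \<open>auto simp: bmeas_measurable\<close>)
  have "rint h = rint (\<lambda>l. ?s l * ?s l)"
    by (rule rint_cong) (simp add: pos)
  then have "rint h x = rint ?s (rint ?s x)" for x
    by (simp only: rint_mult[OF s s] blinfun_apply_blinfun_compose)
  then have "cl_inner (rint h x) x = cl_inner (rint ?s x) (rint ?s x)" for x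
    by (simp add: cl_inner_symmetric_op[OF rint_ops[OF s] rint_symmetric[OF s]])
  then show ?thesis
    by (simp add: cl_positive_def cl_nonneg_inner_self)
qed

lemma cl_positive_sint:
  assumes f: "f \<in> BB" and pos: "spectral_AE S E (\<lambda>l. \<exists>r\<ge>0. f l = r *\<^sub>R cl_one)"
  shows "cl_positive (sint f)"
proof -
  obtain M where M: "M \<in> sets S" "E M = 0" "\<And>l. l \<in> space S - M \<Longrightarrow> \<exists>r\<ge>0. f l = r *\<^sub>R cl_one"
    using pos by (auto simp: spectral_AE_def)
  \<comment> \<open>A representative that is nonnegative everywhere and not just almost
    everywhere.\<close>
  let ?h = "\<lambda>l. \<bar>cl_re (f l)\<bar>"
  have h: "?h \<in> bmeas S"
    using BB_bmeas(1)[OF f] unfolding bmeas_def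
    by (auto simp: bounded_iff)
  have "sint f = sint (\<lambda>l. ?h l *\<^sub>R cl_one)"
  proof (rule sint_cong_null[OF f bounded_borel_real[OF unit h] M(1,2)])
    fix l assume "l \<in> space S - M"
    then obtain r where "r \<ge> 0" "f l = r *\<^sub>R cl_one"
      using M(3) by blast
    then show "f l = ?h l *\<^sub>R cl_one"
      using cl_re_im_simps(1)[OF unit] by (simp add: cl_re_scaleR)
  qed
  then show ?thesis
    by (simp add: sint_real h cl_positive_rint)
qed

subsection \<open>Invertibility\<close>

lemma sint_inverse:
  assumes f: "f \<in> BB" and nz: "spectral_AE S E (\<lambda>l. f l \<noteq> 0)"
    and inv: "(\<lambda>l. cl_inverse (f l)) \<in> Linf \<II> S E"
  obtains g where "g \<in> BB" "spectral_AE S E (\<lambda>l. g l = cl_inverse (f l))" "cl_inverse_op (sint f) (sint g)"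
proof -
  obtain M1 where M1: "M1 \<in> sets S" "E M1 = 0" "\<And>l. l \<in> space S - M1 \<Longrightarrow> f l \<noteq> 0"
    using nz by (auto simp: spectral_AE_def)
  obtain M2 where M2: "M2 \<in> sets S" "E M2 = 0" "bounded ((\<lambda>l. cl_inverse (f l)) ` (space S - M2))"
    and meas: "(\<lambda>l. cl_inverse (f l)) \<in> borel_measurable S"
    using inv by (auto simp: Linf_def)
  define M where "M = M1 \<union> M2"
  have M: "M \<in> sets S" "E M = 0"
    unfolding M_def using M1 M2 by (auto intro: null_Un)
  \<comment> \<open>Since \<open>cl_inverse\<close> is 0 at 0, essential boundedness of the inverse
    does not exclude zeros of f. The zeros and the set where the inverse is large are therefore cut
    off together.\<close>
  define g where "g l = indicator (space S - M) l *\<^sub>R cl_inverse (f l)" for l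
  have g: "g \<in> BB"
    unfolding bounded_borel_def mem_Collect_eq
  proof (intro conjI)
    show "g \<in> borel_measurable S"
      unfolding g_def using M(1) meas by (intro borel_measurable_scaleR borel_measurable_indicator) auto
    show "g ` space S \<subseteq> cplane \<II>"
      by (auto simp: g_def cplane_scaleR[OF unit] cl_inverse_cplane[OF unit] BB_cplane f)
    obtain c where c: "\<And>l. l \<in> space S - M2 \<Longrightarrow> norm (cl_inverse (f l)) \<le> c"
      using M2(3) by (auto simp: bounded_iff)
    have "norm (g l) \<le> max c 0" if "l \<in> space S" for l
      using c[of l] that by (auto simp: g_def indicator_def M_def)
    then show "bounded (g ` space S)"
      by (auto simp: bounded_iff)
  qed
  have AE: "spectral_AE S E (\<lambda>l. g l = cl_inverse (f l))"
    unfolding spectral_AE_def using M by (intro bexI[of _ M]) (auto simp: g_def)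
  have fg: "f l \<odot> g l = cl_one" "g l \<odot> f l = cl_one" if l: "l \<in> space S - M" for l
  proof -
    have c: "f l \<in> cplane \<II>" "g l \<in> cplane \<II>" "f l \<noteq> 0"
      using l M1(3) f g by (auto simp: BB_cplane M_def)
    then show "f l \<odot> g l = cl_one"
      using l by (simp add: g_def cplane_inverse[OF unit])
    then show "g l \<odot> f l = cl_one"
      using cplane_mult_eq[OF unit c(1,2)] cplane_mult_eq[OF unit c(2,1)] by (simp add: ac_simps)
  qed
  have one: "(\<lambda>l. cl_one) \<in> BB"
    by (intro bounded_borel_const[OF unit] cplane_one[OF unit])
  have "sint f o\<^sub>L sint g = id_blinfun"
    unfolding sint_mult[OF f g, symmetric] sint_one[symmetric]
    by (rule sint_cong_null[OF bounded_borel_mult[OF unit f g] one M]) (rule fg)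
  moreover have "sint g o\<^sub>L sint f = id_blinfun"
    unfolding sint_mult[OF g f, symmetric] sint_one[symmetric]
    by (rule sint_cong_null[OF bounded_borel_mult[OF unit g f] one M]) (rule fg)
  ultimately show ?thesis
    using that[OF g AE] sint_ops[OF g] by (simp add: cl_inverse_op_def)
qed

text \<open>For these normal operators an estimate from below already amounts to invertibility: it
  keeps |f| essentially away from 0. Starting from the estimate lets the lemma serve (x) and,
  applied to a quadratic polynomial in f, the resolvent set.\<close>

lemma sint_bounded_below_inverse:
  assumes f: "f \<in> BB" and K: "\<And>x. norm x \<le> K * norm (sint f x)"
  shows "spectral_AE S E (\<lambda>l. f l \<noteq> 0)" "(\<lambda>l. cl_inverse (f l)) \<in> Linf \<II> S E"
proof -
  have [measurable]: "f \<in> borel_measurable S"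
    using f by (rule bounded_borelD)
  \<comment> \<open>K is an arbitrary real number; this choice gives c > 0 and |K| c < 1, as
    \<open>E_null_if_small\<close> requires.\<close>
  define c where "c = 1 / (\<bar>K\<bar> + 1)"
  have c: "0 < c" "\<bar>K\<bar> * c < 1"
    by (simp_all add: c_def add_nonneg_pos)
  have K': "norm x \<le> \<bar>K\<bar> * norm (sint f x)" for x
    using K[of x] mult_right_mono[OF abs_ge_self[of K] norm_ge_zero[of "sint f x"]] by linarith
  define M where "M = {l \<in> space S. norm (f l) \<le> c}"
  have M: "M \<in> sets S"
    unfolding M_def by measurable
  have EM: "E M = 0"
    by (rule E_null_if_small[OF f K' _ c(2) _ M]) (use c in \<open>auto simp: M_def\<close>)
  show "spectral_AE S E (\<lambda>l. f l \<noteq> 0)"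
    unfolding spectral_AE_def using M EM c by (intro bexI[of _ M]) (auto simp: M_def)
  have conj: "cl_conj \<in> borel_measurable borel"
    by (intro borel_measurable_continuous_onI linear_continuous_on linear_conv_bounded_linear[THEN iffD1] linearI)
       (simp_all add: cl_conj_add cl_conj_scaleR)
  have "(\<lambda>l. cl_inverse (f l)) \<in> borel_measurable S"
    unfolding cl_inverse_def using measurable_compose[OF \<open>f \<in> borel_measurable S\<close> conj] by measurable
  moreover have "norm (cl_inverse (f l)) \<le> 1 / c" if "l \<in> space S - M" for l
    using that c unfolding norm_cl_inverse[OF unit BB_cplane[OF f DiffD1[OF that]]]
    by (intro frac_le) (auto simp: M_def)
  then have "bounded ((\<lambda>l. cl_inverse (f l)) ` (space S - M))"
    by (auto simp: bounded_iff)
  ultimately show "(\<lambda>l. cl_inverse (f l)) \<in> Linf \<II> S E"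
    using M EM BB_cplane[OF f] cl_inverse_cplane[OF unit] by (auto simp: Linf_def)
qed

lemma sint_invertible_iff:
  assumes f: "f \<in> BB"
  shows "(\<exists>R. cl_inverse_op (sint f) R) \<longleftrightarrow>
    spectral_AE S E (\<lambda>l. f l \<noteq> 0) \<and> (\<lambda>l. cl_inverse (f l)) \<in> Linf \<II> S E"
proof
  assume "\<exists>R. cl_inverse_op (sint f) R"
  then obtain R where "R o\<^sub>L sint f = id_blinfun"
    by (auto simp: cl_inverse_op_def)
  then have "R (sint f x) = x" for x
    by (metis blinfun_apply_blinfun_compose blinfun_apply_id_blinfun)
  then have "norm x \<le> norm R * norm (sint f x)" for x
    by (metis norm_blinfun)
  then show "spectral_AE S E (\<lambda>l. f l \<noteq> 0) \<and> (\<lambda>l. cl_inverse (f l)) \<in> Linf \<II> S E"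
    using sint_bounded_below_inverse[OF f] by blast
next
  assume "spectral_AE S E (\<lambda>l. f l \<noteq> 0) \<and> (\<lambda>l. cl_inverse (f l)) \<in> Linf \<II> S E"
  then show "\<exists>R. cl_inverse_op (sint f) R"
    using sint_inverse[OF f] by metis
qed

lemma cl_inverse_op_sint:
  assumes f: "f \<in> BB" and R: "cl_inverse_op (sint f) R"
  shows "R = spectral_integral_Linf \<II> S E J (\<lambda>l. cl_inverse (f l))"
proof -
  obtain g where g: "g \<in> BB" "spectral_AE S E (\<lambda>l. g l = cl_inverse (f l))" "cl_inverse_op (sint f) (sint g)"
    using sint_invertible_iff[OF f] sint_inverse[OF f] R by blast
  have "R x = sint g x" for x
  proof -
    have "R (sint f (sint g x)) = R x"
      using g(3) by (metis blinfun_apply_blinfun_compose blinfun_apply_id_blinfun cl_inverse_op_def)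
    moreover have "R (sint f (sint g x)) = sint g x"
      using R by (metis blinfun_apply_blinfun_compose blinfun_apply_id_blinfun cl_inverse_op_def)
    ultimately show ?thesis by simp
  qed
  then show ?thesis
    unfolding spectral_integral_Linf_eq[OF g(1,2)] by (rule blinfun_eqI)
qed

end

subsection \<open>The spectrum and the spectral measure of an integral\<close>

lemma cl_re_diff: "cl_re (a - b) = cl_re a - cl_re b"
  and cl_im_diff: "cl_im \<II> (a - b) = cl_im \<II> a - cl_im \<II> b"
  by (simp_all add: cl_re_def cl_im_def inner_diff_left)

context
  fixes \<II> :: "'n::{finite,linorder} clifford"
  assumes \<II>: "\<II> \<in> cl_sphere"
begin

lemma cplane_diff: "c \<in> cplane \<II> \<Longrightarrow> d \<in> cplane \<II> \<Longrightarrow> c - d \<in> cplane \<II>"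
  using cplane_add[OF \<II>, of c "(-1) *\<^sub>R d"] cplane_scaleR[OF \<II>, of d "-1"] by simp

lemma cplane_quadratic:
  assumes c: "c \<in> cplane \<II>" and v: "v \<in> cplane \<II>"
  shows "(c - v) \<odot> (c - cl_conj v) = c \<odot> c - (2 * cl_re v) *\<^sub>R c + (norm v)\<^sup>2 *\<^sub>R cl_one"
proof (rule cplane_eqI[OF \<II>])
  note [simp] = cplane_mult[OF \<II>] cplane_conj[OF \<II>] cplane_diff cplane_add[OF \<II>] cplane_scaleR[OF \<II>]
    cplane_one[OF \<II>] c v cl_re_diff cl_im_diff cl_re_add cl_im_add cl_re_scaleR cl_im_scaleR cl_re_im_simps[OF \<II>]
  show "(c - v) \<odot> (c - cl_conj v) \<in> cplane \<II>"
    and "c \<odot> c - (2 * cl_re v) *\<^sub>R c + (norm v)\<^sup>2 *\<^sub>R cl_one \<in> cplane \<II>"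
    by simp_all
  show "cl_re ((c - v) \<odot> (c - cl_conj v)) = cl_re (c \<odot> c - (2 * cl_re v) *\<^sub>R c + (norm v)\<^sup>2 *\<^sub>R cl_one)"
    and "cl_im \<II> ((c - v) \<odot> (c - cl_conj v)) = cl_im \<II> (c \<odot> c - (2 * cl_re v) *\<^sub>R c + (norm v)\<^sup>2 *\<^sub>R cl_one)"
    unfolding cplane_norm[OF \<II> v] by (simp_all add: power2_eq_square algebra_simps)
qed

text \<open>Imaginary parts of the same sign subtract in the first distance and add in the second. A
  lower bound for |c - v| thus bounds both factors of the quadratic polynomial.\<close>

lemma cplane_upper_dist_conj:
  assumes c: "c \<in> cplane_upper \<II>" and v: "v \<in> cplane_upper \<II>"
  shows "norm (c - v) \<le> norm (c - cl_conj v)"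
proof (rule power2_le_imp_le)
  note cv = c[unfolded cplane_upper_iff[OF \<II>]] v[unfolded cplane_upper_iff[OF \<II>]]
  have "0 \<le> cl_im \<II> c * cl_im \<II> v"
    using cv by simp
  moreover have "(norm (c - v))\<^sup>2 = (cl_re c - cl_re v)\<^sup>2 + (cl_im \<II> c - cl_im \<II> v)\<^sup>2"
    using cv by (simp add: cplane_norm[OF \<II>] cplane_diff cl_re_diff cl_im_diff)
  moreover have "(norm (c - cl_conj v))\<^sup>2 = (cl_re c - cl_re v)\<^sup>2 + (cl_im \<II> c + cl_im \<II> v)\<^sup>2"
    using cv by (simp add: cplane_norm[OF \<II>] cplane_diff cl_re_diff cl_im_diff cplane_conj[OF \<II>])
  ultimately show "(norm (c - v))\<^sup>2 \<le> (norm (c - cl_conj v))\<^sup>2"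
    by (simp add: power2_eq_square algebra_simps)
qed simp

end

lemma spectral_measureI:
  assumes "pvm S E" "\<And>M. M \<in> sets S \<Longrightarrow> E M \<in> cl_ops"
  shows "spectral_measure S E"
proof -
  interpret pvm S E by fact
  show ?thesis
    unfolding spectral_measure_def
  proof (intro conjI ballI allI impI)
    show "cl_projection (E M)" if "M \<in> sets S" for M
      by (rule cl_projectionI[OF assms(2)[OF that] E_symmetric[OF that] E_idem[OF that]])
  qed (simp_all only: E_space E_sums)
qed

context clifford_spectral
begin

lemma spectral_AE_elim:
  assumes "spectral_AE S E P"
  obtains M where "M \<in> sets S" "E M = 0" "\<And>l. l \<in> space S - M \<Longrightarrow> P l"
  using assms by (auto simp: spectral_AE_def)

lemma S_quadratic_sint:
  assumes f: "f \<in> BB" and v: "v \<in> cplane \<II>"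
  shows "S_quadratic (sint f) v = sint (\<lambda>l. (f l - v) \<odot> (f l - cl_conj v))"
    and "(\<lambda>l. (f l - v) \<odot> (f l - cl_conj v)) \<in> BB"
proof -
  show "(\<lambda>l. (f l - v) \<odot> (f l - cl_conj v)) \<in> BB"
    by (intro bounded_borel_mult[OF unit] bounded_borel_diff[OF unit] bounded_borel_const[OF unit]
        f v cplane_conj(1)[OF unit])
  have "(\<lambda>l. (norm v)\<^sup>2 *\<^sub>R cl_one) \<in> BB"
    by (intro bounded_borel_const[OF unit] cplane_scaleR[OF unit] cplane_one[OF unit])
  moreover have "sint (\<lambda>l. (norm v)\<^sup>2 *\<^sub>R cl_one) = (norm v)\<^sup>2 *\<^sub>R id_blinfun"
    using sint_real[of "\<lambda>l. (norm v)\<^sup>2"] by (simp add: rint_const)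
  ultimately have "S_quadratic (sint f) v = sint (\<lambda>l. f l \<odot> f l - (2 * cl_re v) *\<^sub>R f l + (norm v)\<^sup>2 *\<^sub>R cl_one)"
    using f by (simp add: S_quadratic_def sint_add sint_diff sint_scaleR sint_mult
        bounded_borel_mult[OF unit] bounded_borel_scaleR[OF unit] bounded_borel_diff[OF unit])
  also have "\<dots> = sint (\<lambda>l. (f l - v) \<odot> (f l - cl_conj v))"
    by (rule sint_cong) (simp add: cplane_quadratic[OF unit BB_cplane[OF f] v])
  finally show "S_quadratic (sint f) v = sint (\<lambda>l. (f l - v) \<odot> (f l - cl_conj v))" .
qed

text \<open>For v in the upper half plane, being a resolvent point means that (f - v)(f - conj v) is
  essentially bounded away from 0. The bound of the inverse makes preimages of small balls around v
  null; conversely, a null ball yields an inverse on the whole space, which settles kernel, range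
  and bound at once.\<close>

lemma S_spectrum_sint:
  assumes f: "f \<in> BB" and up: "spectral_AE S E (\<lambda>l. f l \<in> cplane_upper \<II>)"
  shows "S_spectrum (sint f) \<inter> cplane_upper \<II> = ess_range f \<inter> cplane_upper \<II>"
proof -
  have [measurable]: "f \<in> borel_measurable S"
    using f by (rule bounded_borelD)
  have "v \<in> S_resolvent_set (sint f) \<longleftrightarrow> v \<notin> ess_range f" if v: "v \<in> cplane_upper \<II>" for v
  proof -
    have vc: "v \<in> cplane \<II>"
      using v by (simp add: cplane_upper_iff[OF unit])
    define q where "q l = (f l - v) \<odot> (f l - cl_conj v)" for l
    have Q: "S_quadratic (sint f) v = sint q" and q: "q \<in> BB"
      unfolding q_def using S_quadratic_sint[OF f vc] by auto
    have norm_q: "norm (q l) = norm (f l - v) * norm (f l - cl_conj v)" if "l \<in> space S" for l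
      unfolding q_def
      by (intro cplane_norm_mult[OF unit] cplane_diff[OF unit] BB_cplane[OF f that] vc cplane_conj(1)[OF unit])
    have ball: "f -` ball v e \<inter> space S \<in> sets S" for e
      by (intro measurable_sets[of f S borel]) auto
    show ?thesis
    proof
      assume v_res: "v \<in> S_resolvent_set (sint f)"
      then have "\<exists>K. \<forall>y\<in>range (sint q). norm (inv (sint q) y) \<le> K * norm y"
        by (simp add: S_resolvent_set_def Q)
      then obtain K where K: "\<And>y. y \<in> range (sint q) \<Longrightarrow> norm (inv (sint q) y) \<le> K * norm y"
        by blast
      have "inj (sint q)"
        using v_res by (auto simp: S_resolvent_set_def Q linear_injective_0[OF bounded_linear.linear[OF blinfun.bounded_linear_right]])
      then have K': "norm x \<le> K * norm (sint q x)" for x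
        using K[of "sint q x"] by simp
      have K'': "norm x \<le> \<bar>K\<bar> * norm (sint q x)" for x
        using K'[of x] mult_right_mono[OF abs_ge_self[of K] norm_ge_zero[of "sint q x"]] by linarith
      have "bounded ((\<lambda>l. f l - cl_conj v) ` space S)"
        by (rule bounded_borelD(2)[OF bounded_borel_diff[OF unit f bounded_borel_const[OF unit cplane_conj(1)[OF unit vc]]]])
      then obtain C where C: "0 < C" "\<And>l. l \<in> space S \<Longrightarrow> norm (f l - cl_conj v) \<le> C"
        by (auto simp: bounded_pos)
      \<comment> \<open>Over the ball of radius e the product is at most e C, and |K| e C < 1 as
        \<open>E_null_if_small\<close> demands.\<close>
      define e where "e = 1 / (\<bar>K\<bar> * C + 1)"
      have e: "0 < e" "\<bar>K\<bar> * (e * C) < 1"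
        using C(1) by (simp_all add: e_def add_nonneg_pos pos_divide_less_eq)
      have "norm (q l) \<le> e * C" if "l \<in> f -` ball v e \<inter> space S" for l
        using that C(2)[of l] e(1) unfolding norm_q[OF IntD2[OF that]]
        by (intro mult_mono) (auto simp: dist_norm norm_minus_commute)
      then have "E (f -` ball v e \<inter> space S) = 0"
        using C(1) e by (intro E_null_if_small[OF q K'' _ e(2) _ ball]) auto
      then show "v \<notin> ess_range f"
        using e(1) by (auto simp: ess_range_def)
    next
      assume "v \<notin> ess_range f"
      then obtain e where e: "e > 0" "E (f -` ball v e \<inter> space S) = 0"
        by (auto simp: ess_range_def)
      obtain N where N: "N \<in> sets S" "E N = 0" "\<And>l. l \<in> space S - N \<Longrightarrow> f l \<in> cplane_upper \<II>"
        using spectral_AE_elim[OF up] by metis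
      define M where "M = (f -` ball v e \<inter> space S) \<union> N"
      have M: "M \<in> sets S" "E M = 0"
        unfolding M_def using N ball e by (auto intro: null_Un)
      have SM: "space S - M \<in> sets S" using M by auto
      have "E (space S - M) = id_blinfun"
        using M sets.sets_into_space[OF M(1)] by (intro E_conull SM) (simp add: double_diff)
      \<comment> \<open>Off M both factors are at least e: the first because f stays outside the
        ball, the second because v is at least as near to f as its conjugate.\<close>
      moreover have "e * e \<le> norm (q l)" if "l \<in> space S - M" for l
      proof -
        have "e \<le> norm (f l - v)"
          using that by (auto simp: M_def dist_norm norm_minus_commute)
        moreover have "norm (f l - v) \<le> norm (f l - cl_conj v)"
          using that by (intro cplane_upper_dist_conj[OF unit _ v] N) (auto simp: M_def)
        ultimately show ?thesis
          unfolding norm_q[OF DiffD1[OF that]] using e(1) by (intro mult_mono) auto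
      qed
      ultimately have "e * e * norm x \<le> norm (sint q x)" for x
        using norm_sint_E_ge[OF q SM, of "e * e" x] by simp
      then have "norm x \<le> (1 / (e * e)) * norm (sint q x)" for x
        using e(1) by (simp add: field_simps)
      then obtain g where "cl_inverse_op (sint q) (sint g)"
        using sint_inverse[OF q sint_bounded_below_inverse[OF q]] by metis
      then have inv: "sint q (sint g x) = x" "sint g (sint q x) = x" for x
        unfolding cl_inverse_op_def by (metis blinfun_apply_blinfun_compose blinfun_apply_id_blinfun)+
      have inj: "inj (sint q)"
        using inv(2) by (rule inj_on_inverseI)
      have "inv (sint q) y = sint g y" for y
        using inv_f_f[OF inj, of "sint g y"] by (simp add: inv)
      then have "\<exists>K. \<forall>y\<in>range (sint q). norm (inv (sint q) y) \<le> K * norm y"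
        by (auto intro!: exI[of _ "norm (sint g)"] norm_blinfun)
      moreover have "surj (sint q)"
        using inv(1) by (rule surjI)
      then have "closure (range (sint q)) = UNIV"
        by simp
      moreover have "\<forall>x. sint q x = 0 \<longrightarrow> x = 0"
        using inv(2) by (metis blinfun.zero_right)
      ultimately show "v \<in> S_resolvent_set (sint f)"
        unfolding S_resolvent_set_def mem_Collect_eq Q using cplane_paravector[OF unit vc] by blast
    qed
  qed
  moreover have "v \<in> paravectors" if "v \<in> cplane_upper \<II>" for v
    using that cplane_paravector[OF unit] by (simp add: cplane_upper_iff[OF unit])
  ultimately show ?thesis
    by (auto simp: S_spectrum_def)
qed

text \<open>f takes values outside \<Omega> only off its essential range or outside the upper half
  plane, on a null set in either case, so the image measure may be restricted to \<Omega>.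
  Boundedness of \<Omega> makes the identity a bounded function there.\<close>

lemma upper_spectrum:
  assumes f: "f \<in> BB" and up: "spectral_AE S E (\<lambda>l. f l \<in> cplane_upper \<II>)"
  defines "\<Omega> \<equiv> S_spectrum (sint f) \<inter> cplane_upper \<II>"
  shows "closed \<Omega>" "\<Omega> \<subseteq> closure (f ` space S)" "bounded \<Omega>" "E (f -` \<Omega> \<inter> space S) = id_blinfun"
proof -
  have [measurable]: "f \<in> borel_measurable S"
    using f by (rule bounded_borelD)
  have \<Omega>: "\<Omega> = ess_range f \<inter> cplane_upper \<II>"
    unfolding \<Omega>_def by (rule S_spectrum_sint[OF f up])
  show cl: "closed \<Omega>"
    unfolding \<Omega> using ess_range_compl(1)[of f] by (intro closed_Int closed_cplane_upper[OF unit]) (simp add: closed_def)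
  show sub: "\<Omega> \<subseteq> closure (f ` space S)"
    unfolding \<Omega> using ess_range_subset[of f] by blast
  show "bounded \<Omega>"
    using sub bounded_borelD(2)[OF f] by (meson bounded_closure bounded_subset)
  obtain N where N: "N \<in> sets S" "E N = 0" "\<And>l. l \<in> space S - N \<Longrightarrow> f l \<in> cplane_upper \<II>"
    using spectral_AE_elim[OF up] by metis
  have A: "f -` \<Omega> \<inter> space S \<in> sets S" and B: "f -` (- ess_range f) \<inter> space S \<in> sets S"
    using cl ess_range_compl(1)[of f] by (auto intro!: measurable_sets[of f S borel])
  show "E (f -` \<Omega> \<inter> space S) = id_blinfun"
  proof (rule E_conull[OF A])
    show "E (space S - f -` \<Omega> \<inter> space S) = 0"
    proof (rule null_subset)
      show "E ((f -` (- ess_range f) \<inter> space S) \<union> N) = 0"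
        by (rule null_Un[OF B N(1) ess_range_compl(2) N(2)]) simp
      show "space S - f -` \<Omega> \<inter> space S \<subseteq> (f -` (- ess_range f) \<inter> space S) \<union> N"
        using N(3) by (auto simp: \<Omega>)
    qed (use A B N in auto)
  qed
qed

section \<open>Representing an integral over the plane and over its spectrum\<close>

lemma measurable_cplane:
  assumes "f \<in> BB"
  shows "f \<in> measurable S (restrict_space borel (cplane \<II>))"
  using bounded_borelD[OF assms] by (intro measurable_restrict_space2) auto

lemma clifford_spectral_image:
  assumes f: "f \<in> measurable S S'"
  shows "clifford_spectral \<II> S' (\<lambda>M. E (f -` M \<inter> space S)) J"
proof
  show "spectral_measure S' (\<lambda>M. E (f -` M \<inter> space S))"
    by (rule spectral_measureI[OF pvm_image[OF f]]) (intro E_ops measurable_sets[OF f])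
  show "associated S' (\<lambda>M. E (f -` M \<inter> space S)) J"
    using assoc measurable_sets[OF f] by (simp add: associated_def)
qed (rule unit imaginary)+

lemma sint_image:
  assumes f: "f \<in> measurable S S'" and h: "h \<in> bounded_borel \<II> S'"
  shows "clifford_spectral.sint \<II> S' (\<lambda>M. E (f -` M \<inter> space S)) J h = sint (\<lambda>l. h (f l))"
proof -
  interpret B: clifford_spectral \<II> S' "\<lambda>M. E (f -` M \<inter> space S)" J
    by (rule clifford_spectral_image[OF f])
  show ?thesis
    using B.BB_bmeas[OF h] by (simp add: B.sint_def sint_def rint_image(1)[OF f])
qed

lemma clifford_spectral_restrict:
  assumes A: "A \<in> sets S" "E A = id_blinfun"
  shows "clifford_spectral \<II> (restrict_space S A) E J"
proof
  have sub: "sets (restrict_space S A) \<subseteq> sets S"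
    using A(1) by (auto simp: sets_restrict_space)
  show "spectral_measure (restrict_space S A) E"
    by (rule spectral_measureI[OF pvm_restrict[OF A]]) (use sub E_ops in blast)
  show "associated (restrict_space S A) E J"
    using assoc sub by (auto simp: associated_def)
qed (rule unit imaginary)+

lemma sint_restrict:
  assumes A: "A \<in> sets S" "E A = id_blinfun" and h: "h \<in> BB"
  shows "clifford_spectral.sint \<II> (restrict_space S A) E J h = sint h"
proof -
  interpret B: clifford_spectral \<II> "restrict_space S A" E J
    by (rule clifford_spectral_restrict[OF A])
  show ?thesis
    using BB_bmeas[OF h] by (simp add: B.sint_def sint_def rint_restrict[OF A])
qed

lemma sint_conj_eq:
  assumes f: "f \<in> BB"
  shows "sint (\<lambda>l. cl_conj (f l)) = rint (\<lambda>l. cl_re (f l)) - (rint (\<lambda>l. cl_im \<II> (f l)) o\<^sub>L J)"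
proof -
  show ?thesis
    by (rule blinfun_eqI) (simp add: sint_apply rint_conj[OF f] blinfun.bilinear_simps)
qed

lemma rint_im_abs:
  assumes f: "f \<in> BB" and up: "spectral_AE S E (\<lambda>l. f l \<in> cplane_upper \<II>)"
  shows "rint (\<lambda>l. \<bar>cl_im \<II> (f l)\<bar>) = rint (\<lambda>l. cl_im \<II> (f l))" "(\<lambda>l. \<bar>cl_im \<II> (f l)\<bar>) \<in> bmeas S"
proof -
  show abs: "(\<lambda>l. \<bar>cl_im \<II> (f l)\<bar>) \<in> bmeas S"
    using BB_bmeas(2)[OF f] by (auto simp: bmeas_def bounded_iff)
  obtain N where N: "N \<in> sets S" "E N = 0" "\<And>l. l \<in> space S - N \<Longrightarrow> f l \<in> cplane_upper \<II>"
    using spectral_AE_elim[OF up] by metis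
  show "rint (\<lambda>l. \<bar>cl_im \<II> (f l)\<bar>) = rint (\<lambda>l. cl_im \<II> (f l))"
    by (rule rint_cong_null[OF abs BB_bmeas(2)[OF f] N(1,2)])
       (use N(3) in \<open>auto simp: cplane_upper_iff[OF unit]\<close>)
qed

text \<open>Subtracting the adjoint integrates f - conj f, whose modulus is twice |Im f|. In the
  upper half plane this is twice Im f, so J itself serves in the polar form.\<close>

lemma polar_imaginary_sint:
  assumes f: "f \<in> BB" and up: "spectral_AE S E (\<lambda>l. f l \<in> cplane_upper \<II>)"
  shows "polar_imaginary (sint f) J"
proof -
  define A where "A = rint (\<lambda>l. cl_re (f l))"
  define B where "B = rint (\<lambda>l. cl_im \<II> (f l))"
  note b = BB_bmeas[OF f]
  have adj: "cl_adjoint (sint f) = A - (B o\<^sub>L J)"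
    by (simp add: cl_adjoint_sint f sint_conj_eq A_def B_def)
  have T: "sint f = A + (B o\<^sub>L J)"
    by (simp add: sint_def A_def B_def)
  have re: "(1/2) *\<^sub>R (sint f + cl_adjoint (sint f)) = A"
    unfolding adj unfolding T by (simp flip: scaleR_2)
  \<comment> \<open>The imaginary part is nonnegative only almost everywhere, while
    \<open>cl_positive_rint\<close> asks for it on the whole space; hence the absolute
    value.\<close>
  let ?d = "\<lambda>l. f l - cl_conj (f l)" and ?h = "\<lambda>l. 2 * \<bar>cl_im \<II> (f l)\<bar>"
  have d: "?d \<in> BB"
    by (intro bounded_borel_diff[OF unit] bounded_borel_conj[OF unit] f)
  have D: "sint f - cl_adjoint (sint f) = sint ?d"
    by (simp add: cl_adjoint_sint f sint_diff bounded_borel_conj[OF unit])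
  have h: "?h \<in> bmeas S"
    by (intro bmeas_scale rint_im_abs[OF f up])
  have "cl_abs (sint f - cl_adjoint (sint f)) = rint ?h"
  proof (rule cl_abs_eqI)
    show "rint ?h \<in> cl_ops" by (rule rint_ops[OF h])
    show "cl_positive (rint ?h)" by (rule cl_positive_rint[OF h]) simp
    have "(norm (?d l))\<^sup>2 = ?h l * ?h l" if "l \<in> space S" for l
    proof -
      note c = BB_cplane[OF f that] cplane_conj[OF unit BB_cplane[OF f that]]
      show ?thesis
        unfolding cplane_norm[OF unit cplane_diff[OF unit c(1,2)]] cl_re_diff cl_im_diff c(3,4)
        by (simp add: power2_eq_square)
    qed
    then have "rint (\<lambda>l. (norm (?d l))\<^sup>2) = rint ?h o\<^sub>L rint ?h"
      by (simp add: h flip: rint_mult cong: rint_cong)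
    then show "rint ?h o\<^sub>L rint ?h = cl_adjoint (sint f - cl_adjoint (sint f)) o\<^sub>L (sint f - cl_adjoint (sint f))"
      unfolding D by (simp add: cl_adjoint_sint d sint_conj_mult)
  qed
  also have "rint ?h = 2 *\<^sub>R B"
    using rint_scale[OF rint_im_abs(2)[OF f up], of 2] by (simp add: rint_im_abs(1)[OF f up] B_def)
  finally have abs: "(1/2) *\<^sub>R cl_abs (sint f - cl_adjoint (sint f)) = B"
    by simp
  have comp: "A o\<^sub>L J = J o\<^sub>L A" "B o\<^sub>L J = J o\<^sub>L B" "A o\<^sub>L B = B o\<^sub>L A"
    by (rule blinfun_eqI, simp add: A_def B_def J_rint b rint_rint_commute)+
  show ?thesis
    unfolding polar_imaginary_def Let_def re abs using imaginary T comp by simp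
qed

text \<open>The identity is unbounded on the plane. Cut off outside the ball of radius c it becomes
  bounded and still satisfies g (f l) = f l.\<close>

lemma sint_plane:
  assumes f: "f \<in> BB" and c: "\<And>l. l \<in> space S \<Longrightarrow> norm (f l) \<le> c"
  defines "Sp \<equiv> restrict_space (borel :: 'n clifford measure) (cplane \<II>)"
    and "g \<equiv> \<lambda>l :: 'n clifford. if norm l \<le> c then l else 0"
  shows "g \<in> bounded_borel \<II> Sp"
    and "clifford_spectral.sint \<II> Sp (\<lambda>M. E (f -` M \<inter> space S)) J g = sint f"
proof -
  show g: "g \<in> bounded_borel \<II> Sp"
    unfolding bounded_borel_def mem_Collect_eq
  proof (intro conjI)
    show "g \<in> borel_measurable Sp"
      unfolding g_def Sp_def by (rule measurable_restrict_space1) measurable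
    show "g ` space Sp \<subseteq> cplane \<II>"
      using cplane_0[OF unit] by (auto simp: g_def Sp_def space_restrict_space)
    have "norm (g l) \<le> max c 0" for l
      by (simp add: g_def le_max_iff_disj)
    then show "bounded (g ` space Sp)"
      unfolding bounded_iff by blast
  qed
  show "clifford_spectral.sint \<II> Sp (\<lambda>M. E (f -` M \<inter> space S)) J g = sint f"
    unfolding sint_image[OF measurable_cplane[OF f, folded Sp_def] g]
    by (rule sint_cong) (simp add: g_def c)
qed

lemma plane_representation:
  assumes f: "f \<in> BB"
  shows "represents_on_plane \<II> (sint f) J (\<lambda>M. E (f -` M \<inter> space S))"
proof -
  define Sp where "Sp = restrict_space (borel :: 'n clifford measure) (cplane \<II>)"
  have sp: "space Sp = cplane \<II>"
    by (simp add: Sp_def space_restrict_space)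
  have fm: "f \<in> measurable S Sp"
    unfolding Sp_def by (rule measurable_cplane[OF f])
  interpret B: clifford_spectral \<II> Sp "\<lambda>M. E (f -` M \<inter> space S)" J
    by (rule clifford_spectral_image[OF fm])
  obtain c where c: "\<And>l. l \<in> space S \<Longrightarrow> norm (f l) \<le> c"
    using bounded_borelD(2)[OF f] by (auto simp: bounded_iff)
  define M where "M = {l \<in> space Sp. c < norm l}"
  have idm [measurable]: "(\<lambda>l. l) \<in> borel_measurable Sp"
    unfolding Sp_def by (rule measurable_restrict_space1) simp
  have M: "M \<in> sets Sp"
    unfolding M_def by measurable
  have "f -` M \<inter> space S = {}"
    using c by (force simp: M_def)
  then have EM: "E (f -` M \<inter> space S) = 0"
    by simp
  define g where "g = (\<lambda>l :: 'n clifford. if norm l \<le> c then l else 0)"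
  have g: "g \<in> bounded_borel \<II> Sp" "B.sint g = sint f"
    unfolding g_def Sp_def by (rule sint_plane[OF f c]; assumption)+
  have "spectral_AE Sp (\<lambda>M. E (f -` M \<inter> space S)) (\<lambda>l. g l = l)"
    unfolding spectral_AE_def using M EM by (intro bexI[of _ M]) (auto simp: g_def M_def)
  then have "spectral_integral_Linf \<II> Sp (\<lambda>M. E (f -` M \<inter> space S)) J (\<lambda>l. l) = B.sint g"
    by (rule B.spectral_integral_Linf_eq[OF g(1)])
  also have "\<dots> = sint f"
    by (rule g(2))
  finally have "sint f = spectral_integral_Linf \<II> Sp (\<lambda>M. E (f -` M \<inter> space S)) J (\<lambda>l. l)" ..
  moreover have "(\<lambda>l. l) \<in> Linf \<II> Sp (\<lambda>M. E (f -` M \<inter> space S))"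
  proof -
    have "bounded ((\<lambda>l. l) ` (space Sp - M))"
      by (auto simp: bounded_iff M_def intro!: exI[of _ c])
    then show ?thesis
      using M EM idm by (auto simp: Linf_def sp)
  qed
  ultimately show ?thesis
    unfolding represents_on_plane_def Sp_def[symmetric] using B.spectral B.assoc by blast
qed

text \<open>f may leave \<Omega> on a null set, so its image measure is formed on the plane and then
  restricted to \<Omega>, which has full measure.\<close>

lemma upper_representation:
  assumes f: "f \<in> BB" and up: "spectral_AE S E (\<lambda>l. f l \<in> cplane_upper \<II>)"
  shows "represents \<II> (sint f) J (\<lambda>M. E (f -` M \<inter> space S))"
proof -
  define Sp where "Sp = restrict_space (borel :: 'n clifford measure) (cplane \<II>)"
  define \<Omega> where "\<Omega> = S_spectrum (sint f) \<inter> cplane_upper \<II>"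
  note \<Omega> = upper_spectrum[OF f up, folded \<Omega>_def]
  have fm: "f \<in> measurable S Sp"
    unfolding Sp_def by (rule measurable_cplane[OF f])
  interpret B: clifford_spectral \<II> Sp "\<lambda>M. E (f -` M \<inter> space S)" J
    by (rule clifford_spectral_image[OF fm])
  have sub: "\<Omega> \<subseteq> cplane \<II>"
    by (auto simp: \<Omega>_def cplane_upper_iff[OF unit])
  have \<Omega>s: "\<Omega> \<in> sets Sp"
    unfolding Sp_def sets_restrict_space using sub \<Omega>(1) by (auto intro!: image_eqI[of _ _ \<Omega>])
  interpret R: clifford_spectral \<II> "restrict_space Sp \<Omega>" "\<lambda>M. E (f -` M \<inter> space S)" J
    by (rule B.clifford_spectral_restrict[OF \<Omega>s \<Omega>(4)])
  have eq: "restrict_space Sp \<Omega> = spectral_space \<II> (sint f)"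
    unfolding Sp_def spectral_space_def \<Omega>_def[symmetric]
    using sub \<Omega>(1) closed_cplane[OF unit] by (subst restrict_restrict_space) (auto simp: Int_absorb1)
  have spR: "space (restrict_space Sp \<Omega>) = \<Omega>"
    unfolding eq by (simp add: spectral_space_def \<Omega>_def space_restrict_space)
  obtain c where c: "\<And>l. l \<in> space S \<Longrightarrow> norm (f l) \<le> c"
    using bounded_borelD(2)[OF f] by (auto simp: bounded_iff)
  \<comment> \<open>Elements of \<Omega> are limits of values of f and obey the same bound, so the
    cutoff g is the identity on \<Omega>.\<close>
  then have "closure (f ` space S) \<subseteq> cball 0 c"
    by (intro closure_minimal) auto
  then have c\<Omega>: "\<Omega> \<subseteq> cball 0 c"
    using \<Omega>(2) by blast
  define g where "g = (\<lambda>l :: 'n clifford. if norm l \<le> c then l else 0)"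
  have g: "g \<in> bounded_borel \<II> Sp" "B.sint g = sint f"
    unfolding g_def Sp_def by (rule sint_plane[OF f c]; assumption)+
  have "(\<lambda>l. l) \<in> borel_measurable Sp"
    unfolding Sp_def by (rule measurable_restrict_space1) simp
  then have id: "(\<lambda>l. l) \<in> bounded_borel \<II> (restrict_space Sp \<Omega>)"
    using sub \<Omega>(3) by (auto simp: bounded_borel_def spR intro!: measurable_restrict_space1)
  have "spectral_integral \<II> (restrict_space Sp \<Omega>) (\<lambda>M. E (f -` M \<inter> space S)) J (\<lambda>l. l) = R.sint (\<lambda>l. l)"
    by (rule R.spectral_integral_eq[OF id])
  also have "\<dots> = R.sint g"
    by (rule R.sint_cong) (use c\<Omega> in \<open>auto simp: g_def spR\<close>)
  also have "\<dots> = B.sint g"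
    by (rule B.sint_restrict[OF \<Omega>s \<Omega>(4) g(1)])
  also have "\<dots> = sint f"
    by (rule g(2))
  finally show ?thesis
    unfolding represents_def eq[symmetric] using R.spectral R.assoc by simp
qed

end

section \<open>Uniqueness of the representing measure\<close>

lemma clifford_spectral_unique:
  assumes "clifford_spectral \<II> S1 E1 J1" "clifford_spectral \<II> S2 E2 J2"
    and f1: "f1 \<in> bounded_borel \<II> S1" and f2: "f2 \<in> bounded_borel \<II> S2"
    and re: "pvm.rint S1 E1 (\<lambda>l. cl_re (f1 l)) = pvm.rint S2 E2 (\<lambda>l. cl_re (f2 l))"
    and im: "pvm.rint S1 E1 (\<lambda>l. cl_im \<II> (f1 l)) = pvm.rint S2 E2 (\<lambda>l. cl_im \<II> (f2 l))"
    and M: "M \<in> sets borel"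
  shows "E1 (f1 -` M \<inter> space S1) = E2 (f2 -` M \<inter> space S2)"
proof -
  interpret A: clifford_spectral \<II> S1 E1 J1 by fact
  interpret B: clifford_spectral \<II> S2 E2 J2 by fact
  show ?thesis
  proof (rule pvm_uniqueness[OF A.pvm_axioms B.pvm_axioms bounded_borelD(1,2)[OF f1] bounded_borelD(1,2)[OF f2] _ M])
    fix p :: "'a clifford \<Rightarrow> real" assume p: "bounded_linear p"
    \<comment> \<open>On the plane every real linear functional is a combination of real and
      imaginary part, so two integrals decide the hypothesis of
      \<open>pvm_uniqueness\<close>.\<close>
    have eq: "p c = p cl_one * cl_re c + p \<II> * cl_im \<II> c" if "c \<in> cplane \<II>" for c
    proof -
      have "p c = p (cl_re c *\<^sub>R cl_one + cl_im \<II> c *\<^sub>R \<II>)"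
        by (rule arg_cong[OF cplane_eq[OF A.unit that]])
      then show ?thesis
        by (simp add: linear_add[OF bounded_linear.linear[OF p]] linear_scale[OF bounded_linear.linear[OF p]])
    qed
    have "A.rint (\<lambda>l. p (f1 l)) = A.rint (\<lambda>l. p cl_one * cl_re (f1 l) + p \<II> * cl_im \<II> (f1 l))"
      by (rule A.rint_cong, rule eq) (rule A.BB_cplane[OF f1])
    also have "\<dots> = B.rint (\<lambda>l. p cl_one * cl_re (f2 l) + p \<II> * cl_im \<II> (f2 l))"
      by (simp add: A.rint_add B.rint_add A.rint_scale B.rint_scale bmeas_scale
          A.BB_bmeas[OF f1] B.BB_bmeas[OF f2] re im)
    also have "\<dots> = B.rint (\<lambda>l. p (f2 l))"
      by (rule B.rint_cong, rule eq[symmetric]) (rule B.BB_cplane[OF f2])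
    finally show "A.rint (\<lambda>l. p (f1 l)) = B.rint (\<lambda>l. p (f2 l))" .
  qed
qed

text \<open>Taking adjoints changes the sign of the second summand, so sum and difference with the
  adjoint separate the two. The imaginary part is obtained only in combination with its imaginary
  operator.\<close>

lemma sint_parts_unique:
  assumes "clifford_spectral \<II> S1 E1 J1" "clifford_spectral \<II> S2 E2 J2"
    and f1: "f1 \<in> bounded_borel \<II> S1" and f2: "f2 \<in> bounded_borel \<II> S2"
    and eq: "clifford_spectral.sint \<II> S1 E1 J1 f1 = clifford_spectral.sint \<II> S2 E2 J2 f2"
  shows "pvm.rint S1 E1 (\<lambda>l. cl_re (f1 l)) = pvm.rint S2 E2 (\<lambda>l. cl_re (f2 l))"
    and "pvm.rint S1 E1 (\<lambda>l. cl_im \<II> (f1 l)) (J1 x) = pvm.rint S2 E2 (\<lambda>l. cl_im \<II> (f2 l)) (J2 x)"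
proof -
  interpret A: clifford_spectral \<II> S1 E1 J1 by fact
  interpret B: clifford_spectral \<II> S2 E2 J2 by fact
  have conj: "A.sint (\<lambda>l. cl_conj (f1 l)) = B.sint (\<lambda>l. cl_conj (f2 l))"
    using A.cl_adjoint_sint[OF f1] B.cl_adjoint_sint[OF f2] eq by simp
  have half: "u = v \<and> w = z" if "u + w = v + z" "u - w = v - z" for u v w z :: "('c, 'a) cmodule"
  proof -
    have "2 *\<^sub>R u = 2 *\<^sub>R v"
      using arg_cong2[OF that, of "(+)"] by (simp add: scaleR_2)
    then show ?thesis using that by simp
  qed
  have parts: "A.rint (\<lambda>l. cl_re (f1 l)) x = B.rint (\<lambda>l. cl_re (f2 l)) x \<and>
      A.rint (\<lambda>l. cl_im \<II> (f1 l)) (J1 x) = B.rint (\<lambda>l. cl_im \<II> (f2 l)) (J2 x)" for x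
  proof (rule half)
    show "A.rint (\<lambda>l. cl_re (f1 l)) x + A.rint (\<lambda>l. cl_im \<II> (f1 l)) (J1 x) =
        B.rint (\<lambda>l. cl_re (f2 l)) x + B.rint (\<lambda>l. cl_im \<II> (f2 l)) (J2 x)"
      using arg_cong[OF eq, of "\<lambda>T. blinfun_apply T x"] by (simp add: A.sint_apply B.sint_apply)
    show "A.rint (\<lambda>l. cl_re (f1 l)) x - A.rint (\<lambda>l. cl_im \<II> (f1 l)) (J1 x) =
        B.rint (\<lambda>l. cl_re (f2 l)) x - B.rint (\<lambda>l. cl_im \<II> (f2 l)) (J2 x)"
      using arg_cong[OF conj, of "\<lambda>T. blinfun_apply T x"]
      by (simp add: A.sint_conj_eq[OF f1] B.sint_conj_eq[OF f2] blinfun.diff_left)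
  qed
  then show "A.rint (\<lambda>l. cl_re (f1 l)) = B.rint (\<lambda>l. cl_re (f2 l))"
    "A.rint (\<lambda>l. cl_im \<II> (f1 l)) (J1 x) = B.rint (\<lambda>l. cl_im \<II> (f2 l)) (J2 x)"
    by (auto intro: blinfun_eqI)
qed

context clifford_spectral
begin

text \<open>For G the identity is only essentially bounded. Cutting it off on a G-null set N gives a
  bounded g whose preimages agree with the sets themselves up to N.\<close>

lemma plane_representation_unique:
  assumes f: "f \<in> BB" and G: "represents_on_plane \<II> (sint f) J G"
    and M: "M \<in> sets borel" "M \<subseteq> cplane \<II>"
  shows "G M = E (f -` M \<inter> space S)"
proof -
  define Sp where "Sp = restrict_space (borel :: 'n clifford measure) (cplane \<II>)"
  have sp: "space Sp = cplane \<II>"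
    by (simp add: Sp_def space_restrict_space)
  interpret B: clifford_spectral \<II> Sp G J
    using G unit imaginary by unfold_locales (auto simp: represents_on_plane_def Sp_def)
  have Linf: "(\<lambda>l. l) \<in> Linf \<II> Sp G" and T: "sint f = spectral_integral_Linf \<II> Sp G J (\<lambda>l. l)"
    using G by (auto simp: represents_on_plane_def Sp_def)
  obtain N where N: "N \<in> sets Sp" "G N = 0" "bounded (space Sp - N)"
    using Linf by (auto simp: Linf_def)
  define g :: "'n clifford \<Rightarrow> 'n clifford" where "g l = indicator (space Sp - N) l *\<^sub>R l" for l
  have g: "g \<in> bounded_borel \<II> Sp"
    unfolding bounded_borel_def mem_Collect_eq
  proof (intro conjI)
    have "(\<lambda>l. l) \<in> borel_measurable Sp"
      unfolding Sp_def by (rule measurable_restrict_space1) simp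
    then show "g \<in> borel_measurable Sp"
      unfolding g_def using N(1) by (intro borel_measurable_scaleR borel_measurable_indicator) auto
    show "g ` space Sp \<subseteq> cplane \<II>"
      by (auto simp: g_def sp cplane_scaleR[OF unit])
    obtain c where c: "\<And>l. l \<in> space Sp - N \<Longrightarrow> norm l \<le> c"
      using N(3) by (auto simp: bounded_iff)
    have "norm (g l) \<le> max c 0" for l
      using c[of l] by (auto simp: g_def indicator_def)
    then show "bounded (g ` space Sp)"
      unfolding bounded_iff by blast
  qed
  have gAE: "g l = l" if "l \<in> space Sp - N" for l
    using that by (simp add: g_def)
  then have "spectral_AE Sp G (\<lambda>l. g l = l)"
    unfolding spectral_AE_def using N by blast
  then have eq: "B.sint g = sint f"
    unfolding T by (rule B.spectral_integral_Linf_eq[OF g, symmetric])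
  note parts = sint_parts_unique[OF B.clifford_spectral_axioms clifford_spectral_axioms g f eq]
  have "B.rint (\<lambda>l. cl_im \<II> (g l)) = rint (\<lambda>l. cl_im \<II> (f l))"
  proof (rule blinfun_eqI)
    \<comment> \<open>The same J stands on both sides, and J (- J x) = x, so evaluating at - J x
      removes it.\<close>
    fix x show "B.rint (\<lambda>l. cl_im \<II> (g l)) x = rint (\<lambda>l. cl_im \<II> (f l)) x"
      using parts(2)[of "- J x"] by (simp add: blinfun.minus_right)
  qed
  then have "G (g -` M \<inter> space Sp) = E (f -` M \<inter> space S)"
    by (rule clifford_spectral_unique[OF B.clifford_spectral_axioms clifford_spectral_axioms g f parts(1) _ M(1)])
  moreover have "G M = G (g -` M \<inter> space Sp)"
  proof (rule B.E_cong_null[OF _ _ N(1,2)])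
    show "M \<in> sets Sp"
      unfolding Sp_def sets_restrict_space using M by (auto intro!: image_eqI[of _ _ M])
    show "g -` M \<inter> space Sp \<in> sets Sp"
      by (rule measurable_sets[OF bounded_borelD(1)[OF g] M(1)])
  qed (auto simp: gAE)
  ultimately show ?thesis by simp
qed

text \<open>Here J' may differ from J, so neither can be cancelled. The two imaginary parts are
  positive operators, as \<Omega> and almost all values of f lie in the upper half plane, and are
  compared through their squares.\<close>

lemma upper_representation_unique:
  assumes f: "f \<in> BB" and up: "spectral_AE S E (\<lambda>l. f l \<in> cplane_upper \<II>)"
    and E': "is_spectral_measure_of \<II> (sint f) E'" and M: "M \<in> sets borel"
  shows "E' (M \<inter> S_spectrum (sint f) \<inter> cplane_upper \<II>) = E (f -` M \<inter> space S)"
proof -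
  define \<Omega> where "\<Omega> = S_spectrum (sint f) \<inter> cplane_upper \<II>"
  note \<Omega> = upper_spectrum[OF f up, folded \<Omega>_def]
  define S' where "S' = restrict_space borel \<Omega>"
  have spS': "spectral_space \<II> (sint f) = S'"
    by (simp add: spectral_space_def S'_def \<Omega>_def)
  have space: "space S' = \<Omega>"
    by (simp add: S'_def space_restrict_space)
  obtain J' where J': "polar_imaginary (sint f) J'" "represents \<II> (sint f) J' E'"
    using E' by (auto simp: is_spectral_measure_of_def)
  interpret B: clifford_spectral \<II> S' E' J'
    using J' unit by unfold_locales (auto simp: represents_def polar_imaginary_def spS')
  have "(\<lambda>l. l) \<in> borel_measurable S'"
    unfolding S'_def by (rule measurable_restrict_space1) simp
  moreover have "\<Omega> \<subseteq> cplane \<II>"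
    by (auto simp: \<Omega>_def cplane_upper_iff[OF unit])
  ultimately have id: "(\<lambda>l. l) \<in> bounded_borel \<II> S'"
    using \<Omega>(3) by (simp add: bounded_borel_def space)
  have eq: "B.sint (\<lambda>l. l) = sint f"
    using J'(2) B.spectral_integral_eq[OF id] by (simp add: represents_def spS')
  note parts = sint_parts_unique[OF B.clifford_spectral_axioms clifford_spectral_axioms id f eq]
  let ?P = "B.rint (\<lambda>l. cl_im \<II> l)" and ?Q = "rint (\<lambda>l. cl_im \<II> (f l))"
  note b = B.BB_bmeas(2)[OF id] BB_bmeas(2)[OF f]
  have "?P = ?Q"
  proof (rule positive_sqrt_unique)
    show "symmetric_op ?P" "symmetric_op ?Q"
      by (intro B.rint_symmetric rint_symmetric b)+
    show "positive_op ?P"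
      by (rule B.rint_positive[OF b(1)]) (auto simp: space \<Omega>_def cplane_upper_iff[OF unit])
    show "positive_op ?Q"
      unfolding rint_im_abs(1)[OF f up, symmetric] by (rule rint_positive[OF rint_im_abs(2)[OF f up]]) simp
    show "?P o\<^sub>L ?P = ?Q o\<^sub>L ?Q"
    proof (rule blinfun_eqI)
      fix x
      \<comment> \<open>Applying the identity for the imaginary parts twice makes both imaginary
        operators disappear, since each commutes with its integral and squares to -1.\<close>
      have "?P (J' (?P (J' x))) = ?Q (J (?Q (J x)))"
        by (simp add: parts(2))
      then show "(?P o\<^sub>L ?P) x = (?Q o\<^sub>L ?Q) x"
        by (simp add: B.J_rint[OF b(1)] J_rint[OF b(2)] blinfun.minus_right)
    qed
  qed
  then have "E' ((\<lambda>l. l) -` M \<inter> space S') = E (f -` M \<inter> space S)"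
    by (rule clifford_spectral_unique[OF B.clifford_spectral_axioms clifford_spectral_axioms id f parts(1) _ M])
  then show ?thesis
    by (simp add: space \<Omega>_def Int_assoc)
qed

end

theorem corollary9p0p4:
  fixes T J :: "('h::{real_inner,banach}, 'n::{finite,linorder}) cop"
    and \<II> :: "'n clifford"
    and E :: "'n clifford set \<Rightarrow> ('h, 'n) cop"
    and \<Omega> :: "'n clifford set"
    and S :: "'n clifford measure"
    and I :: "('n clifford \<Rightarrow> 'n clifford) \<Rightarrow> ('h, 'n) cop"
    and f g :: "'n clifford \<Rightarrow> 'n clifford"
  assumes T: "T \<in> cl_ops" "cl_normal T"
    and \<II>: "\<II> \<in> cl_sphere"
    and J: "polar_imaginary T J"
    and E: "represents \<II> T J E"
    and \<Omega>: "\<Omega> = S_spectrum T \<inter> cplane_upper \<II>"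
    and S: "S = restrict_space borel \<Omega>"
    and I: "I = spectral_integral \<II> S E J"
    and f: "f \<in> bounded_borel \<II> S"
    and g: "g \<in> bounded_borel \<II> S"
  shows
    "I f \<in> cl_ops \<and> cl_normal (I f) \<and> I g \<in> cl_ops \<and> cl_normal (I g) \<and>
     \<comment> \<open>(i)\<close>
     I (\<lambda>l. cl_conj (f l)) = cl_adjoint (I f) \<and>
     \<comment> \<open>(ii)\<close>
     I (\<lambda>l. f l \<odot> g l) = I f o\<^sub>L I g \<and>
     \<comment> \<open>(iii)\<close>
     I (\<lambda>l. \<II>) = J \<and>
     (\<forall>c\<in>cplane \<II>. I (\<lambda>l. c \<odot> f l + g l) =
        ((cl_re c *\<^sub>R id_blinfun + cl_im \<II> c *\<^sub>R J) o\<^sub>L I f) + I g) \<and>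
     \<comment> \<open>(iv)\<close>
     (\<forall>x y. cl_inner (I f x) y =
        cl_integral S (\<lambda>M. cl_inner (E M x) y) (\<lambda>l. cl_re (f l)) +
        cl_integral S (\<lambda>M. cl_inner (J (E M x)) y) (\<lambda>l. cl_im \<II> (f l))) \<and>
     \<comment> \<open>(v)\<close>
     (\<forall>x. (norm (I f x))\<^sup>2 =
        (\<integral>l. (norm (f l))\<^sup>2 \<partial>measure_of (space S) (sets S)
                                 (\<lambda>M. ennreal (cl_re (cl_inner (E M x) x))))) \<and>
     \<comment> \<open>(vi)\<close>
     ennreal (norm (I f)) \<le> (SUP l\<in>\<Omega>. ennreal (norm (f l))) \<and>
     (ennreal (norm (I f)) = Linf_norm S E f \<longleftrightarrow> f \<in> Linf \<II> S E) \<and>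
     \<comment> \<open>(vii)\<close>
     (\<forall>(F :: nat \<Rightarrow> 'n clifford \<Rightarrow> 'n clifford) \<kappa>.
        (\<forall>j. F j \<in> bounded_borel \<II> S) \<longrightarrow>
        spectral_AE S E (\<lambda>l. (\<lambda>j. F j l) \<longlonglongrightarrow> f l) \<longrightarrow>
        \<kappa> > 0 \<longrightarrow> (\<forall>l\<in>\<Omega>. \<forall>j. norm (F j l) \<le> \<kappa>) \<longrightarrow>
        (\<forall>x. (\<lambda>j. I (F j) x) \<longlonglongrightarrow> I f x)) \<and>
     \<comment> \<open>(viii)\<close>
     (\<forall>x y. cl_inner (I f x) y =
        cl_integral_right \<II> S (\<lambda>M. cl_inner (E M (Pi_plus J \<II> x)) y) f +
        cl_integral_right \<II> S (\<lambda>M. cl_inner (E M (Pi_minus J \<II> x)) y) (\<lambda>l. cl_conj (f l))) \<and>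
     \<comment> \<open>(ix)\<close>
     (spectral_AE S E (\<lambda>l. \<exists>r\<ge>0. f l = r *\<^sub>R cl_one) \<longrightarrow> cl_positive (I f)) \<and>
     \<comment> \<open>(x)\<close>
     ((\<exists>R. cl_inverse_op (I f) R) \<longleftrightarrow>
        spectral_AE S E (\<lambda>l. f l \<noteq> 0) \<and> (\<lambda>l. cl_inverse (f l)) \<in> Linf \<II> S E) \<and>
     (\<forall>R. cl_inverse_op (I f) R \<longrightarrow>
        R = spectral_integral_Linf \<II> S E J (\<lambda>l. cl_inverse (f l))) \<and>
     \<comment> \<open>(xi), as the spectral measure on the upper half plane\<close>
     (spectral_AE S E (\<lambda>l. f l \<in> cplane_upper \<II>) \<longrightarrow>
        (\<exists>E'. is_spectral_measure_of \<II> (I f) E') \<and>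
        (\<forall>E'. is_spectral_measure_of \<II> (I f) E' \<longrightarrow>
          (\<forall>M\<in>sets borel. M \<subseteq> cplane_upper \<II> \<longrightarrow>
             E' (M \<inter> S_spectrum (I f)) = E (f -` (M \<inter> f ` \<Omega>) \<inter> \<Omega>)))) \<and>
     \<comment> \<open>(xi), as the spectral measure on the whole plane relative to J\<close>
     (\<exists>G. represents_on_plane \<II> (I f) J G) \<and>
     (\<forall>G. represents_on_plane \<II> (I f) J G \<longrightarrow>
        (\<forall>M\<in>sets borel. M \<subseteq> cplane \<II> \<longrightarrow> G M = E (f -` (M \<inter> f ` \<Omega>) \<inter> \<Omega>)))"
proof -
  have spS: "spectral_space \<II> T = S"
    by (simp add: spectral_space_def S \<Omega>)
  interpret clifford_spectral \<II> S E J
    using \<II> J E by unfold_locales (simp_all add: represents_def polar_imaginary_def spS)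
  have sp: "space S = \<Omega>"
    by (simp add: S space_restrict_space)
  have I_eq: "I h = sint h" if "h \<in> BB" for h
    unfolding I using that by (rule spectral_integral_eq)
  have If: "I f = sint f" and Ig: "I g = sint g"
    using f g by (simp_all add: I_eq)
  have const: "(\<lambda>l. c) \<in> BB" if "c \<in> cplane \<II>" for c
    using that by (rule bounded_borel_const[OF \<II>])
  have preimage: "f -` (M \<inter> f ` \<Omega>) \<inter> \<Omega> = f -` M \<inter> space S" for M
    by (auto simp: sp)
  have ops: "I f \<in> cl_ops" "cl_normal (I f)" "I g \<in> cl_ops" "cl_normal (I g)"
    unfolding If Ig using f g by (simp_all add: sint_ops cl_normal_sint)
  have i: "I (\<lambda>l. cl_conj (f l)) = cl_adjoint (I f)"
    using f by (simp add: I_eq bounded_borel_conj[OF \<II>] cl_adjoint_sint)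
  have ii: "I (\<lambda>l. f l \<odot> g l) = I f o\<^sub>L I g"
    using f g by (simp add: I_eq bounded_borel_mult[OF \<II>] sint_mult)
  have iii: "I (\<lambda>l. \<II>) = J"
    by (simp add: I_eq const cplane_unit[OF \<II>] sint_unit)
  have iii': "\<forall>c\<in>cplane \<II>. I (\<lambda>l. c \<odot> f l + g l) =
      ((cl_re c *\<^sub>R id_blinfun + cl_im \<II> c *\<^sub>R J) o\<^sub>L I f) + I g"
  proof
    fix c assume c: "c \<in> cplane \<II>"
    have "sint (\<lambda>l. c) = cl_re c *\<^sub>R id_blinfun + cl_im \<II> c *\<^sub>R J"
      by (rule blinfun_eqI) (simp add: sint_apply rint_const blinfun.bilinear_simps)
    then show "I (\<lambda>l. c \<odot> f l + g l) = ((cl_re c *\<^sub>R id_blinfun + cl_im \<II> c *\<^sub>R J) o\<^sub>L I f) + I g"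
      using f g by (simp add: I_eq bounded_borel_mult[OF \<II>] bounded_borel_add[OF \<II>] const[OF c] sint_add sint_mult)
  qed
  have iv: "\<forall>x y. cl_inner (I f x) y =
      cl_integral S (\<lambda>M. cl_inner (E M x) y) (\<lambda>l. cl_re (f l)) +
      cl_integral S (\<lambda>M. cl_inner (J (E M x)) y) (\<lambda>l. cl_im \<II> (f l))"
    using BB_bmeas[OF f] by (simp add: If sint_apply cl_inner_add_left cl_integral_rint cl_integral_rint_J)
  have v: "\<forall>x. (norm (I f x))\<^sup>2 =
      (\<integral>l. (norm (f l))\<^sup>2 \<partial>measure_of (space S) (sets S) (\<lambda>M. ennreal (cl_re (cl_inner (E M x) x))))"
    unfolding cl_re_inner If using norm_sint[OF f] by (simp add: quad_measure_def)
  have vi: "ennreal (norm (I f)) \<le> (SUP l\<in>\<Omega>. ennreal (norm (f l)))"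
    using norm_sint_sup[OF f, of "{}"] by (simp add: If sp)
  \<comment> \<open>For bounded f both sides of the equivalence hold.\<close>
  have vi': "ennreal (norm (I f)) = Linf_norm S E f \<longleftrightarrow> f \<in> Linf \<II> S E"
    using BB_Linf[OF f] by (simp add: If Linf_norm_sint[OF f])
  have vii: "\<forall>(F :: nat \<Rightarrow> 'n clifford \<Rightarrow> 'n clifford) \<kappa>.
      (\<forall>j. F j \<in> bounded_borel \<II> S) \<longrightarrow>
      spectral_AE S E (\<lambda>l. (\<lambda>j. F j l) \<longlonglongrightarrow> f l) \<longrightarrow>
      \<kappa> > 0 \<longrightarrow> (\<forall>l\<in>\<Omega>. \<forall>j. norm (F j l) \<le> \<kappa>) \<longrightarrow>
      (\<forall>x. (\<lambda>j. I (F j) x) \<longlonglongrightarrow> I f x)"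
  proof (intro allI impI)
    fix F :: "nat \<Rightarrow> 'n clifford \<Rightarrow> 'n clifford" and \<kappa> x
    assume F: "\<forall>j. F j \<in> BB" "spectral_AE S E (\<lambda>l. (\<lambda>j. F j l) \<longlonglongrightarrow> f l)"
      and \<kappa>: "\<forall>l\<in>\<Omega>. \<forall>j. norm (F j l) \<le> \<kappa>"
    then have "(\<lambda>j. sint (F j) x) \<longlonglongrightarrow> sint f x"
      by (intro sint_dominated_convergence[OF _ f, where \<kappa> = \<kappa>]) (auto simp: sp)
    then show "(\<lambda>j. I (F j) x) \<longlonglongrightarrow> I f x"
      using F(1) by (simp add: If I_eq)
  qed
  have viii: "\<forall>x y. cl_inner (I f x) y =
      cl_integral_right \<II> S (\<lambda>M. cl_inner (E M (Pi_plus J \<II> x)) y) f +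
      cl_integral_right \<II> S (\<lambda>M. cl_inner (E M (Pi_minus J \<II> x)) y) (\<lambda>l. cl_conj (f l))"
    unfolding If using sint_decomposition[OF f] by blast
  have ix: "spectral_AE S E (\<lambda>l. \<exists>r\<ge>0. f l = r *\<^sub>R cl_one) \<longrightarrow> cl_positive (I f)"
    unfolding If using cl_positive_sint[OF f] by blast
  have x: "(\<exists>R. cl_inverse_op (I f) R) \<longleftrightarrow>
      spectral_AE S E (\<lambda>l. f l \<noteq> 0) \<and> (\<lambda>l. cl_inverse (f l)) \<in> Linf \<II> S E"
    unfolding If by (rule sint_invertible_iff[OF f])
  have x': "\<forall>R. cl_inverse_op (I f) R \<longrightarrow>
      R = spectral_integral_Linf \<II> S E J (\<lambda>l. cl_inverse (f l))"
    unfolding If using cl_inverse_op_sint[OF f] by blast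
  \<comment> \<open>A spectral measure in the sense of \<open>is_spectral_measure_of\<close> has
    full mass in the upper half plane, so the image of E under f can agree with it only if f has
    almost all its values there.\<close>
  have xi: "spectral_AE S E (\<lambda>l. f l \<in> cplane_upper \<II>) \<longrightarrow>
      (\<exists>E'. is_spectral_measure_of \<II> (I f) E') \<and>
      (\<forall>E'. is_spectral_measure_of \<II> (I f) E' \<longrightarrow>
        (\<forall>M\<in>sets borel. M \<subseteq> cplane_upper \<II> \<longrightarrow>
           E' (M \<inter> S_spectrum (I f)) = E (f -` (M \<inter> f ` \<Omega>) \<inter> \<Omega>)))"
  proof (intro impI conjI allI ballI)
    assume up: "spectral_AE S E (\<lambda>l. f l \<in> cplane_upper \<II>)"
    show "\<exists>E'. is_spectral_measure_of \<II> (I f) E'"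
      unfolding If is_spectral_measure_of_def
      using polar_imaginary_sint[OF f up] upper_representation[OF f up] by blast
    fix E' M assume E': "is_spectral_measure_of \<II> (I f) E'" and M: "M \<in> sets borel" "M \<subseteq> cplane_upper \<II>"
    have "M \<inter> S_spectrum (I f) \<inter> cplane_upper \<II> = M \<inter> S_spectrum (I f)"
      using M(2) by blast
    then show "E' (M \<inter> S_spectrum (I f)) = E (f -` (M \<inter> f ` \<Omega>) \<inter> \<Omega>)"
      using upper_representation_unique[OF f up E'[unfolded If] M(1)] unfolding preimage If by simp
  qed
  \<comment> \<open>Here f ranges over the whole plane. Since f with J and conj f with - J have the
    same integral, the imaginary operator has to be prescribed.\<close>
  have xi': "\<exists>G. represents_on_plane \<II> (I f) J G"
    unfolding If using plane_representation[OF f] by blast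
  have xi'': "\<forall>G. represents_on_plane \<II> (I f) J G \<longrightarrow>
      (\<forall>M\<in>sets borel. M \<subseteq> cplane \<II> \<longrightarrow> G M = E (f -` (M \<inter> f ` \<Omega>) \<inter> \<Omega>))"
    unfolding If preimage using plane_representation_unique[OF f] by blast
  show ?thesis
    by (intro conjI; fact ops i ii iii iii' iv v vi vi' vii viii ix x x' xi xi' xi'')
qed

end
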